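(* Let $X$ be a compact strict LCK manifold, let $C\subset X$ be a rational curve (that is, a closed analytic subspace whose normalisation is the projective line $\mathbb{P}^1$), and let $Y$ be a compact complex manifold with $\dim Y>0$. Then the product $M:=X\times Y$ does not admit a strict LCK structure.
   Context: Convention: complex manifolds are connected. A Hermitian manifold $(M,I,g,\omega)$, with $\dim_{\mathbb{C}} M \geq 2$ and $\omega(\cdot,\cdot)=g(I\cdot,\cdot)$, is locally conformally Kähler (LCK) if there exists a closed 1-form $\theta$ (the Lee form) such that $d\omega=\theta\wedge\omega$. If $\theta$ is exact, the structure is called globally conformally Kähler (GCK); an LCK structure which is not GCK is called strict. A strict LCK manifold is a complex manifold equipped with a strict LCK structure. The product $X\times Y$ carries the product complex structure. *)

theory Defs
  imports "HOL-Analysis.Analysis"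
begin

section \<open>Differentiability on open subsets of the model spaces\<close>

primrec Ck_on :: "nat \<Rightarrow> 'e::real_normed_vector set \<Rightarrow> ('e \<Rightarrow> 'f::real_normed_vector) \<Rightarrow> bool" where
  "Ck_on 0 S f \<longleftrightarrow> continuous_on S f"
| "Ck_on (Suc k) S f \<longleftrightarrow>
     (\<forall>x\<in>S. f differentiable (at x)) \<and> (\<forall>v. Ck_on k S (\<lambda>x. frechet_derivative f (at x) v))"

definition smooth_on :: "'e::real_normed_vector set \<Rightarrow> ('e \<Rightarrow> 'f::real_normed_vector) \<Rightarrow> bool" where
  "smooth_on S f \<longleftrightarrow> (\<forall>k. Ck_on k S f)"

text \<open>Holomorphic functions of several variables: totally differentiable, with
  \<open>\<complex>\<close>-linear differential. Both predicates are used for open \<open>S\<close> only.\<close>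

definition cfun_holomorphic_on :: "(complex^'n \<Rightarrow> complex) \<Rightarrow> (complex^'n) set \<Rightarrow> bool" where
  "cfun_holomorphic_on f S \<longleftrightarrow>
     (\<forall>x\<in>S. \<exists>D. (f has_derivative D) (at x) \<and> (\<forall>c v. D (c *s v) = c * D v))"

definition cmap_holomorphic_on :: "(complex^'n \<Rightarrow> complex^'m) \<Rightarrow> (complex^'n) set \<Rightarrow> bool" where
  "cmap_holomorphic_on f S \<longleftrightarrow>
     (\<forall>x\<in>S. \<exists>D. (f has_derivative D) (at x) \<and> (\<forall>c v. D (c *s v) = c *s D v))"

section \<open>Complex manifolds\<close>

text \<open>The dimension is \<open>CARD('n)\<close>; a chart is a pair of its domain and its coordinate map,
  the latter being relevant on the domain only.\<close>

type_synonym ('a, 'n) chart = "'a set \<times> ('a \<Rightarrow> complex^'n)"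

record ('a, 'n) cmfd =
  mtop :: "'a topology"
  atlas :: "('a set \<times> ('a \<Rightarrow> complex^('n::finite))) set"

definition chart_image :: "('a, 'n::finite) chart \<Rightarrow> (complex^'n) set" where
  "chart_image c = snd c ` fst c"

definition chart_inv :: "('a, 'n::finite) chart \<Rightarrow> complex^'n \<Rightarrow> 'a" where
  "chart_inv c = inv_into (fst c) (snd c)"

definition transition :: "('a, 'n::finite) chart \<Rightarrow> ('a, 'n) chart \<Rightarrow> complex^'n \<Rightarrow> complex^'n" where
  "transition c d = snd d \<circ> chart_inv c"

definition complex_manifold :: "('a, 'n::finite) cmfd \<Rightarrow> bool" where
  "complex_manifold M \<longleftrightarrow>
     topspace (mtop M) \<noteq> {} \<and> connected_space (mtop M) \<and>
     Hausdorff_space (mtop M) \<and> second_countable (mtop M) \<and>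
     (\<Union>c\<in>atlas M. fst c) = topspace (mtop M) \<and>
     (\<forall>c\<in>atlas M. openin (mtop M) (fst c) \<and> open (chart_image c) \<and>
        homeomorphic_map (subtopology (mtop M) (fst c)) (top_of_set (chart_image c)) (snd c)) \<and>
     (\<forall>c\<in>atlas M. \<forall>d\<in>atlas M. cmap_holomorphic_on (transition c d) (snd c ` (fst c \<inter> fst d)))"

definition vec_join :: "complex^'n \<Rightarrow> complex^'m \<Rightarrow> complex^('n + 'm)" where
  "vec_join u v = (\<chi> i. case i of Inl j \<Rightarrow> u $ j | Inr k \<Rightarrow> v $ k)"

definition prod_chart :: "('a, 'n::finite) chart \<Rightarrow> ('b, 'm::finite) chart \<Rightarrow> ('a \<times> 'b, 'n + 'm) chart" where
  "prod_chart c d = (fst c \<times> fst d, \<lambda>p. vec_join (snd c (fst p)) (snd d (snd p)))"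

definition prod_cmfd :: "('a, 'n::finite) cmfd \<Rightarrow> ('b, 'm::finite) cmfd \<Rightarrow> ('a \<times> 'b, 'n + 'm) cmfd" where
  "prod_cmfd X Y =
     \<lparr>mtop = prod_topology (mtop X) (mtop Y),
      atlas = (\<lambda>(c, d). prod_chart c d) ` (atlas X \<times> atlas Y)\<rparr>"

section \<open>Locally conformally Kaehler structures\<close>

text \<open>A covariant tensor field is given by its coordinate representations: one for each chart
  \<open>c\<close> of the atlas, defined on the image of \<open>c\<close> (values elsewhere are irrelevant), which are
  exchanged by pullback along the transition maps. Vectors are real tangent vectors, written
  in the coordinates of \<open>c\<close>, so that the complex structure \<open>I\<close> is \<open>v \<mapsto> \<i> *s v\<close>.\<close>

type_synonym ('a, 'n) field1 = "('a, 'n) chart \<Rightarrow> complex^'n \<Rightarrow> complex^'n \<Rightarrow> real"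
type_synonym ('a, 'n) field2 = "('a, 'n) chart \<Rightarrow> complex^'n \<Rightarrow> complex^'n \<Rightarrow> complex^'n \<Rightarrow> real"

definition smooth_one_form :: "('a, 'n::finite) cmfd \<Rightarrow> ('a, 'n) field1 \<Rightarrow> bool" where
  "smooth_one_form M \<theta> \<longleftrightarrow>
     (\<forall>c\<in>atlas M. (\<forall>x\<in>chart_image c. linear (\<theta> c x)) \<and>
                  (\<forall>v. smooth_on (chart_image c) (\<lambda>x. \<theta> c x v))) \<and>
     (\<forall>c\<in>atlas M. \<forall>d\<in>atlas M. \<forall>p\<in>fst c \<inter> fst d. \<forall>v.
        let T = frechet_derivative (transition c d) (at (snd c p))
        in \<theta> c (snd c p) v = \<theta> d (snd d p) (T v))"

definition smooth_bilinear_field :: "('a, 'n::finite) cmfd \<Rightarrow> ('a, 'n) field2 \<Rightarrow> bool" where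
  "smooth_bilinear_field M t \<longleftrightarrow>
     (\<forall>c\<in>atlas M. (\<forall>x\<in>chart_image c. bilinear (t c x)) \<and>
                  (\<forall>v w. smooth_on (chart_image c) (\<lambda>x. t c x v w))) \<and>
     (\<forall>c\<in>atlas M. \<forall>d\<in>atlas M. \<forall>p\<in>fst c \<inter> fst d. \<forall>v w.
        let T = frechet_derivative (transition c d) (at (snd c p))
        in t c (snd c p) v w = t d (snd d p) (T v) (T w))"

definition hermitian_metric :: "('a, 'n::finite) cmfd \<Rightarrow> ('a, 'n) field2 \<Rightarrow> bool" where
  "hermitian_metric M g \<longleftrightarrow>
     smooth_bilinear_field M g \<and>
     (\<forall>c\<in>atlas M. \<forall>x\<in>chart_image c.
        (\<forall>v w. g c x v w = g c x w v) \<and>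
        (\<forall>v. v \<noteq> 0 \<longrightarrow> g c x v v > 0) \<and>
        (\<forall>v w. g c x (\<i> *s v) (\<i> *s w) = g c x v w))"

definition fundamental_form :: "('a, 'n::finite) field2 \<Rightarrow> ('a, 'n) field2" where
  "fundamental_form g c x v w = g c x (\<i> *s v) w"

text \<open>Exterior derivatives of 1- and 2-forms and the wedge product of a 1-form with a 2-form, in
  coordinates and evaluated on constant vector fields. The normalisations are such that no
  factorials occur in either \<open>d\<close> or \<open>\<and>\<close>.\<close>

definition ext_deriv1 :: "('a, 'n::finite) field1 \<Rightarrow> ('a, 'n) field2" where
  "ext_deriv1 \<theta> c x u v =
     frechet_derivative (\<lambda>y. \<theta> c y v) (at x) u - frechet_derivative (\<lambda>y. \<theta> c y u) (at x) v"

definition ext_deriv2 ::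
  "('a, 'n::finite) field2 \<Rightarrow> ('a, 'n) chart \<Rightarrow> complex^'n \<Rightarrow> complex^'n \<Rightarrow> complex^'n \<Rightarrow> complex^'n \<Rightarrow> real"
where
  "ext_deriv2 \<omega> c x u v w =
     frechet_derivative (\<lambda>y. \<omega> c y v w) (at x) u
     - frechet_derivative (\<lambda>y. \<omega> c y u w) (at x) v
     + frechet_derivative (\<lambda>y. \<omega> c y u v) (at x) w"

definition wedge12 ::
  "('a, 'n::finite) field1 \<Rightarrow> ('a, 'n) field2
    \<Rightarrow> ('a, 'n) chart \<Rightarrow> complex^'n \<Rightarrow> complex^'n \<Rightarrow> complex^'n \<Rightarrow> complex^'n \<Rightarrow> real"
where
  "wedge12 \<theta> \<omega> c x u v w =
     \<theta> c x u * \<omega> c x v w - \<theta> c x v * \<omega> c x u w + \<theta> c x w * \<omega> c x u v"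

definition closed_one_form :: "('a, 'n::finite) cmfd \<Rightarrow> ('a, 'n) field1 \<Rightarrow> bool" where
  "closed_one_form M \<theta> \<longleftrightarrow> smooth_one_form M \<theta> \<and>
     (\<forall>c\<in>atlas M. \<forall>x\<in>chart_image c. \<forall>u v. ext_deriv1 \<theta> c x u v = 0)"

definition smooth_function :: "('a, 'n::finite) cmfd \<Rightarrow> ('a \<Rightarrow> real) \<Rightarrow> bool" where
  "smooth_function M f \<longleftrightarrow> (\<forall>c\<in>atlas M. smooth_on (chart_image c) (f \<circ> chart_inv c))"

definition exact_one_form :: "('a, 'n::finite) cmfd \<Rightarrow> ('a, 'n) field1 \<Rightarrow> bool" where
  "exact_one_form M \<theta> \<longleftrightarrow> smooth_one_form M \<theta> \<and>
     (\<exists>f. smooth_function M f \<and>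
        (\<forall>c\<in>atlas M. \<forall>x\<in>chart_image c. \<forall>v.
           \<theta> c x v = frechet_derivative (f \<circ> chart_inv c) (at x) v))"

definition lee_form :: "('a, 'n::finite) cmfd \<Rightarrow> ('a, 'n) field2 \<Rightarrow> ('a, 'n) field1 \<Rightarrow> bool" where
  "lee_form M g \<theta> \<longleftrightarrow> closed_one_form M \<theta> \<and>
     (\<forall>c\<in>atlas M. \<forall>x\<in>chart_image c. \<forall>u v w.
        ext_deriv2 (fundamental_form g) c x u v w = wedge12 \<theta> (fundamental_form g) c x u v w)"

definition LCK_structure :: "('a, 'n::finite) cmfd \<Rightarrow> ('a, 'n) field2 \<Rightarrow> bool" where
  "LCK_structure M g \<longleftrightarrow> 2 \<le> CARD('n) \<and> hermitian_metric M g \<and> (\<exists>\<theta>. lee_form M g \<theta>)"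

definition GCK_structure :: "('a, 'n::finite) cmfd \<Rightarrow> ('a, 'n) field2 \<Rightarrow> bool" where
  "GCK_structure M g \<longleftrightarrow>
     2 \<le> CARD('n) \<and> hermitian_metric M g \<and> (\<exists>\<theta>. lee_form M g \<theta> \<and> exact_one_form M \<theta>)"

definition strict_LCK_structure :: "('a, 'n::finite) cmfd \<Rightarrow> ('a, 'n) field2 \<Rightarrow> bool" where
  "strict_LCK_structure M g \<longleftrightarrow> LCK_structure M g \<and> \<not> GCK_structure M g"

section \<open>Rational curves\<close>

text \<open>Maps and functions on an open subset \<open>W\<close> of a manifold.\<close>

definition holomorphic_map_on ::
  "('a, 'n::finite) cmfd \<Rightarrow> 'a set \<Rightarrow> ('b, 'm::finite) cmfd \<Rightarrow> ('a \<Rightarrow> 'b) \<Rightarrow> bool"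
where
  "holomorphic_map_on M W N f \<longleftrightarrow>
     continuous_map (subtopology (mtop M) W) (mtop N) f \<and>
     (\<forall>c\<in>atlas M. \<forall>d\<in>atlas N.
        cmap_holomorphic_on (snd d \<circ> f \<circ> chart_inv c) (snd c ` {p \<in> fst c \<inter> W. f p \<in> fst d}))"

abbreviation holomorphic_map ::
  "('a, 'n::finite) cmfd \<Rightarrow> ('b, 'm::finite) cmfd \<Rightarrow> ('a \<Rightarrow> 'b) \<Rightarrow> bool"
where
  "holomorphic_map M N f \<equiv> holomorphic_map_on M (topspace (mtop M)) N f"

definition holomorphic_function_on :: "('a, 'n::finite) cmfd \<Rightarrow> 'a set \<Rightarrow> ('a \<Rightarrow> complex) \<Rightarrow> bool" where
  "holomorphic_function_on M W f \<longleftrightarrow>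
     (\<forall>c\<in>atlas M. cfun_holomorphic_on (f \<circ> chart_inv c) (snd c ` (fst c \<inter> W)))"

definition analytic_subset :: "('a, 'n::finite) cmfd \<Rightarrow> 'a set \<Rightarrow> bool" where
  "analytic_subset M A \<longleftrightarrow> A \<subseteq> topspace (mtop M) \<and>
     (\<forall>p\<in>topspace (mtop M). \<exists>W F. openin (mtop M) W \<and> p \<in> W \<and> finite F \<and>
        (\<forall>f\<in>F. holomorphic_function_on M W f) \<and> A \<inter> W = {q \<in> W. \<forall>f\<in>F. f q = 0})"

text \<open>The manifold \<open>N\<close>, which is in particular a normal complex space, together with \<open>\<nu>\<close> is the
  normalisation of the (reduced) analytic subset \<open>A\<close> of \<open>M\<close>: the map \<open>\<nu>\<close> is finite, onto \<open>A\<close>, and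
  biholomorphic off a nowhere dense analytic subset \<open>T\<close> of \<open>A\<close> with nowhere dense preimage.
  As for any reduced complex subspace, holomorphy of the inverse on \<open>A - T\<close> means that it
  extends locally to a holomorphic map on an open subset of \<open>M\<close>.\<close>

definition is_normalisation ::
  "('a, 'n::finite) cmfd \<Rightarrow> 'a set \<Rightarrow> ('b, 'm::finite) cmfd \<Rightarrow> ('b \<Rightarrow> 'a) \<Rightarrow> bool"
where
  "is_normalisation M A N \<nu> \<longleftrightarrow>
     holomorphic_map N M \<nu> \<and> \<nu> ` topspace (mtop N) = A \<and>
     proper_map (mtop N) (subtopology (mtop M) A) \<nu> \<and>
     (\<forall>q\<in>A. finite {p \<in> topspace (mtop N). \<nu> p = q}) \<and>
     (\<exists>T. analytic_subset M T \<and> T \<subseteq> A \<and> A \<subseteq> mtop M closure_of (A - T) \<and>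
        mtop N closure_of {p \<in> topspace (mtop N). \<nu> p \<notin> T} = topspace (mtop N) \<and>
        (\<forall>q\<in>A - T. \<exists>W h. openin (mtop M) W \<and> q \<in> W \<and> holomorphic_map_on M W N h \<and>
           (\<forall>p\<in>topspace (mtop N). \<nu> p \<in> W \<longrightarrow> h (\<nu> p) = p)))"

text \<open>The projective line as \<open>\<complex> \<union> {\<infinity>}\<close>, with \<open>None\<close> for \<open>\<infinity>\<close>.\<close>

definition proj_line :: "(complex option, 1) cmfd" where
  "proj_line =
     \<lparr>mtop = Alexandroff_compactification euclidean,
      atlas = {(- {None}, \<lambda>p. vec (case p of None \<Rightarrow> 0 | Some z \<Rightarrow> z)),
               (- {Some 0}, \<lambda>p. vec (case p of None \<Rightarrow> 0 | Some z \<Rightarrow> 1 / z))}\<rparr>"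

definition rational_curve :: "('a, 'n::finite) cmfd \<Rightarrow> 'a set \<Rightarrow> bool" where
  "rational_curve M C \<longleftrightarrow> analytic_subset M C \<and> (\<exists>\<nu>. is_normalisation M C proj_line \<nu>)"

end

theory Submission
  imports Defs "HOL-Complex_Analysis.Cauchy_Integral_Formula"
begin

text \<open>Let \<open>\<omega>\<close> be an LCK form on \<open>X \<times> Y\<close> with Lee form \<open>\<theta>\<close>. If \<open>df = \<theta>\<close> on an open set, then
  \<open>exp (-f) \<omega>\<close> is closed there, so by Stokes the integral of this form, or of its top power, over
  the fibres of a family of compact submanifolds is locally constant. Since \<open>\<theta>\<close> is exact along
  the sphere \<open>\<nu> : P\<^sup>1 \<rightarrow> X\<close>, integration over the spheres \<open>\<nu>(P\<^sup>1) \<times> {y}\<close> produces a primitive of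
  \<open>\<theta>\<close> on one slice \<open>{x} \<times> Y\<close>, and hence on all of them, as \<open>X\<close> is connected. A primitive on the
  slice through \<open>x\<close> is unique up to a constant, and normalising the volume of the slice with
  respect to \<open>exp (-f) \<omega>\<close> to be \<open>1\<close> fixes this constant in a way that gives a global primitive
  of \<open>\<theta>\<close>. So every LCK structure on \<open>X \<times> Y\<close> is GCK.\<close>

section \<open>Continuously differentiable maps and the Poincare lemma\<close>

text \<open>Two elementary substitutes for Stokes carry the argument. Over \<open>Y\<close>, the top
  power of the rescaled form is represented by the density \<open>sqrt |det A|\<close> of its Gram
  matrix \<open>A\<close> (the absolute Pfaffian), so neither exterior powers nor orientations
  enter. Along a path of slices its time derivative is a divergence, and divergences integrate to
  zero by a partition of unity. Over the sphere, polar coordinates lead to a rectangle: two edges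
  collapse to the poles, the other two are identified by periodicity. The same coordinates produce
  the primitive along the sphere: on the parameter plane one exists, and collapse at a pole makes it
  periodic. If \<open>H\<close> is a primitive near the sphere over \<open>y\<close>, and the
  primitive on each sphere is renormalised to vanish at the base point, the area becomes
  \<open>exp\<close> of \<open>H\<close> at the base point times a constant. This is why its
  logarithm is a primitive on the slice. On the slices, adding \<open>s\<close> to a primitive
  multiplies the volume \<open>V\<close> by \<open>exp (- m s)\<close>, with \<open>m\<close> the
  complex dimension of \<open>Y\<close>; hence the correction \<open>ln V / m\<close>.\<close>

definition C1_on :: "'e::euclidean_space set \<Rightarrow> ('e \<Rightarrow> 'f::real_normed_vector) \<Rightarrow> bool" where
  "C1_on S f \<longleftrightarrow> (\<forall>x\<in>S. f differentiable (at x)) \<and>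
     (\<forall>v. continuous_on S (\<lambda>x. frechet_derivative f (at x) v))"

lemma C1_onI:
  assumes "\<And>x. x \<in> S \<Longrightarrow> (f has_derivative f' x) (at x)"
    and "\<And>v. continuous_on S (\<lambda>x. f' x v)"
  shows "C1_on S f"
proof -
  have "frechet_derivative f (at x) = f' x" if "x \<in> S" for x
    using assms(1)[OF that] by (metis frechet_derivative_at)
  then show ?thesis
    unfolding C1_on_def using assms by (auto simp: differentiable_def cong: continuous_on_cong)
qed

lemma C1_on_has_derivative:
  "C1_on S f \<Longrightarrow> x \<in> S \<Longrightarrow> (f has_derivative frechet_derivative f (at x)) (at x)"
  unfolding C1_on_def by (simp add: frechet_derivative_works)

lemma C1_on_differentiable: "C1_on S f \<Longrightarrow> x \<in> S \<Longrightarrow> f differentiable (at x)"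
  unfolding C1_on_def by simp

lemma C1_on_continuous_derivative:
  "C1_on S f \<Longrightarrow> continuous_on S (\<lambda>x. frechet_derivative f (at x) v)"
  unfolding C1_on_def by simp

lemma C1_on_continuous_on: "C1_on S f \<Longrightarrow> continuous_on S f"
  by (meson C1_on_differentiable continuous_at_imp_continuous_on differentiable_imp_continuous_within)

lemma C1_on_subset: "C1_on T f \<Longrightarrow> S \<subseteq> T \<Longrightarrow> C1_on S f"
  unfolding C1_on_def by (meson continuous_on_subset subsetD)

text \<open>Differentiability and continuity of derivatives are local, and agreement on an open set
  transfers derivatives. This treats functions assembled from choices of charts or from cut-offs,
  for which no single formula holds on all of \<open>S\<close>.\<close>

lemma C1_on_local:
  assumes "\<And>x. x \<in> S \<Longrightarrow> \<exists>N g. open N \<and> x \<in> N \<and> C1_on N g \<and> (\<forall>y\<in>N. f y = g y)"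
  shows "C1_on S f"
proof -
  have *: "f differentiable (at x) \<and> isCont (\<lambda>x. frechet_derivative f (at x) v) x" if "x \<in> S" for x v
  proof -
    obtain N g where N: "open N" "x \<in> N" "C1_on N g" "\<forall>y\<in>N. f y = g y" using assms \<open>x \<in> S\<close> by metis
    have d: "(f has_derivative frechet_derivative g (at y)) (at y)" if "y \<in> N" for y
      using C1_on_has_derivative[OF N(3) that] N(1,4) that
      by (metis has_derivative_transform_within_open)
    then have eq: "frechet_derivative f (at y) v = frechet_derivative g (at y) v" if "y \<in> N" for y
      using frechet_derivative_at that by metis
    have "continuous_on N (\<lambda>x. frechet_derivative f (at x) v)"
      using C1_on_continuous_derivative[OF N(3)] eq by (simp cong: continuous_on_cong)
    then show ?thesis using d N(1,2) unfolding differentiable_def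
      by (meson continuous_on_eq_continuous_at)
  qed
  show ?thesis unfolding C1_on_def using * by (simp add: continuous_at_imp_continuous_on)
qed

lemma C1_on_cong: "open S \<Longrightarrow> C1_on S g \<Longrightarrow> (\<And>x. x \<in> S \<Longrightarrow> f x = g x) \<Longrightarrow> C1_on S f"
  by (rule C1_on_local) blast

lemma C1_on_bounded_linear: "bounded_linear f \<Longrightarrow> C1_on S f"
  by (rule C1_onI[where f'="\<lambda>_. f"]) (auto simp: bounded_linear_imp_has_derivative)

lemma C1_on_const [simp]: "C1_on S (\<lambda>x. c)"
  by (rule C1_onI[where f'="\<lambda>_ _. 0"]) auto

lemma linear_basis_expansion:
  fixes f :: "'e::euclidean_space \<Rightarrow> 'f::real_vector"
  assumes "linear f"
  shows "f v = (\<Sum>b\<in>Basis. (v \<bullet> b) *\<^sub>R f b)"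
proof -
  have "f v = f (\<Sum>b\<in>Basis. (v \<bullet> b) *\<^sub>R b)" by (simp add: euclidean_representation)
  then show ?thesis by (simp add: linear_sum[OF assms] linear_cmul[OF assms])
qed

lemma C1_on_compose:
  fixes f :: "'e::euclidean_space \<Rightarrow> 'g::euclidean_space"
  assumes g: "C1_on T g" and f: "C1_on S f" and "f ` S \<subseteq> T"
  shows "C1_on S (\<lambda>x. g (f x))"
proof (rule C1_onI[where f'="\<lambda>x v. frechet_derivative g (at (f x)) (frechet_derivative f (at x) v)"])
  fix x assume "x \<in> S"
  with assms show "((\<lambda>x. g (f x)) has_derivative (\<lambda>v. frechet_derivative g (at (f x)) (frechet_derivative f (at x) v))) (at x)"
    by (intro has_derivative_compose[where f=f and g=g] C1_on_has_derivative[of S f] C1_on_has_derivative[of T g]) auto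
next
  fix v
  \<comment> \<open>\<open>C1_on\<close> controls the derivative of \<open>g\<close> only in a fixed
    direction, whereas here the direction moves with \<open>x\<close>. Expanding it in the basis
    leaves finitely many fixed directions.\<close>
  have eq: "frechet_derivative g (at (f x)) (frechet_derivative f (at x) v) =
     (\<Sum>b\<in>Basis. (frechet_derivative f (at x) v \<bullet> b) *\<^sub>R frechet_derivative g (at (f x)) b)" if "x \<in> S" for x
  proof -
    have "linear (frechet_derivative g (at (f x)))"
      using g assms(3) that by (intro linear_frechet_derivative) (auto simp: C1_on_def)
    then show ?thesis by (rule linear_basis_expansion)
  qed
  have "continuous_on S (\<lambda>x. \<Sum>b\<in>Basis. (frechet_derivative f (at x) v \<bullet> b) *\<^sub>R frechet_derivative g (at (f x)) b)"
    by (intro continuous_on_sum continuous_on_scaleR continuous_on_inner continuous_on_const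
        C1_on_continuous_derivative[OF f]
        continuous_on_compose2[OF C1_on_continuous_derivative[OF g] C1_on_continuous_on[OF f] assms(3)])
  then show "continuous_on S (\<lambda>x. frechet_derivative g (at (f x)) (frechet_derivative f (at x) v))"
    using eq by (simp cong: continuous_on_cong)
qed

lemma C1_on_linear_compose:
  assumes "bounded_linear L" "C1_on S f"
  shows "C1_on S (\<lambda>x. L (f x))"
proof (rule C1_onI[where f'="\<lambda>x v. L (frechet_derivative f (at x) v)"])
  show "((\<lambda>x. L (f x)) has_derivative (\<lambda>v. L (frechet_derivative f (at x) v))) (at x)" if "x \<in> S" for x
    by (rule bounded_linear.has_derivative[OF assms(1) C1_on_has_derivative[OF assms(2) that]])
  show "continuous_on S (\<lambda>x. L (frechet_derivative f (at x) v))" for v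
    by (rule bounded_linear.continuous_on[OF assms(1) C1_on_continuous_derivative[OF assms(2)]])
qed

lemma C1_on_add: "C1_on S f \<Longrightarrow> C1_on S g \<Longrightarrow> C1_on S (\<lambda>x. f x + g x)"
  by (rule C1_onI[where f'="\<lambda>x v. frechet_derivative f (at x) v + frechet_derivative g (at x) v"])
    ((intro derivative_intros C1_on_has_derivative continuous_intros C1_on_continuous_derivative | assumption)+)

lemma C1_on_uminus: "C1_on S f \<Longrightarrow> C1_on S (\<lambda>x. - f x)"
  by (rule C1_on_linear_compose[OF bounded_linear_minus[OF bounded_linear_ident]])

lemma C1_on_scaleR: "C1_on S f \<Longrightarrow> C1_on S g \<Longrightarrow> C1_on S (\<lambda>x. f x *\<^sub>R g x)"
  by (rule C1_onI[where f'="\<lambda>x v. f x *\<^sub>R frechet_derivative g (at x) v + frechet_derivative f (at x) v *\<^sub>R g x"])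
    ((intro derivative_intros C1_on_has_derivative continuous_intros C1_on_continuous_derivative
      C1_on_continuous_on | assumption)+)

lemma C1_on_mult:
  fixes f g :: "_ \<Rightarrow> real"
  shows "C1_on S f \<Longrightarrow> C1_on S g \<Longrightarrow> C1_on S (\<lambda>x. f x * g x)"
  using C1_on_scaleR[of S f g] by simp

lemma C1_on_sum: "(\<And>i. i \<in> I \<Longrightarrow> C1_on S (f i)) \<Longrightarrow> C1_on S (\<lambda>x. \<Sum>i\<in>I. f i x)"
  by (induction I rule: infinite_finite_induct) (simp_all add: C1_on_add)

lemma C1_on_prod:
  fixes f :: "_ \<Rightarrow> _ \<Rightarrow> real"
  shows "(\<And>i. i \<in> I \<Longrightarrow> C1_on S (f i)) \<Longrightarrow> C1_on S (\<lambda>x. \<Prod>i\<in>I. f i x)"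
  by (induction I rule: infinite_finite_induct) (simp_all add: C1_on_mult)

lemma C1_on_Pair: "C1_on S f \<Longrightarrow> C1_on S g \<Longrightarrow> C1_on S (\<lambda>x. (f x, g x))"
  by (rule C1_onI[where f'="\<lambda>x v. (frechet_derivative f (at x) v, frechet_derivative g (at x) v)"])
    ((intro derivative_intros C1_on_has_derivative continuous_intros C1_on_continuous_derivative | assumption)+)

lemma C1_on_fst: "C1_on S fst"
  by (rule C1_on_bounded_linear) (rule bounded_linear_fst)

lemma C1_on_snd: "C1_on S snd"
  by (rule C1_on_bounded_linear) (rule bounded_linear_snd)

lemma C1_on_real:
  fixes g :: "real \<Rightarrow> real"
  assumes "\<And>x. x \<in> S \<Longrightarrow> (g has_real_derivative g' x) (at x)" "continuous_on S g'"
  shows "C1_on S g"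
  by (rule C1_onI[where f'="\<lambda>x v. g' x * v"])
    (use assms in \<open>auto simp: has_field_derivative_def intro!: continuous_intros\<close>)

lemma C1_on_exp:
  fixes f :: "_ \<Rightarrow> real"
  shows "C1_on S f \<Longrightarrow> C1_on S (\<lambda>x. exp (f x))"
  by (rule C1_on_compose[where T=UNIV and g=exp, OF C1_on_real[where g'=exp]])
    (auto intro!: DERIV_exp continuous_intros)

lemma C1_on_inverse:
  fixes f :: "_ \<Rightarrow> real"
  shows "C1_on S f \<Longrightarrow> (\<And>x. x \<in> S \<Longrightarrow> f x \<noteq> 0) \<Longrightarrow> C1_on S (\<lambda>x. inverse (f x))"
proof (rule C1_on_compose[where T="-{0}" and g=inverse])
  show "C1_on (- {0}) (inverse :: real \<Rightarrow> real)"
  proof (rule C1_on_real)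
    show "continuous_on (-{0}) (\<lambda>x::real. - (inverse x ^ Suc (Suc 0)))"
      by (intro continuous_intros) auto
  qed (use DERIV_inverse in auto)
qed auto

lemma C1_on_divide:
  fixes f :: "_ \<Rightarrow> real"
  shows "C1_on S f \<Longrightarrow> C1_on S g \<Longrightarrow> (\<And>x. x \<in> S \<Longrightarrow> g x \<noteq> 0) \<Longrightarrow> C1_on S (\<lambda>x. f x / g x)"
  by (simp add: divide_inverse C1_on_inverse C1_on_mult)

lemma C1_on_linear_apply:
  fixes \<alpha> :: "'e::euclidean_space \<Rightarrow> 'g::euclidean_space \<Rightarrow> 'f::real_normed_vector"
  assumes "open S" "\<And>x. x \<in> S \<Longrightarrow> linear (\<alpha> x)" "\<And>v. C1_on S (\<lambda>x. \<alpha> x v)" "C1_on S w"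
  shows "C1_on S (\<lambda>x. \<alpha> x (w x))"
proof (rule C1_on_cong[where g="\<lambda>x. \<Sum>b\<in>Basis. (w x \<bullet> b) *\<^sub>R \<alpha> x b"])
  have "C1_on S (\<lambda>x. w x \<bullet> b)" for b
    by (rule C1_on_linear_compose[OF bounded_linear_inner_left assms(4)])
  then show "C1_on S (\<lambda>x. \<Sum>b\<in>Basis. (w x \<bullet> b) *\<^sub>R \<alpha> x b)"
    by (intro C1_on_sum C1_on_scaleR assms(3))
  fix x assume "x \<in> S"
  then show "\<alpha> x (w x) = (\<Sum>b\<in>Basis. (w x \<bullet> b) *\<^sub>R \<alpha> x b)"
    by (rule linear_basis_expansion[OF assms(2)])
qed (fact assms(1))

lemma continuous_on_linear_apply:
  fixes \<alpha> :: "'e::topological_space \<Rightarrow> 'g::euclidean_space \<Rightarrow> 'f::real_normed_vector"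
  assumes "\<And>x. x \<in> S \<Longrightarrow> linear (\<alpha> x)" "\<And>v. continuous_on S (\<lambda>x. \<alpha> x v)" "continuous_on S w"
  shows "continuous_on S (\<lambda>x. \<alpha> x (w x))"
proof -
  have "continuous_on S (\<lambda>x. \<Sum>b\<in>Basis. (w x \<bullet> b) *\<^sub>R \<alpha> x b)"
    by (intro continuous_intros assms)
  moreover have "\<alpha> x (w x) = (\<Sum>b\<in>Basis. (w x \<bullet> b) *\<^sub>R \<alpha> x b)" if "x \<in> S" for x
    by (rule linear_basis_expansion[OF assms(1)[OF that]])
  ultimately show ?thesis by (simp cong: continuous_on_cong)
qed

lemma C1_on_bilinear_apply:
  fixes \<omega> :: "'e::euclidean_space \<Rightarrow> 'g::euclidean_space \<Rightarrow> 'h::euclidean_space \<Rightarrow> 'f::real_normed_vector"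
  assumes "open S" "\<And>x. x \<in> S \<Longrightarrow> bilinear (\<omega> x)" "\<And>v w. C1_on S (\<lambda>x. \<omega> x v w)"
    "C1_on S v" "C1_on S w"
  shows "C1_on S (\<lambda>x. \<omega> x (v x) (w x))"
proof -
  have "C1_on S (\<lambda>x. \<omega> x (v x) b)" for b
    by (rule C1_on_linear_apply[where \<alpha>="\<lambda>x v. \<omega> x v b", OF assms(1) _ assms(3) assms(4)])
      (use assms(2) in \<open>auto simp: bilinear_def\<close>)
  from C1_on_linear_apply[where \<alpha>="\<lambda>x w. \<omega> x (v x) w", OF assms(1) _ this assms(5)] assms(2)
  show ?thesis by (simp add: bilinear_def)
qed

lemma smooth_on_imp_C1_on: "smooth_on S f \<Longrightarrow> C1_on S f"
  unfolding smooth_on_def C1_on_def by (metis Ck_on.simps)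

lemma has_derivative_zero_unique_on:
  fixes f g :: "'e::euclidean_space \<Rightarrow> real"
  assumes "open S" "connected S" "\<And>x. x \<in> S \<Longrightarrow> (f has_derivative D x) (at x)"
    "\<And>x. x \<in> S \<Longrightarrow> (g has_derivative D x) (at x)" "a \<in> S" "b \<in> S"
  shows "f b - g b = f a - g a"
proof -
  have "((\<lambda>x. f x - g x) has_derivative (\<lambda>h. 0)) (at x)" if "x \<in> S" for x
    using has_derivative_diff[OF assms(3)[OF that] assms(4)[OF that]] by simp
  then have "f a - g a = f b - g b"
    by (intro has_derivative_zero_unique_connected[OF assms(1,2), where f="\<lambda>x. f x - g x"])
      (use assms(5,6) in auto)
  then show ?thesis by simp
qed

text \<open>The primitive is the integral of the form along the segment from a base point,
  differentiated under the integral sign. Closedness makes the differentiated integrand the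
  \<open>t\<close>-derivative of \<open>t * \<alpha> (p x t) h\<close>, so the fundamental theorem
  of calculus evaluates it to \<open>\<alpha> x h\<close>.\<close>

lemma poincare:
  fixes \<alpha> :: "'e::euclidean_space \<Rightarrow> 'e \<Rightarrow> real"
  assumes S: "open S" "convex S" and lin: "\<And>x. x \<in> S \<Longrightarrow> linear (\<alpha> x)"
    and C1: "\<And>v. C1_on S (\<lambda>x. \<alpha> x v)"
    and closed: "\<And>x u v. x \<in> S \<Longrightarrow>
      frechet_derivative (\<lambda>y. \<alpha> y v) (at x) u = frechet_derivative (\<lambda>y. \<alpha> y u) (at x) v"
  obtains f where "\<And>x. x \<in> S \<Longrightarrow> (f has_derivative \<alpha> x) (at x)"
proof (cases "S = {}")
  case True then show ?thesis using that by blast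
next
  case False
  then obtain a where a: "a \<in> S" by blast
  define D where "D v x = frechet_derivative (\<lambda>y. \<alpha> y v) (at x)" for v x
  define p where "p x t = a + t *\<^sub>R (x - a)" for x and t :: real
  define f where "f x = integral (cbox 0 1) (\<lambda>t. \<alpha> (p x t) (x - a))" for x
  \<comment> \<open>Derivative of the integrand of \<open>f\<close> in \<open>x\<close> along
    \<open>h\<close>: the first summand comes from the moving point \<open>p x t\<close>, the second
    from the moving vector \<open>x - a\<close>.\<close>
  define fx where "fx x t h = t * D (x - a) (p x t) h + \<alpha> (p x t) h" for x t h
  have pS: "p x t \<in> S" if "x \<in> S" "t \<in> cbox 0 1" for x t
    using convexD_alt[OF S(2) a that(1), of t] that(2) unfolding p_def by (simp add: algebra_simps)
  have D: "((\<lambda>y. \<alpha> y v) has_derivative D v x) (at x)" if "x \<in> S" for v x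
    unfolding D_def using C1_on_has_derivative[OF C1 that] .
  have linD: "linear (D v x)" if "x \<in> S" for v x using D[OF that] has_derivative_linear by blast
  have sum\<alpha>: "\<alpha> y v = (\<Sum>b\<in>Basis. (v \<bullet> b) *\<^sub>R \<alpha> y b)" if "y \<in> S" for y v
    using lin[OF that] by (rule linear_basis_expansion)
  \<comment> \<open>Linearity in \<open>v\<close> is inherited from the form on the open set
    \<open>S\<close>. It allows \<open>x - a\<close>, which moves with \<open>x\<close>, to be
    expanded in basis vectors.\<close>
  have linDv: "D v x h = (\<Sum>b\<in>Basis. (v \<bullet> b) *\<^sub>R D b x h)" if "x \<in> S" for v x h
  proof -
    have "((\<lambda>y. \<Sum>b\<in>Basis. (v \<bullet> b) *\<^sub>R \<alpha> y b) has_derivative (\<lambda>h. \<Sum>b\<in>Basis. (v \<bullet> b) *\<^sub>R D b x h)) (at x)"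
      by (intro has_derivative_sum has_derivative_scaleR_right D that)
    then have "((\<lambda>y. \<alpha> y v) has_derivative (\<lambda>h. \<Sum>b\<in>Basis. (v \<bullet> b) *\<^sub>R D b x h)) (at x)"
      by (rule has_derivative_transform_within_open[OF _ S(1) that]) (rule sum\<alpha>[symmetric])
    then show ?thesis using fun_cong[OF has_derivative_unique[OF D[OF that]]] by blast
  qed
  have int: "((\<lambda>t. fx x t h) has_integral \<alpha> x h) (cbox 0 1)" if "x \<in> S" for x h
  proof -
    have "((\<lambda>t. t * \<alpha> (p x t) h) has_vector_derivative fx x t h) (at t)" if t: "t \<in> {0..1}" for t
    proof -
      have pt: "p x t \<in> S" using pS \<open>x \<in> S\<close> t by auto
      have "((\<lambda>t. \<alpha> (p x t) h) has_derivative (\<lambda>s. D h (p x t) (s *\<^sub>R (x - a)))) (at t)"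
        by (rule has_derivative_compose[where g="\<lambda>y. \<alpha> y h" and f="p x"])
          (auto simp: p_def[abs_def] intro!: derivative_eq_intros D pt[unfolded p_def])
      moreover have "D h (p x t) (s *\<^sub>R (x - a)) = s * D (x - a) (p x t) h" for s
        using linear_cmul[OF linD[OF pt]] closed[OF pt] by (simp add: D_def)
      ultimately have "((\<lambda>t. \<alpha> (p x t) h) has_real_derivative D (x - a) (p x t) h) (at t)"
        by (simp add: has_field_derivative_def mult_commute_abs)
      then show ?thesis unfolding fx_def has_real_derivative_iff_has_vector_derivative[symmetric]
        by (auto intro!: derivative_eq_intros)
    qed
    from fundamental_theorem_of_calculus[of 0 1, OF _ has_vector_derivative_at_within[OF this]]
    show ?thesis by (simp add: p_def)
  qed
  have cp: "continuous_on (S \<times> cbox 0 1) (\<lambda>z. p (fst z) (snd z))"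
    unfolding p_def by (intro continuous_intros)
  have c\<alpha>: "continuous_on (S \<times> cbox 0 1) (\<lambda>z. \<alpha> (p (fst z) (snd z)) b)" for b
    by (rule continuous_on_compose2[OF C1_on_continuous_on[OF C1] cp]) (use pS in auto)
  have cD: "continuous_on (S \<times> cbox 0 1) (\<lambda>z. D v (p (fst z) (snd z)) b)" for v b
    using continuous_on_compose2[OF C1_on_continuous_derivative[OF C1] cp] pS unfolding D_def by force
  have cpr: "continuous_on (cbox 0 1) (\<lambda>t::real. (x, t))" for x :: 'e
    by (intro continuous_intros)
  have linfx: "linear (fx x t)" if "x \<in> S" "t \<in> cbox 0 1" for x t
    by (rule linearI) (simp_all add: fx_def linear_add[OF lin[OF pS[OF that]]] linear_cmul[OF lin[OF pS[OF that]]]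
        linear_add[OF linD[OF pS[OF that]]] linear_cmul[OF linD[OF pS[OF that]]] algebra_simps)
  have fxd: "((\<lambda>x. \<alpha> (p x t) (x - a)) has_derivative fx x t) (at x within S)" if "x \<in> S" "t \<in> cbox 0 1" for x t
  proof -
    note pt = pS[OF that]
    have 1: "((\<lambda>x. \<alpha> (p x t) v) has_derivative (\<lambda>h. D v (p x t) (t *\<^sub>R h))) (at x)" for v
      by (rule has_derivative_compose[where g="\<lambda>y. \<alpha> y v" and f="\<lambda>x. p x t"])
          (auto simp: p_def[abs_def] intro!: derivative_eq_intros D pt[unfolded p_def])
    have "((\<lambda>x. \<Sum>b\<in>Basis. ((x - a) \<bullet> b) *\<^sub>R \<alpha> (p x t) b) has_derivative
       (\<lambda>h. \<Sum>b\<in>Basis. ((x - a) \<bullet> b) *\<^sub>R D b (p x t) (t *\<^sub>R h) + (h \<bullet> b) *\<^sub>R \<alpha> (p x t) b)) (at x)"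
      by (intro has_derivative_sum has_derivative_scaleR 1) (auto intro!: derivative_eq_intros)
    moreover have "(\<Sum>b\<in>Basis. ((x - a) \<bullet> b) *\<^sub>R D b (p x t) (t *\<^sub>R h) + (h \<bullet> b) *\<^sub>R \<alpha> (p x t) b) = fx x t h" for h
      unfolding sum.distrib sum\<alpha>[OF pt, of h, symmetric] linDv[OF pt, of "x-a", symmetric] fx_def
      using linear_cmul[OF linD[OF pt]] by simp
    ultimately have "((\<lambda>x. \<Sum>b\<in>Basis. ((x - a) \<bullet> b) *\<^sub>R \<alpha> (p x t) b) has_derivative fx x t) (at x)" by simp
    then show ?thesis
      by (rule has_derivative_transform_within_open[THEN has_derivative_at_withinI, OF _ S(1) that(1)])
        (rule sum\<alpha>[symmetric, OF pS[OF _ that(2)]])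
  qed
  have "(f has_derivative \<alpha> x) (at x within S)" if x: "x \<in> S" for x
  proof -
    have bl: "blinfun_apply (Blinfun (fx x t)) = fx x t" if "x \<in> S" "t \<in> cbox 0 1" for x t
      using linfx[OF that] linear_conv_bounded_linear bounded_linear_Blinfun_apply by blast
    \<comment> \<open>The Leibniz rule wants the derivative as a continuous family of bounded linear
      maps; in finite dimension it suffices to test on basis vectors.\<close>
    have ci: "continuous_on (S \<times> cbox 0 1) (\<lambda>(x, t). Blinfun (fx x t))"
    proof (rule continuous_on_blinfun_componentwise)
      fix b :: 'e assume "b \<in> Basis"
      have "continuous_on (S \<times> cbox 0 1) (\<lambda>z. snd z * (\<Sum>i\<in>Basis. ((fst z - a) \<bullet> i) *\<^sub>R D i (p (fst z) (snd z)) b) + \<alpha> (p (fst z) (snd z)) b)"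
        by (intro continuous_intros c\<alpha> cD)
      moreover have "blinfun_apply (case z of (x, t) \<Rightarrow> Blinfun (fx x t)) b =
         snd z * (\<Sum>i\<in>Basis. ((fst z - a) \<bullet> i) *\<^sub>R D i (p (fst z) (snd z)) b) + \<alpha> (p (fst z) (snd z)) b"
        if "z \<in> S \<times> cbox 0 1" for z
        using that bl linDv[OF pS, of "fst z" "snd z" "fst z - a" b] by (auto simp: fx_def)
      ultimately show "continuous_on (S \<times> cbox 0 1) (\<lambda>z. blinfun_apply (case z of (x, t) \<Rightarrow> Blinfun (fx x t)) b)"
        by (simp cong: continuous_on_cong)
    qed
    have ti: "(\<lambda>t. \<alpha> (p x t) (x - a)) integrable_on cbox 0 1" if "x \<in> S" for x
    proof -
      have "continuous_on (cbox 0 1) (\<lambda>t. \<alpha> (p x t) (x - a))"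
        using continuous_on_compose2[OF c\<alpha>[of "x-a"] cpr[of x]] that
        by force
      then show ?thesis by (rule integrable_continuous)
    qed
    have "(f has_derivative integral (cbox 0 1) (\<lambda>t. Blinfun (fx x t))) (at x within S)"
      unfolding f_def[abs_def]
      by (rule leibniz_rule[OF _ ti ci x S(2)]) (simp add: bl fxd)
    moreover have "blinfun_apply (integral (cbox 0 1) (\<lambda>t. Blinfun (fx x t))) = \<alpha> x"
    proof
      fix h
      have "continuous_on (cbox 0 1) (\<lambda>t. Blinfun (fx x t))"
        using continuous_on_compose2[OF ci cpr[of x]] x
        by force
      then have "((\<lambda>t. Blinfun (fx x t)) has_integral integral (cbox 0 1) (\<lambda>t. Blinfun (fx x t))) (cbox 0 1)"
        by (intro integrable_integral integrable_continuous)
      from has_integral_linear[OF this blinfun.bounded_linear_left[of h]]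
      have "((\<lambda>t. blinfun_apply (Blinfun (fx x t)) h) has_integral blinfun_apply (integral (cbox 0 1) (\<lambda>t. Blinfun (fx x t))) h) (cbox 0 1)"
        by (simp add: o_def)
      then have "((\<lambda>t. fx x t h) has_integral blinfun_apply (integral (cbox 0 1) (\<lambda>t. Blinfun (fx x t))) h) (cbox 0 1)"
        by (rule has_integral_eq[rotated]) (simp add: bl x)
      then show "blinfun_apply (integral (cbox 0 1) (\<lambda>t. Blinfun (fx x t))) h = \<alpha> x h"
        using int[OF x, of h] has_integral_unique by blast
    qed
    ultimately show ?thesis by simp
  qed
  then show ?thesis by (intro that[of f]) (simp add: at_within_open[OF _ S(1)])
qed

section \<open>Holomorphic maps are continuously differentiable\<close>

lemma norm_vector_scalar_mult: "norm (c *s v) = cmod c * norm (v :: complex^'n)"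
  by (simp add: norm_vec_def norm_mult L2_set_right_distrib)

lemma bounded_linear_vector_scalar_mult: "bounded_linear (\<lambda>c. c *s (v :: complex^'n))"
  by (rule bounded_linear_intro[where K="norm v"])
    (simp_all add: norm_vector_scalar_mult vec_eq_iff algebra_simps)

text \<open>Holomorphy is pointwise differentiability here, so continuity of the derivative rests on
  Cauchy's estimate. Along the parallel complex lines through \<open>y\<close> and \<open>x\<close>
  in direction \<open>v\<close>, the difference of the values of \<open>f\<close> is small on a
  circle by uniform continuity, and so is its derivative at the centre.\<close>

lemma cfun_holomorphic_C1_on:
  fixes f :: "complex^'n \<Rightarrow> complex"
  assumes "open S" and f: "cfun_holomorphic_on f S"
  shows "C1_on S f"
proof -
  obtain D where D: "\<And>x. x \<in> S \<Longrightarrow> (f has_derivative D x) (at x)"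
    and Dc: "\<And>x c v. x \<in> S \<Longrightarrow> D x (c *s v) = c * D x v"
    using f unfolding cfun_holomorphic_on_def by metis
  have line: "((\<lambda>\<zeta>. f (x + \<zeta> *s v)) has_field_derivative D (x + \<zeta> *s v) v) (at \<zeta>)" if "x + \<zeta> *s v \<in> S" for x v \<zeta>
  proof -
    have "((\<lambda>\<zeta>. f (x + \<zeta> *s v)) has_derivative (\<lambda>h. D (x + \<zeta> *s v) (h *s v))) (at \<zeta>)"
      by (rule has_derivative_compose[where g=f and f="\<lambda>\<zeta>. x + \<zeta> *s v", OF _ D[OF that]])
        (auto intro!: derivative_eq_intros bounded_linear_imp_has_derivative bounded_linear_vector_scalar_mult)
    then show ?thesis
      by (simp add: has_field_derivative_def Dc[OF that] mult_commute_abs)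
  qed
  have "continuous_on S (\<lambda>x. D x v)" for v
  proof (cases "v = 0")
    case True
    have "D x 0 = 0" if "x \<in> S" for x using D[OF that] by (simp add: has_derivative_linear linear_0)
    then show ?thesis using True by (simp cong: continuous_on_cong)
  next
    case False
    have "\<exists>\<delta>>0. \<forall>y\<in>S. dist y x < \<delta> \<longrightarrow> dist (D y v) (D x v) < e" if x: "x \<in> S" and e: "e > 0" for x e
    proof -
      obtain R where R: "R > 0" "cball x R \<subseteq> S" using \<open>open S\<close> x open_contains_cball by metis
      \<comment> \<open>With this radius the vectors \<open>\<zeta> *s v\<close> have norm at most
        \<open>R / 2\<close>; together with \<open>dist y x < R / 2\<close> both discs stay in
        \<open>cball x R\<close>. The bound \<open>e * r / 2\<close> below becomes
        \<open>e / 2\<close> after the division by \<open>r\<close> in Cauchy's inequality.\<close>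
      define r where "r = R / (2 * norm v)"
      have r: "r > 0" "r * norm v = R / 2" using R False by (auto simp: r_def)
      have "continuous_on (cball x R) f"
        using R D by (intro continuous_at_imp_continuous_on) (metis has_derivative_continuous subsetD)
      then have "uniformly_continuous_on (cball x R) f" by (intro compact_uniformly_continuous) auto
      then obtain d where d: "d > 0" "\<And>y z. y \<in> cball x R \<Longrightarrow> z \<in> cball x R \<Longrightarrow> dist z y < d \<Longrightarrow> dist (f z) (f y) < e * r / 2"
        using e r unfolding uniformly_continuous_on_def by (metis half_gt_zero mult_pos_pos)
      have "dist (D y v) (D x v) < e" if y: "y \<in> S" "dist y x < min d (R/2)" for y
      proof -
        let ?g = "\<lambda>\<zeta>. f (y + \<zeta> *s v) - f (x + \<zeta> *s v)"
        have in1: "x + \<zeta> *s v \<in> cball x R" "y + \<zeta> *s v \<in> cball x R" if "cmod \<zeta> \<le> r" for \<zeta>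
        proof -
          have "norm (\<zeta> *s v) \<le> R / 2"
            unfolding norm_vector_scalar_mult r(2)[symmetric] using that by (intro mult_right_mono) auto
          moreover have "norm (y - x) < R / 2" using y by (simp add: dist_norm)
          moreover have "norm (y + \<zeta> *s v - x) \<le> norm (y - x) + norm (\<zeta> *s v)"
            using norm_triangle_ineq[of "y - x" "\<zeta> *s v"] by (simp add: algebra_simps)
          ultimately show "x + \<zeta> *s v \<in> cball x R" "y + \<zeta> *s v \<in> cball x R"
            using R(1) by (auto simp: mem_cball dist_norm norm_minus_commute)
        qed
        have dg: "(?g has_field_derivative (D (y + \<zeta> *s v) v - D (x + \<zeta> *s v) v)) (at \<zeta>)" if "cmod \<zeta> \<le> r" for \<zeta>
          using in1[OF that] R(2) by (intro DERIV_diff line) auto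
        have "norm ((deriv ^^ 1) ?g 0) \<le> fact 1 * (e * r / 2) / r ^ 1"
        proof (rule Cauchy_inequality)
          show "?g holomorphic_on ball 0 r"
            by (rule holomorphic_on_open[THEN iffD2, OF open_ball], rule ballI, rule exI, rule dg) simp
          show "continuous_on (cball 0 r) ?g"
            by (intro continuous_at_imp_continuous_on ballI, rule DERIV_isCont, rule dg) simp
          fix \<zeta> :: complex assume "norm (0 - \<zeta>) = r"
          then have "cmod \<zeta> \<le> r" by simp
          note in1[OF this]
          moreover have "dist (y + \<zeta> *s v) (x + \<zeta> *s v) < d" using y by simp
          ultimately show "norm (?g \<zeta>) \<le> e * r / 2" using d(2) unfolding dist_norm by (meson less_imp_le)
        qed (use r in auto)
        moreover have "deriv ?g 0 = D y v - D x v" using DERIV_imp_deriv[OF dg[of 0]] r by simp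
        ultimately have "norm (D y v - D x v) \<le> e / 2" using r by simp
        then show ?thesis using e by (simp add: dist_norm)
      qed
      moreover have "min d (R/2) > 0" using d R by simp
      ultimately show ?thesis by blast
    qed
    then show ?thesis unfolding continuous_on_iff by blast
  qed
  then show ?thesis using D by (rule C1_onI[rotated])
qed

lemma has_derivative_vecI:
  fixes f :: "'e::euclidean_space \<Rightarrow> 'f::euclidean_space^'n"
  assumes "\<And>i. ((\<lambda>x. f x $ i) has_derivative f' i) (at x)"
  shows "(f has_derivative (\<lambda>v. \<chi> i. f' i v)) (at x)"
proof -
  have "((\<lambda>x. f x $ i \<bullet> b) has_derivative (\<lambda>v. f' i v \<bullet> b)) (at x)" for i b
    by (rule bounded_linear.has_derivative[OF bounded_linear_inner_left assms])
  then show ?thesis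
    by (subst has_derivative_componentwise_within) (auto simp: Basis_vec_def inner_axis)
qed

lemma C1_on_vec:
  fixes f :: "'e::euclidean_space \<Rightarrow> 'f::euclidean_space^'n"
  assumes "\<And>i. C1_on S (\<lambda>x. f x $ i)"
  shows "C1_on S f"
proof (rule C1_onI[where f'="\<lambda>x v. \<chi> i. frechet_derivative (\<lambda>x. f x $ i) (at x) v"])
  show "(f has_derivative (\<lambda>v. \<chi> i. frechet_derivative (\<lambda>x. f x $ i) (at x) v)) (at x)" if "x \<in> S" for x
    by (rule has_derivative_vecI[OF C1_on_has_derivative[OF assms that]])
  show "continuous_on S (\<lambda>x. \<chi> i. frechet_derivative (\<lambda>x. f x $ i) (at x) v)" for v
    by (intro continuous_on_vec_lambda C1_on_continuous_derivative assms)
qed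

lemma cmap_holomorphic_C1_on:
  fixes f :: "complex^'n \<Rightarrow> complex^'m"
  assumes "open S" and f: "cmap_holomorphic_on f S"
  shows "C1_on S f"
proof (rule C1_on_vec, rule cfun_holomorphic_C1_on[OF assms(1)])
  show "cfun_holomorphic_on (\<lambda>x. f x $ i) S" for i
    unfolding cfun_holomorphic_on_def
  proof
    fix x assume "x \<in> S"
    then obtain D where D: "(f has_derivative D) (at x)" "\<forall>c v. D (c *s v) = c *s D v"
      using f unfolding cmap_holomorphic_on_def by metis
    have "((\<lambda>x. f x $ i) has_derivative (\<lambda>v. D v $ i)) (at x)"
      by (rule bounded_linear.has_derivative[OF bounded_linear_vec_nth D(1)])
    then show "\<exists>D. ((\<lambda>x. f x $ i) has_derivative D) (at x) \<and> (\<forall>c v. D (c *s v) = c * D v)"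
      using D(2) by (intro exI[of _ "\<lambda>v. D v $ i"]) simp
  qed
qed

section \<open>The Liouville density of a family of symplectic forms\<close>

text \<open>Product rule in the Leibniz expansion, regrouped by the row that is
  differentiated.\<close>

lemma det_has_derivative:
  fixes A :: "'e::euclidean_space \<Rightarrow> real^'k^'k"
  assumes "\<And>i j. ((\<lambda>x. A x $ i $ j) has_derivative D i j) (at x)"
  shows "((\<lambda>x. det (A x)) has_derivative
    (\<lambda>h. \<Sum>i\<in>UNIV. det (\<chi> r. if r = i then (\<chi> j. D i j h) else A x $ r))) (at x)"
proof -
  let ?S = "{p. p permutes (UNIV :: 'k set)}"
  have "((\<lambda>x. \<Sum>p\<in>?S. of_int (sign p) * (\<Prod>i\<in>UNIV. A x $ i $ p i)) has_derivative
     (\<lambda>h. \<Sum>p\<in>?S. of_int (sign p) * (\<Sum>i\<in>UNIV. D i (p i) h * (\<Prod>j\<in>UNIV - {i}. A x $ j $ p j)))) (at x)"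
    by (intro has_derivative_sum has_derivative_mult_right has_derivative_prod assms)
  moreover have "(\<Sum>p\<in>?S. of_int (sign p) * (\<Sum>i\<in>UNIV. D i (p i) h * (\<Prod>j\<in>UNIV - {i}. A x $ j $ p j)))
    = (\<Sum>i\<in>UNIV. det (\<chi> r. if r = i then (\<chi> j. D i j h) else A x $ r))" for h
  proof -
    have "D i (p i) h * (\<Prod>j\<in>UNIV - {i}. A x $ j $ p j) =
      (\<Prod>j\<in>UNIV. (\<chi> r. if r = i then (\<chi> j. D i j h) else A x $ r) $ j $ p j)" for i p
      by (subst prod.remove[of UNIV i]) (auto intro!: arg_cong2[where f="(*)"] prod.cong)
    then show ?thesis
      unfolding det_def by (simp add: sum_distrib_left) (rule sum.swap)
  qed
  ultimately show ?thesis unfolding det_def by simp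
qed

text \<open>The differentiated row \<open>B\<close> is the combination of the rows of
  \<open>A x\<close> with coefficients \<open>B v* P\<close>. By Cramer's rule only its coefficient
  on the replaced row contributes to the determinant.\<close>

lemma jacobi_formula:
  fixes A :: "'e::euclidean_space \<Rightarrow> real^'k^'k"
  assumes D: "\<And>i j. ((\<lambda>x. A x $ i $ j) has_derivative D i j) (at x)"
    and P: "P ** A x = mat 1"
  shows "((\<lambda>x. det (A x)) has_derivative
    (\<lambda>h. det (A x) * (\<Sum>i\<in>UNIV. \<Sum>j\<in>UNIV. P $ j $ i * D i j h))) (at x)"
proof -
  have "det (\<chi> r. if r = i then (\<chi> j. D i j h) else A x $ r) = (\<Sum>j\<in>UNIV. P $ j $ i * D i j h) * det (A x)" for i h
  proof -
    define B where "B = (\<chi> j. D i j h)"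
    have "B = (B v* P) v* A x" using P by (simp add: vector_matrix_mul_assoc)
    also have "\<dots> = (\<Sum>r\<in>UNIV. (B v* P) $ r *s row r (A x))"
      by (simp add: vec_eq_iff vector_matrix_mult_def row_def mult.commute)
    finally have B: "B = (\<Sum>r\<in>UNIV. (B v* P) $ r *s row r (A x))" .
    have "det (\<chi> r. if r = i then B else row r (A x)) = (B v* P) $ i * det (A x)"
      using cramer_lemma_transpose[of i "B v* P" "A x"] by (simp only: B[symmetric])
    moreover have rw: "row r (A x) = A x $ r" for r by (simp add: row_def)
    ultimately show ?thesis
      unfolding B_def rw by (simp add: vector_matrix_mult_def mult.commute)
  qed
  then show ?thesis using det_has_derivative[of A D x, OF D]
    by (simp add: sum_distrib_left[symmetric] mult.commute)
qed

text \<open>Writing the derivative as a multiple of \<open>f x\<close> makes the sign of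
  \<open>f\<close> cancel; Jacobi's formula supplies exactly this form.\<close>

lemma has_derivative_sqrt_abs:
  fixes f :: "'e::euclidean_space \<Rightarrow> real"
  assumes "(f has_derivative (\<lambda>h. f x * c h)) (at x)" "f x \<noteq> 0"
  shows "((\<lambda>x. sqrt \<bar>f x\<bar>) has_derivative (\<lambda>h. sqrt \<bar>f x\<bar> * c h / 2)) (at x)"
proof -
  have "((\<lambda>t. \<bar>t\<bar>) has_derivative (\<lambda>h. sgn y * h)) (at y)" if "y \<noteq> 0" for y :: real
  proof (cases "y > 0")
    case True
    then show ?thesis
      by (intro has_derivative_transform_within_open[OF has_derivative_mult_right[OF has_derivative_ident], of "{0<..}"]) auto
  next
    case False
    with that show ?thesis
      by (intro has_derivative_transform_within_open[OF has_derivative_mult_right[OF has_derivative_ident], of "{..<0}"]) auto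
  qed
  from has_derivative_compose[OF assms(1) this[OF assms(2)]]
  have 1: "((\<lambda>x. \<bar>f x\<bar>) has_derivative (\<lambda>h. sgn (f x) * (f x * c h))) (at x)" .
  have "((\<lambda>x. sqrt \<bar>f x\<bar>) has_derivative (\<lambda>h. (sgn (f x) * (f x * c h)) * (inverse (sqrt \<bar>f x\<bar>) / 2))) (at x)"
    using has_derivative_real_sqrt[OF _ 1] assms(2) by (simp add: field_simps)
  moreover have "(sgn (f x) * (f x * c h)) * (inverse (sqrt \<bar>f x\<bar>) / 2) = sqrt \<bar>f x\<bar> * c h / 2" for h
  proof -
    have eq: "sgn (f x) * f x = sqrt \<bar>f x\<bar> * sqrt \<bar>f x\<bar>"
      by (simp only: real_sqrt_mult_self abs_abs) (simp add: sgn_if)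
    have "(sgn (f x) * (f x * c h)) * (inverse (sqrt \<bar>f x\<bar>) / 2)
      = sqrt \<bar>f x\<bar> * sqrt \<bar>f x\<bar> * c h * (inverse (sqrt \<bar>f x\<bar>) / 2)"
      by (simp only: eq[symmetric] mult.assoc)
    also have "\<dots> = sqrt \<bar>f x\<bar> * c h / 2"
    proof -
      have "s * s * d * (inverse s / 2) = s * d / 2" if "s \<noteq> 0" for s d :: real
        using that by (simp add: field_simps)
      then show ?thesis using assms(2) by (metis abs_0_eq real_sqrt_eq_zero_cancel_iff)
    qed
    finally show ?thesis .
  qed
  ultimately show ?thesis by (simp only:)
qed

lemma C1_on_det:
  fixes A :: "'e::euclidean_space \<Rightarrow> real^'k^'k"
  assumes "\<And>i j. C1_on S (\<lambda>x. A x $ i $ j)"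
  shows "C1_on S (\<lambda>x. det (A x))"
  unfolding det_def by (intro C1_on_sum C1_on_mult C1_on_prod C1_on_const assms)

lemma C1_on_sqrt_abs:
  fixes f :: "'e::euclidean_space \<Rightarrow> real"
  assumes "C1_on S f" "\<And>x. x \<in> S \<Longrightarrow> f x \<noteq> 0"
  shows "C1_on S (\<lambda>x. sqrt \<bar>f x\<bar>)"
proof (rule C1_onI)
  fix x assume x: "x \<in> S"
  have "(f has_derivative (\<lambda>h. f x * (frechet_derivative f (at x) h / f x))) (at x)"
    using C1_on_has_derivative[OF assms(1) x] assms(2)[OF x] by simp
  then show "((\<lambda>x. sqrt \<bar>f x\<bar>) has_derivative (\<lambda>h. sqrt \<bar>f x\<bar> * (frechet_derivative f (at x) h / f x) / 2)) (at x)"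
    by (rule has_derivative_sqrt_abs[where c="\<lambda>h. frechet_derivative f (at x) h / f x"]) (rule assms(2)[OF x])
next
  show "continuous_on S (\<lambda>x. sqrt \<bar>f x\<bar> * (frechet_derivative f (at x) v / f x) / 2)" for v
    by (intro continuous_intros C1_on_continuous_derivative C1_on_continuous_on assms)
      (use assms(2) in auto)
qed

text \<open>Cramer's quotients are used instead of an inverse matrix because they are visibly
  continuously differentiable in the data.\<close>

definition cramer_solve :: "real^'k^'k \<Rightarrow> real^'k \<Rightarrow> real^'k" where
  "cramer_solve A b = (\<chi> l. det (\<chi> i j. if j = l then b $ i else A $ i $ j) / det A)"

lemma cramer_solve: "det A \<noteq> 0 \<Longrightarrow> A *v x = b \<longleftrightarrow> x = cramer_solve A b"
  unfolding cramer_solve_def by (rule cramer)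

lemma C1_on_cramer_solve:
  fixes A :: "'e::euclidean_space \<Rightarrow> real^'k^'k"
  assumes "\<And>i j. C1_on S (\<lambda>x. A x $ i $ j)" "\<And>i. C1_on S (\<lambda>x. b x $ i)"
    "\<And>x. x \<in> S \<Longrightarrow> det (A x) \<noteq> 0"
  shows "C1_on S (\<lambda>x. cramer_solve (A x) (b x) $ l)"
proof -
  have "C1_on S (\<lambda>x. (\<chi> i j. if j = l then b x $ i else A x $ i $ j) $ i $ j)" for i j
    using assms by (cases "j = l") auto
  then show ?thesis unfolding cramer_solve_def using assms
    by (simp add: C1_on_divide C1_on_det)
qed

text \<open>Since \<open>A\<close> is a closed 2-form and \<open>\<partial>\<^sub>t A = d \<eta>\<close>, the Lie derivative of \<open>A\<close> along the vector field
  \<open>X\<close> with \<open>A X = - \<eta>\<close> is \<open>\<partial>\<^sub>t A\<close>; hence the Liouville density \<open>sqrt |det A|\<close> evolves by the divergence.\<close>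

lemma liouville_divergence:
  fixes A :: "real \<times> (real^'k) \<Rightarrow> real^'k^'k" and \<eta> :: "real \<times> (real^'k) \<Rightarrow> real^'k"
  assumes S: "open S" and CA: "\<And>i j. C1_on S (\<lambda>z. A z $ i $ j)" and C\<eta>: "\<And>i. C1_on S (\<lambda>z. \<eta> z $ i)"
    and anti: "\<And>z i j. z \<in> S \<Longrightarrow> A z $ i $ j = - A z $ j $ i"
    and det: "\<And>z. z \<in> S \<Longrightarrow> det (A z) \<noteq> 0"
    and z: "z \<in> S"
  defines "dA \<equiv> \<lambda>l i j. frechet_derivative (\<lambda>z. A z $ i $ j) (at z) (0, axis l 1)"
    and "d\<eta> \<equiv> \<lambda>l i. frechet_derivative (\<lambda>z. \<eta> z $ i) (at z) (0, axis l 1)"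
    and "V \<equiv> \<lambda>z. sqrt \<bar>det (A z)\<bar>"
    and "X \<equiv> \<lambda>z. cramer_solve (A z) (- \<eta> z)"
  assumes closed: "\<And>l i j. dA l i j + dA i j l + dA j l i = 0"
    and ev: "\<And>i j. frechet_derivative (\<lambda>z. A z $ i $ j) (at z) (1, 0) = d\<eta> i j - d\<eta> j i"
  shows "(\<Sum>l\<in>UNIV. frechet_derivative (\<lambda>z. V z * X z $ l) (at z) (0, axis l 1))
    = frechet_derivative V (at z) (1, 0)"
proof -
  obtain P where P: "P ** A z = mat 1" "A z ** P = mat 1"
    using det[OF z] invertible_det_nz[of "A z"] unfolding invertible_def by blast
  \<comment> \<open>\<open>- transpose P\<close> is also a left inverse of \<open>A z\<close>, hence
    equal to \<open>P\<close>.\<close>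
  have antiP: "P $ i $ j = - P $ j $ i" for i j
  proof -
    have "- P $ k $ i * A z $ k $ j = P $ k $ i * A z $ j $ k" for i j k
      using anti[OF z, of j k] by simp
    then have "(- transpose P) ** A z = transpose P ** transpose (A z)"
      by (simp add: vec_eq_iff matrix_matrix_mult_def transpose_def)
    also have "\<dots> = mat 1"
      by (simp add: matrix_transpose_mul[symmetric] P(2) transpose_mat)
    finally have "- transpose P ** A z ** P = P" by simp
    then have "- transpose P = P" by (simp add: matrix_mul_assoc[symmetric] P(2))
    then have "(- transpose P) $ i $ j = P $ i $ j" by simp
    then show ?thesis by (simp add: transpose_def)
  qed
  have antidA: "dA l i j = - dA l j i" for l i j
  proof -
    have "((\<lambda>z. - (A z $ j $ i)) has_derivative frechet_derivative (\<lambda>z. A z $ i $ j) (at z)) (at z)"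
      by (rule has_derivative_transform_within_open[OF C1_on_has_derivative[OF CA z] S z]) (rule anti)
    moreover have "((\<lambda>z. - (A z $ j $ i)) has_derivative (\<lambda>h. - frechet_derivative (\<lambda>z. A z $ j $ i) (at z) h)) (at z)"
      by (rule has_derivative_minus[OF C1_on_has_derivative[OF CA z]])
    ultimately show ?thesis unfolding dA_def by (rule fun_cong[OF has_derivative_unique])
  qed
  have CX: "C1_on S (\<lambda>z. X z $ l)" for l
    unfolding X_def by (rule C1_on_cramer_solve[OF CA _ det]) (simp add: C1_on_uminus C\<eta>)
  have VD: "(V has_derivative (\<lambda>h. V z * (\<Sum>i\<in>UNIV. \<Sum>j\<in>UNIV. P $ j $ i * frechet_derivative (\<lambda>z. A z $ i $ j) (at z) h) / 2)) (at z)"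
    unfolding V_def
    by (rule has_derivative_sqrt_abs[OF jacobi_formula[of A _ z P, OF C1_on_has_derivative[OF CA z] P(1)] det[OF z]])
  note dV = fun_cong[OF frechet_derivative_at[OF VD], symmetric]
  define dX where "dX l i = frechet_derivative (\<lambda>z. X z $ i) (at z) (0, axis l 1)" for l i
  have AX: "(\<Sum>m\<in>UNIV. A w $ j $ m * X w $ m) = - \<eta> w $ j" if "w \<in> S" for w j
    using cramer_solve[OF det[OF that], of "X w" "- \<eta> w"]
    by (simp add: X_def vec_eq_iff matrix_vector_mult_def)
  \<comment> \<open>Differentiating the equation \<open>A X = - \<eta>\<close> avoids
    differentiating Cramer's quotients; \<open>P\<close> then isolates \<open>dX\<close>.\<close>
  have dAX: "(\<Sum>m\<in>UNIV. A z $ j $ m * dX l m) = - d\<eta> l j - (\<Sum>m\<in>UNIV. dA l j m * X z $ m)" for l j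
  proof -
    have 1: "((\<lambda>w. - \<eta> w $ j) has_derivative (\<lambda>h. \<Sum>m\<in>UNIV. A z $ j $ m * frechet_derivative (\<lambda>z. X z $ m) (at z) h
        + frechet_derivative (\<lambda>z. A z $ j $ m) (at z) h * X z $ m)) (at z)"
      by (rule has_derivative_transform_within_open[OF has_derivative_sum[OF has_derivative_mult[OF C1_on_has_derivative[OF CA z] C1_on_has_derivative[OF CX z]]] S z])
        (simp add: AX)
    have 2: "((\<lambda>w. - \<eta> w $ j) has_derivative (\<lambda>h. - frechet_derivative (\<lambda>z. \<eta> z $ j) (at z) h)) (at z)"
      by (rule has_derivative_minus[OF C1_on_has_derivative[OF C\<eta> z]])
    from fun_cong[OF has_derivative_unique[OF 1 2], of "(0, axis l 1)"] show ?thesis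
      by (simp add: dX_def d\<eta>_def dA_def sum.distrib)
  qed
  have dXP: "dX l i = (\<Sum>j\<in>UNIV. P $ i $ j * (- d\<eta> l j - (\<Sum>m\<in>UNIV. dA l j m * X z $ m)))" for l i
  proof -
    have "A z *v (\<chi> m. dX l m) = (\<chi> j. - d\<eta> l j - (\<Sum>m\<in>UNIV. dA l j m * X z $ m))"
      using dAX by (simp add: vec_eq_iff matrix_vector_mult_def)
    from arg_cong[OF this, of "(*v) P"]
    have "(\<chi> m. dX l m) = P *v (\<chi> j. - d\<eta> l j - (\<Sum>m\<in>UNIV. dA l j m * X z $ m))"
      by (simp add: matrix_vector_mul_assoc P(1))
    then show ?thesis by (simp add: vec_eq_iff matrix_vector_mult_def)
  qed
  \<comment> \<open>Antisymmetry of \<open>P\<close> allows the contraction to be symmetrised as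
    \<open>?T + ?T\<close>; closedness then trades the two mixed derivatives for
    \<open>dA m\<close>. This is what makes the derivative of \<open>V\<close> along
    \<open>X\<close> cancel in the end.\<close>
  have contr: "(\<Sum>l\<in>UNIV. \<Sum>j\<in>UNIV. P $ l $ j * dA l j m) = (\<Sum>i\<in>UNIV. \<Sum>j\<in>UNIV. P $ j $ i * dA m i j) / 2" for m
  proof -
    let ?T = "\<Sum>l\<in>UNIV. \<Sum>j\<in>UNIV. P $ l $ j * dA l j m"
    have "?T = (\<Sum>l\<in>UNIV. \<Sum>j\<in>UNIV. P $ j $ l * dA j l m)" by (rule sum.swap)
    also have "\<dots> = (\<Sum>l\<in>UNIV. \<Sum>j\<in>UNIV. P $ l $ j * dA j m l)"
    proof (intro sum.cong refl)
      fix l j show "P $ j $ l * dA j l m = P $ l $ j * dA j m l"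
        using antiP[of j l] antidA[of j l m] by simp
    qed
    finally have "?T + ?T = (\<Sum>l\<in>UNIV. \<Sum>j\<in>UNIV. P $ l $ j * (dA l j m + dA j m l))"
      by (simp add: sum.distrib distrib_left)
    also have "\<dots> = (\<Sum>i\<in>UNIV. \<Sum>j\<in>UNIV. P $ j $ i * dA m i j)"
    proof (intro sum.cong refl)
      fix l j
      have "dA l j m + dA j m l = - dA m l j" using closed[of l j m] by simp
      then show "P $ l $ j * (dA l j m + dA j m l) = P $ j $ l * dA m l j" using antiP[of l j] by simp
    qed
    finally show ?thesis by simp
  qed
  have "(\<Sum>l\<in>UNIV. dX l l) = - (\<Sum>l\<in>UNIV. \<Sum>j\<in>UNIV. P $ l $ j * d\<eta> l j)
      - (\<Sum>m\<in>UNIV. (\<Sum>l\<in>UNIV. \<Sum>j\<in>UNIV. P $ l $ j * dA l j m) * X z $ m)"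
  proof -
    have "(\<Sum>l\<in>UNIV. dX l l) = - (\<Sum>l\<in>UNIV. \<Sum>j\<in>UNIV. P $ l $ j * d\<eta> l j)
      - (\<Sum>l\<in>UNIV. \<Sum>j\<in>UNIV. \<Sum>m\<in>UNIV. P $ l $ j * dA l j m * X z $ m)"
      unfolding dXP by (simp add: right_diff_distrib sum_subtractf sum_negf sum_distrib_left mult.assoc)
    also have "(\<Sum>l\<in>UNIV. \<Sum>j\<in>UNIV. \<Sum>m\<in>UNIV. P $ l $ j * dA l j m * X z $ m)
      = (\<Sum>m\<in>UNIV. \<Sum>l\<in>UNIV. \<Sum>j\<in>UNIV. P $ l $ j * dA l j m * X z $ m)"
      by (rule trans[OF sum.cong[OF refl sum.swap] sum.swap])
    finally show ?thesis by (simp add: sum_distrib_right)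
  qed
  moreover have "(\<Sum>i\<in>UNIV. \<Sum>j\<in>UNIV. P $ j $ i * (d\<eta> i j - d\<eta> j i)) = - 2 * (\<Sum>l\<in>UNIV. \<Sum>j\<in>UNIV. P $ l $ j * d\<eta> l j)"
  proof -
    have "(\<Sum>i\<in>UNIV. \<Sum>j\<in>UNIV. P $ j $ i * d\<eta> j i) = (\<Sum>l\<in>UNIV. \<Sum>j\<in>UNIV. P $ l $ j * d\<eta> l j)" by (rule sum.swap)
    moreover have "(\<Sum>i\<in>UNIV. \<Sum>j\<in>UNIV. P $ j $ i * d\<eta> i j) = - (\<Sum>l\<in>UNIV. \<Sum>j\<in>UNIV. P $ l $ j * d\<eta> l j)"
      unfolding sum_negf[symmetric]
    proof (intro sum.cong refl)
      fix i j show "P $ j $ i * d\<eta> i j = - (P $ i $ j * d\<eta> i j)" using antiP[of j i] by simp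
    qed
    ultimately show ?thesis by (simp add: right_diff_distrib sum_subtractf)
  qed
  moreover have "frechet_derivative (\<lambda>z. V z * X z $ l) (at z) (0, axis l 1) =
     V z * dX l l + (V z * (\<Sum>i\<in>UNIV. \<Sum>j\<in>UNIV. P $ j $ i * dA l i j) / 2) * X z $ l" for l
    using fun_cong[OF frechet_derivative_at[OF has_derivative_mult[OF VD C1_on_has_derivative[OF CX[of l] z]]], of "(0, axis l 1)"]
    by (simp add: dX_def dA_def)
  \<comment> \<open>The divergence of \<open>V X\<close> is \<open>V\<close> times the trace of
    \<open>dX\<close> plus the derivative of \<open>V\<close> along \<open>X\<close>. By
    \<open>contr\<close> the terms containing \<open>X\<close> itself cancel, and the rest is
    Jacobi's formula for the time derivative of \<open>V\<close>.\<close>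
  ultimately show ?thesis unfolding dV ev
    by (simp add: sum.distrib sum_distrib_left[symmetric] contr sum_subtractf sum_distrib_right
      mult.assoc sum_divide_distrib[symmetric] right_diff_distrib)
qed

section \<open>Integration on closed manifolds\<close>

lemma integral_UNIV_support:
  fixes f :: "'e::euclidean_space \<Rightarrow> real"
  assumes "\<And>x. x \<notin> S \<Longrightarrow> f x = 0"
  shows "integral UNIV f = integral S f"
proof -
  have "f = (\<lambda>x. if x \<in> S then f x else 0)" using assms by auto
  then show ?thesis using Henstock_Kurzweil_Integration.integral_restrict_UNIV[of S f] by metis
qed

lemma integrable_compact_support:
  fixes f :: "'e::euclidean_space \<Rightarrow> real"
  assumes "continuous_on UNIV f" "bounded S" "\<And>x. x \<notin> S \<Longrightarrow> f x = 0"
  shows "f integrable_on UNIV"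
proof -
  obtain a b where ab: "S \<subseteq> cbox a b" using assms(2) bounded_subset_cbox_symmetric by metis
  have "f integrable_on cbox a b"
    using assms(1) continuous_on_subset by (intro integrable_continuous) blast
  then show ?thesis by (rule integrable_on_superset) (use ab assms(3) in auto)
qed

text \<open>Translating \<open>g\<close> does not change its integral; differentiating in the
  translation parameter at \<open>0\<close> gives the claim.\<close>

lemma integral_partial_derivative_eq_0:
  fixes g :: "'e::euclidean_space \<Rightarrow> real"
  assumes g: "C1_on UNIV g" and S: "bounded S" "\<And>x. x \<notin> S \<Longrightarrow> g x = 0"
  shows "integral UNIV (\<lambda>x. frechet_derivative g (at x) v) = 0"
proof -
  obtain R where R: "\<And>x. x \<in> S \<Longrightarrow> norm x \<le> R" using S(1) unfolding bounded_iff by blast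
  \<comment> \<open>Corner of a cube that still contains the ball of radius \<open>R + 1\<close>
    after a translation by \<open>s *\<^sub>R v\<close> with \<open>|s| \<le> 1\<close>.\<close>
  define c where "c = (R + 1 + norm v) *\<^sub>R (One :: 'e)"
  have in_box: "x \<in> cbox (- c + s *\<^sub>R v) (c + s *\<^sub>R v)" if x: "norm x \<le> R + 1" and s: "\<bar>s\<bar> \<le> 1" for x s
  proof -
    have "\<bar>x \<bullet> i\<bar> \<le> R + 1 \<and> \<bar>s * (v \<bullet> i)\<bar> \<le> norm v" if i: "i \<in> Basis" for i
    proof
      show "\<bar>x \<bullet> i\<bar> \<le> R + 1" using Basis_le_norm[OF i, of x] x by simp
      have "\<bar>s\<bar> * \<bar>v \<bullet> i\<bar> \<le> 1 * norm v" using Basis_le_norm[OF i, of v] s by (intro mult_mono) auto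
      then show "\<bar>s * (v \<bullet> i)\<bar> \<le> norm v" by (simp add: abs_mult)
    qed
    then show ?thesis
      unfolding mem_box c_def by (fastforce simp: inner_simps abs_le_iff)
  qed
  define G where "G s = integral (cbox (- c) c) (\<lambda>x. g (x + s *\<^sub>R v))" for s
  have G: "G s = integral UNIV g" if "\<bar>s\<bar> \<le> 1" for s
  proof -
    have "G s = integral (cbox (- c + s *\<^sub>R v) (c + s *\<^sub>R v)) g"
      using integral_shift_cbox[of "- c + s *\<^sub>R v" "s *\<^sub>R v" "c + s *\<^sub>R v" g] by (simp add: G_def)
    also have "\<dots> = integral UNIV g"
    proof (rule integral_UNIV_support[symmetric])
      fix x assume "x \<notin> cbox (- c + s *\<^sub>R v) (c + s *\<^sub>R v)"
      then have "\<not> norm x \<le> R + 1" using in_box that by blast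
      then show "g x = 0" using S(2) R by force
    qed
    finally show ?thesis .
  qed
  have cg: "continuous_on UNIV g" by (rule C1_on_continuous_on[OF g])
  have cdg: "continuous_on UNIV (\<lambda>x. frechet_derivative g (at x) v)"
    by (rule C1_on_continuous_derivative[OF g])
  have "(G has_field_derivative integral (cbox (- c) c) (\<lambda>x. frechet_derivative g (at (x + 0 *\<^sub>R v)) v)) (at 0 within UNIV)"
    unfolding G_def[abs_def]
  proof (rule leibniz_rule_field_derivative)
    fix s :: real and x
    have "((\<lambda>s. g (x + s *\<^sub>R v)) has_derivative (\<lambda>h. frechet_derivative g (at (x + s *\<^sub>R v)) (h *\<^sub>R v))) (at s)"
      by (rule has_derivative_compose[where g=g and f="\<lambda>s. x + s *\<^sub>R v", OF _ C1_on_has_derivative[OF g UNIV_I]])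
        (auto intro!: derivative_eq_intros)
    then show "((\<lambda>s. g (x + s *\<^sub>R v)) has_field_derivative frechet_derivative g (at (x + s *\<^sub>R v)) v) (at s within UNIV)"
      using linear_frechet_derivative[OF C1_on_differentiable[OF g UNIV_I]]
      by (simp add: has_field_derivative_def linear_cmul mult_commute_abs)
  next
    show "(\<lambda>x. g (x + s *\<^sub>R v)) integrable_on cbox (- c) c" for s
      by (intro integrable_continuous continuous_on_compose2[OF cg]) (auto intro!: continuous_intros)
    show "continuous_on (UNIV \<times> cbox (- c) c) (\<lambda>(s, x). frechet_derivative g (at (x + s *\<^sub>R v)) v)"
      unfolding case_prod_beta
      by (rule continuous_on_compose2[OF cdg]) (auto intro!: continuous_intros)
  qed auto
  moreover have "(G has_field_derivative 0) (at 0)"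
    by (rule has_field_derivative_transform_within_open[OF DERIV_const[of "integral UNIV g"], where S="{-1<..<1}"])
      (auto intro!: G[symmetric])
  ultimately have 0: "integral (cbox (- c) c) (\<lambda>x. frechet_derivative g (at x) v) = 0"
    using DERIV_unique by fastforce
  have "frechet_derivative g (at x) v = 0" if "x \<notin> cbox (- c) c" for x
  proof -
    have "norm x > R + 1" using in_box[of x 0] that by force
    have "(g has_derivative (\<lambda>_. 0)) (at x)"
    proof (rule has_derivative_transform_within_open[OF has_derivative_const, where s="- cball 0 R"])
      show "x \<in> - cball 0 R" using \<open>norm x > R + 1\<close> by simp
      show "0 = g y" if "y \<in> - cball 0 R" for y using S(2)[of y] R[of y] that by force
    qed auto
    then show ?thesis by (simp add: frechet_derivative_at[symmetric])
  qed
  from integral_UNIV_support[OF this] 0 show ?thesis by (rule trans)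
qed

section \<open>Extension by zero, change of variables and bump functions\<close>

lemma continuous_on_ext0:
  fixes f :: "real \<times> 'e::euclidean_space \<Rightarrow> real"
  assumes "open J" "open U" "compact K" "continuous_on (J \<times> U) f"
    "\<And>t x. t \<in> J \<Longrightarrow> x \<in> U \<Longrightarrow> x \<notin> K \<Longrightarrow> f (t, x) = 0" "K \<subseteq> U"
  shows "continuous_on (J \<times> UNIV) (\<lambda>z. if snd z \<in> U then f z else 0)"
proof -
  let ?f = "\<lambda>z. if snd z \<in> U then f z else 0"
  have "J \<times> UNIV = J \<times> U \<union> J \<times> (- K)" using assms(6) by auto
  moreover have "continuous_on (J \<times> U) ?f"
    using assms(4) by (rule continuous_on_eq) auto
  moreover have "continuous_on (J \<times> (- K)) ?f"
    by (rule continuous_on_eq[OF continuous_on_const[of _ 0]]) (use assms(5) in auto)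
  ultimately show ?thesis
    using assms by (auto intro!: continuous_on_open_Un open_Times simp: compact_imp_closed open_Compl)
qed

lemma continuous_on_ext0':
  fixes f :: "'e::euclidean_space \<Rightarrow> real"
  assumes "open U" "compact K" "continuous_on U f" "\<And>x. x \<in> U \<Longrightarrow> x \<notin> K \<Longrightarrow> f x = 0" "K \<subseteq> U"
  shows "continuous_on UNIV (\<lambda>x. if x \<in> U then f x else 0)"
proof -
  let ?f = "\<lambda>z. if z \<in> U then f z else 0"
  have "UNIV = U \<union> - K" using assms by auto
  moreover have "continuous_on U ?f"
    using assms(3) by (rule continuous_on_eq) auto
  moreover have "continuous_on (- K) ?f"
    by (rule continuous_on_eq[OF continuous_on_const[of _ 0]]) (use assms(4) in auto)
  ultimately show ?thesis
    using assms by (metis compact_imp_closed continuous_on_open_Un open_Compl)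
qed

lemma C1_on_ext0:
  fixes f :: "'e::euclidean_space \<Rightarrow> real"
  assumes "open U" "compact K" "C1_on U f" "\<And>x. x \<in> U \<Longrightarrow> x \<notin> K \<Longrightarrow> f x = 0" "K \<subseteq> U"
  shows "C1_on UNIV (\<lambda>x. if x \<in> U then f x else 0)"
proof (rule C1_on_local)
  fix x
  show "\<exists>N g. open N \<and> x \<in> N \<and> C1_on N g \<and> (\<forall>y\<in>N. (if y \<in> U then f y else 0) = g y)"
  proof (cases "x \<in> U")
    case True then show ?thesis using assms(1,3) by (intro exI[of _ U] exI[of _ f]) auto
  next
    case False then show ?thesis using assms(2,4,5)
      by (intro exI[of _ "- K"] exI[of _ "\<lambda>_. 0"]) (auto simp: compact_imp_closed open_Compl)
  qed
qed

text \<open>Reduced to the vector-valued change of variables theorem by viewing \<open>f\<close> as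
  a map into \<open>real^1\<close>; compactness and continuity give absolute integrability.\<close>

lemma integral_change_of_variables_real:
  fixes f :: "real^'m::{finite,wellorder} \<Rightarrow> real" and g :: "real^'m::_ \<Rightarrow> real^'m::_"
  assumes S: "compact S" and der_g: "\<And>x. x \<in> S \<Longrightarrow> (g has_derivative g' x) (at x)"
    and inj: "inj_on g S" and f: "continuous_on (g ` S) f"
  shows "integral S (\<lambda>x. \<bar>det (matrix (g' x))\<bar> * f (g x)) = integral (g ` S) f"
proof -
  have cg: "continuous_on S g"
    using der_g by (intro continuous_at_imp_continuous_on) (auto intro: has_derivative_continuous)
  have cS: "compact (g ` S)" using cg S by (rule compact_continuous_image)
  have "(\<lambda>x. vec (f x) :: real^1) absolutely_integrable_on (g ` S)"
  proof -
    have "continuous_on (g ` S) (\<lambda>x. vec (f x) :: real^1)"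
      unfolding vec_def by (rule continuous_on_vec_lambda[OF f])
    from borel_integrable_compact[OF cS this] show ?thesis
      unfolding set_integrable_def by (rule integrable_completion[THEN iffD2, rotated]) 
        (use borel_integrable_compact[OF cS \<open>continuous_on (g ` S) (\<lambda>x. vec (f x) :: real^1)\<close>] in \<open>auto dest: borel_measurable_integrable\<close>)
  qed
  then have "integral S (\<lambda>x. \<bar>det (matrix (g' x))\<bar> *\<^sub>R (vec (f (g x)) :: real^1)) = integral (g ` S) (\<lambda>x. vec (f x))"
    by (intro integral_change_of_variables[where g=g and f="\<lambda>x. vec (f x)", symmetric] inj disjI1
      has_derivative_at_withinI[OF der_g] fmeasurableD lmeasurable_compact S)
  then have "integral S (\<lambda>x. \<bar>det (matrix (g' x))\<bar> *\<^sub>R (vec (f (g x)) :: real^1)) $ 1 = integral (g ` S) (\<lambda>x. vec (f x) :: real^1) $ 1"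
    by simp
  then show ?thesis by (simp add: integral_on_1_eq)
qed

text \<open>Squaring the positive part makes it continuously differentiable: at \<open>0\<close> the
  difference quotient is at most \<open>|h|\<close>.\<close>

lemma C1_on_bump: "C1_on S (\<lambda>x::'e::euclidean_space. (max 0 (r\<^sup>2 - (norm (x - a))\<^sup>2))\<^sup>2)"
proof -
  have 1: "C1_on UNIV (\<lambda>t::real. (max 0 t)\<^sup>2)"
  proof (rule C1_on_real)
    fix t :: real
    show "((\<lambda>t. (max 0 t)\<^sup>2) has_real_derivative 2 * max 0 t) (at t)"
    proof (cases "t = 0")
      case True
      have "((\<lambda>h. ((max 0 (0 + h))\<^sup>2 - (max 0 (0::real))\<^sup>2) / h) \<longlongrightarrow> 0) (at 0)"
      proof (rule Lim_null_comparison)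
        show "\<forall>\<^sub>F h in at 0. norm (((max 0 (0 + h))\<^sup>2 - (max 0 (0::real))\<^sup>2) / h) \<le> \<bar>h\<bar>"
          by (intro always_eventually allI) (simp add: max_def power2_eq_square)
        show "((\<lambda>h::real. \<bar>h\<bar>) \<longlongrightarrow> 0) (at 0)" using tendsto_rabs_zero tendsto_ident_at by blast
      qed
      then show ?thesis using True by (simp add: DERIV_def)
    next
      case False
      then consider "t > 0" | "t < 0" by linarith
      then show ?thesis
      proof cases
        case 1
        then show ?thesis
          using DERIV_pow[of 2 t UNIV]
          by (auto simp: max_def intro: has_field_derivative_transform_within_open[of "\<lambda>t. t\<^sup>2" _ _ "{0<..}"])
      next
        case 2
        then show ?thesis
          using DERIV_const[of 0 "at t"]
          by (auto simp: max_def intro: has_field_derivative_transform_within_open[of "\<lambda>t. 0" _ _ "{..<0}"])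
      qed
    qed
  qed (intro continuous_intros)
  have "C1_on S (\<lambda>x. r\<^sup>2 - (norm (x - a))\<^sup>2)"
    unfolding power2_norm_eq_inner
    by (rule C1_onI[where f'="\<lambda>x v. - (2 * ((x - a) \<bullet> v))"])
      (auto intro!: derivative_eq_intros continuous_intros simp: inner_commute)
  from C1_on_compose[OF 1 this] show ?thesis by simp
qed

text \<open>Charts form an indexed family with explicit inverses \<open>e\<close>, so that complex
  charts followed by a real-linear isomorphism fit in directly. The sort \<open>wellorder\<close> is
  what the change of variables theorem asks of the index type.\<close>

locale closed_C1_manifold =
  fixes T :: "'b topology" and I :: "'i set" and D :: "'i \<Rightarrow> 'b set"
    and k :: "'i \<Rightarrow> 'b \<Rightarrow> real^'k::{finite,wellorder}" and e :: "'i \<Rightarrow> (real, 'k) vec \<Rightarrow> 'b"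
  assumes compact: "compact_space T" and haus: "Hausdorff_space T"
    and cover: "(\<Union>i\<in>I. D i) = topspace T"
    and open_D: "\<And>i. i \<in> I \<Longrightarrow> openin T (D i)"
    and open_im: "\<And>i. i \<in> I \<Longrightarrow> open (k i ` D i)"
    and homeo: "\<And>i. i \<in> I \<Longrightarrow> homeomorphic_maps (subtopology T (D i)) (top_of_set (k i ` D i)) (k i) (e i)"
    and C1_trans: "\<And>i j. i \<in> I \<Longrightarrow> j \<in> I \<Longrightarrow> C1_on (k i ` (D i \<inter> D j)) (\<lambda>x. k j (e i x))"
begin

lemma D_sub: "i \<in> I \<Longrightarrow> D i \<subseteq> topspace T"
  using open_D openin_subset by blast

lemma ek: "i \<in> I \<Longrightarrow> q \<in> D i \<Longrightarrow> e i (k i q) = q"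
  using homeo D_sub unfolding homeomorphic_maps_def by (simp add: inf_absorb2)

lemma ke: "i \<in> I \<Longrightarrow> x \<in> k i ` D i \<Longrightarrow> k i (e i x) = x"
  by (auto simp: ek)

lemma e_in: "i \<in> I \<Longrightarrow> x \<in> k i ` D i \<Longrightarrow> e i x \<in> D i"
  by (auto simp: ek)

lemma open_image: "i \<in> I \<Longrightarrow> openin T U \<Longrightarrow> U \<subseteq> D i \<Longrightarrow> open (k i ` U)"
proof -
  assume i: "i \<in> I" and U: "openin T U" "U \<subseteq> D i"
  have "open_map (subtopology T (D i)) (top_of_set (k i ` D i)) (k i)"
    using homeo[OF i] by (intro homeomorphic_imp_open_map) (simp add: homeomorphic_maps_map)
  moreover have "openin (subtopology T (D i)) U" using U i by (simp add: openin_open_subtopology open_D)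
  ultimately show "open (k i ` U)"
    using open_im[OF i] openin_open_eq[OF open_im[OF i]] unfolding open_map_def by blast
qed

lemma open_preimage: "i \<in> I \<Longrightarrow> open V \<Longrightarrow> openin T {q \<in> D i. k i q \<in> V}"
proof -
  assume i: "i \<in> I" and V: "open V"
  have "continuous_map (subtopology T (D i)) euclidean (k i)"
    using homeo[OF i] unfolding homeomorphic_maps_def by (simp add: continuous_map_in_subtopology)
  then have "openin (subtopology T (D i)) {q \<in> topspace (subtopology T (D i)). k i q \<in> V}"
    using V by (intro openin_continuous_map_preimage) auto
  then show ?thesis
    using open_D[OF i] D_sub[OF i] by (simp add: openin_open_subtopology inf_absorb2)
qed

lemma closed_image_compact: "i \<in> I \<Longrightarrow> compact K \<Longrightarrow> K \<subseteq> k i ` D i \<Longrightarrow> closedin T (e i ` K)"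
proof -
  assume i: "i \<in> I" and K: "compact K" "K \<subseteq> k i ` D i"
  have "continuous_map (top_of_set (k i ` D i)) T (e i)"
    using homeo[OF i] unfolding homeomorphic_maps_def by (simp add: continuous_map_in_subtopology)
  then have "compactin T (e i ` K)"
    using K by (intro image_compactin[where X="top_of_set (k i ` D i)"]) (auto simp: compactin_subtopology)
  then show ?thesis using haus compactin_imp_closedin by blast
qed

lemma open_image_Int: "i \<in> I \<Longrightarrow> j \<in> I \<Longrightarrow> open (k i ` (D i \<inter> D j))"
  by (intro open_image openin_Int open_D) auto

definition bump :: "'i \<times> (real, 'k) vec \<times> real \<Rightarrow> 'b \<Rightarrow> real" where
  "bump p q = (case p of (i, a, r) \<Rightarrow> if q \<in> D i then (max 0 (r\<^sup>2 - (norm (k i q - a))\<^sup>2))\<^sup>2 else 0)"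

text \<open>Over \<open>D i\<close> the function is composed with a transition map. Off
  \<open>D i\<close>, the image of \<open>cball a r\<close> is compact, hence closed in the
  Hausdorff space \<open>T\<close>, so the bump vanishes on a whole neighbourhood.\<close>

lemma C1_bump:
  assumes i: "i \<in> I" and a: "cball a r \<subseteq> k i ` D i" "r > 0" and j: "j \<in> I"
  shows "C1_on (k j ` D j) (\<lambda>x. bump (i, a, r) (e j x))"
proof (rule C1_on_local)
  fix x assume x: "x \<in> k j ` D j"
  show "\<exists>N g. open N \<and> x \<in> N \<and> C1_on N g \<and> (\<forall>y\<in>N. bump (i, a, r) (e j y) = g y)"
  proof (cases "e j x \<in> D i")
    case True
    show ?thesis
    proof (intro exI conjI ballI)
      show "open (k j ` (D j \<inter> D i))" using i j by (rule open_image_Int[rotated])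
      show "x \<in> k j ` (D j \<inter> D i)" using True e_in[OF j x] ke[OF j x]
        by (intro image_eqI[of x "k j" "e j x"]) auto
      show "C1_on (k j ` (D j \<inter> D i)) (\<lambda>x. (max 0 (r\<^sup>2 - (norm (k i (e j x) - a))\<^sup>2))\<^sup>2)"
        by (rule C1_on_compose[OF C1_on_bump[where S=UNIV] C1_trans[OF j i]]) simp
      show "bump (i, a, r) (e j y) = (max 0 (r\<^sup>2 - (norm (k i (e j y) - a))\<^sup>2))\<^sup>2"
        if "y \<in> k j ` (D j \<inter> D i)" for y using that ek[OF j] by (auto simp: bump_def)
    qed
  next
    case False
    show ?thesis
    proof (intro exI conjI ballI)
      have "closedin T (e i ` cball a r)" using i a by (intro closed_image_compact) auto
      then show "open (k j ` (D j - e i ` cball a r))"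
        by (intro open_image j openin_diff open_D) auto
      have "e j x \<notin> e i ` cball a r" using False a e_in[OF i] by auto
      then show "x \<in> k j ` (D j - e i ` cball a r)" using e_in[OF j x] ke[OF j x]
        by (intro image_eqI[of x "k j" "e j x"]) auto
      show "C1_on (k j ` (D j - e i ` cball a r)) (\<lambda>x. 0 :: real)" by simp
      show "bump (i, a, r) (e j y) = 0" if "y \<in> k j ` (D j - e i ` cball a r)" for y
      proof (cases "e j y \<in> D i")
        case True
        from that have "e j y \<notin> e i ` cball a r" using ek[OF j] by auto
        then have "k i (e j y) \<notin> cball a r" using ek[OF i True] by (metis imageI)
        then have "r < norm (k i (e j y) - a)" by (simp add: dist_norm norm_minus_commute)
        then have "r\<^sup>2 - (norm (k i (e j y) - a))\<^sup>2 \<le> 0" using a(2) by (simp add: power_mono)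
        then show ?thesis by (simp add: bump_def max_def)
      qed (simp add: bump_def)
    qed
  qed
qed

text \<open>Finitely many bumps, divided by their sum. Each \<open>p\<close> comes with a chart
  \<open>\<iota> p\<close> and a compact \<open>K p\<close> inside the image of that chart: in
  coordinates, \<open>\<rho> p\<close> can then be extended by zero and integrated over the whole
  space.\<close>

lemma partition_of_unity:
  obtains P :: "('i \<times> (real, 'k) vec \<times> real) set" and \<rho> \<iota> K where "finite P"
    "\<And>p. p \<in> P \<Longrightarrow> \<iota> p \<in> I" "\<And>p. p \<in> P \<Longrightarrow> compact (K p)" "\<And>p. p \<in> P \<Longrightarrow> K p \<subseteq> k (\<iota> p) ` D (\<iota> p)"
    "\<And>p q. p \<in> P \<Longrightarrow> q \<in> topspace T \<Longrightarrow> \<rho> p q \<noteq> 0 \<Longrightarrow> q \<in> D (\<iota> p) \<and> k (\<iota> p) q \<in> K p"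
    "\<And>p q. p \<in> P \<Longrightarrow> q \<in> topspace T \<Longrightarrow> \<rho> p q \<ge> (0::real)"
    "\<And>q. q \<in> topspace T \<Longrightarrow> (\<Sum>p\<in>P. \<rho> p q) = 1"
    "\<And>p j. p \<in> P \<Longrightarrow> j \<in> I \<Longrightarrow> C1_on (k j ` D j) (\<lambda>x. \<rho> p (e j x))"
proof -
  define B where "B = (\<lambda>(i, a, r). {q \<in> D i. k i q \<in> ball a r})"
  define Q where "Q = {(i, a, r). i \<in> I \<and> r > 0 \<and> cball a r \<subseteq> k i ` D i}"
  have "\<forall>U\<in>B ` Q. openin T U" 
    using open_preimage[OF _ open_ball] by (auto simp: B_def Q_def)
  moreover have "topspace T \<subseteq> \<Union>(B ` Q)"
  proof
    fix q assume "q \<in> topspace T"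
    then obtain i where i: "i \<in> I" "q \<in> D i" using cover by blast
    then obtain r where r: "r > 0" "cball (k i q) r \<subseteq> k i ` D i"
      using open_im[OF i(1)] open_contains_cball by blast
    then have "(i, k i q, r) \<in> Q" "q \<in> B (i, k i q, r)" using i by (auto simp: Q_def B_def)
    then show "q \<in> \<Union>(B ` Q)" by blast
  qed
  ultimately obtain \<F> where F: "finite \<F>" "\<F> \<subseteq> B ` Q" "topspace T \<subseteq> \<Union>\<F>"
    using compact unfolding compact_space_alt by meson
  obtain P where P: "P \<subseteq> Q" "finite P" "\<F> = B ` P"
    using F(1,2) finite_subset_image[of \<F> B Q] by metis
  define S where "S q = (\<Sum>p\<in>P. bump p q)" for q
  have bump0: "bump p q \<ge> 0" for p q by (auto simp: bump_def split: prod.splits)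
  have Spos: "S q > 0" if "q \<in> topspace T" for q
  proof -
    obtain p where p: "p \<in> P" "q \<in> B p" using F(3) P(3) \<open>q \<in> topspace T\<close> by blast
    obtain i a r where pe: "p = (i, a, r)" by (cases p)
    have "norm (k i q - a) < r" "q \<in> D i"
      using p(2) by (auto simp: pe B_def dist_norm norm_minus_commute)
    moreover from this have "(norm (k i q - a))\<^sup>2 < r\<^sup>2" by (intro power_strict_mono) auto
    ultimately have "bump p q > 0" by (simp add: pe bump_def)
    then show ?thesis unfolding S_def using P(2) p(1) bump0 by (intro sum_pos2) auto
  qed
  show ?thesis
  proof (rule that[of P fst "\<lambda>(i, a, r). cball a r" "\<lambda>p q. bump p q / S q"])
    show "finite P" by fact
    show "fst p \<in> I" if "p \<in> P" for p using that P(1) by (auto simp: Q_def)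
    show "compact (case p of (i, a, r) \<Rightarrow> cball a r)" for p :: "'i \<times> (real, 'k) vec \<times> real" by (cases p) simp
    show "(case p of (i, a, r) \<Rightarrow> cball a r) \<subseteq> k (fst p) ` D (fst p)" if "p \<in> P" for p
      using that P(1) by (cases p) (auto simp: Q_def)
    show "q \<in> D (fst p) \<and> k (fst p) q \<in> (case p of (i, a, r) \<Rightarrow> cball a r)"
      if "p \<in> P" "q \<in> topspace T" "bump p q / S q \<noteq> 0" for p q
    proof -
      obtain i a r where pe: "p = (i, a, r)" by (cases p)
      have r: "r > 0" using that P(1) by (auto simp: pe Q_def)
      have "q \<in> D i" "max 0 (r\<^sup>2 - (norm (k i q - a))\<^sup>2) \<noteq> 0"
        using that(3) by (auto simp: pe bump_def split: if_splits)
      then have "(norm (k i q - a))\<^sup>2 \<le> r\<^sup>2" by (auto simp: max_def split: if_splits)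
      then have "norm (k i q - a) \<le> r" using r by (simp add: power2_le_iff_abs_le)
      then show ?thesis using \<open>q \<in> D i\<close> by (simp add: pe dist_norm norm_minus_commute)
    qed
    show "bump p q / S q \<ge> 0" if "q \<in> topspace T" for p q
      using bump0[of p q] Spos[OF that] by simp
    show "(\<Sum>p\<in>P. bump p q / S q) = 1" if "q \<in> topspace T" for q
      using Spos[OF that] by (simp add: sum_divide_distrib[symmetric] S_def[symmetric])
    have C: "C1_on (k j ` D j) (\<lambda>x. bump p (e j x))" if "p \<in> P" "j \<in> I" for p j
      using that P(1) by (cases p) (auto simp: Q_def intro: C1_bump)
    show "C1_on (k j ` D j) (\<lambda>x. bump p (e j x) / S (e j x))" if "p \<in> P" "j \<in> I" for p j
    proof (rule C1_on_divide[OF C[OF that]])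
      show "C1_on (k j ` D j) (\<lambda>x. S (e j x))" unfolding S_def using C that(2) by (intro C1_on_sum)
      show "S (e j x) \<noteq> 0" if "x \<in> k j ` D j" for x
        using Spos[of "e j x"] e_in[OF \<open>j \<in> I\<close> that] D_sub[OF \<open>j \<in> I\<close>] by force
    qed
  qed
qed

end

section \<open>Conservation laws and the volume of fibres\<close>

context closed_C1_manifold begin

text \<open>A continuity equation: \<open>V\<close> changes by the divergence of \<open>W\<close>,
  which by \<open>trans\<close> behaves like a vector field times a density. Integrating by parts
  against \<open>\<rho> p\<close> leaves minus the derivative of \<open>\<rho> p\<close> along
  \<open>W\<close>. After inserting the partition once more and moving the term of
  \<open>(p, p')\<close> into the chart of \<open>p'\<close>, the sum over \<open>p\<close> is the
  differential of the constant \<open>1\<close>.\<close>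

lemma integral_flux_constant:
  fixes V :: "'i \<Rightarrow> real \<times> (real, 'k) vec \<Rightarrow> real" and W :: "'i \<Rightarrow> real \<times> (real, 'k) vec \<Rightarrow> (real, 'k) vec"
  assumes P: "finite P" "\<And>p. p \<in> P \<Longrightarrow> \<iota> p \<in> I" "\<And>p. p \<in> P \<Longrightarrow> compact (K p)"
      "\<And>p. p \<in> P \<Longrightarrow> K p \<subseteq> k (\<iota> p) ` D (\<iota> p)"
    and supp: "\<And>p q. p \<in> P \<Longrightarrow> q \<in> topspace T \<Longrightarrow> \<rho> p q \<noteq> 0 \<Longrightarrow> q \<in> D (\<iota> p) \<and> k (\<iota> p) q \<in> K p"
    and one: "\<And>q. q \<in> topspace T \<Longrightarrow> (\<Sum>p\<in>P. \<rho> p q) = (1::real)"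
    and C\<rho>: "\<And>p j. p \<in> P \<Longrightarrow> j \<in> I \<Longrightarrow> C1_on (k j ` D j) (\<lambda>x. \<rho> p (e j x))"
    and J: "open J" "convex J"
    and CV: "\<And>i. i \<in> I \<Longrightarrow> C1_on (J \<times> k i ` D i) (V i)"
    and CW: "\<And>i l. i \<in> I \<Longrightarrow> C1_on (J \<times> k i ` D i) (\<lambda>z. W i z $ l)"
    and div: "\<And>i z. i \<in> I \<Longrightarrow> z \<in> J \<times> k i ` D i \<Longrightarrow>
      (\<Sum>l\<in>UNIV. frechet_derivative (\<lambda>z. W i z $ l) (at z) (0, axis l 1)) = frechet_derivative (V i) (at z) (1, 0)"
    and trans: "\<And>i j q t. i \<in> I \<Longrightarrow> j \<in> I \<Longrightarrow> q \<in> D i \<inter> D j \<Longrightarrow> t \<in> J \<Longrightarrow>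
      frechet_derivative (\<lambda>x. k j (e i x)) (at (k i q)) (W i (t, k i q))
      = \<bar>det (matrix (frechet_derivative (\<lambda>x. k j (e i x)) (at (k i q))))\<bar> *\<^sub>R W j (t, k j q)"
  defines "F \<equiv> \<lambda>t. \<Sum>p\<in>P. integral UNIV (\<lambda>x. if x \<in> k (\<iota> p) ` D (\<iota> p) then \<rho> p (e (\<iota> p) x) * V (\<iota> p) (t, x) else 0)"
  assumes st: "s \<in> J" "t \<in> J"
  shows "F s = F t"
proof -
  define im where "im p = k (\<iota> p) ` D (\<iota> p)" for p
  define r where "r p j x = \<rho> p (e j x)" for p j x
  define dr where "dr p j x = frechet_derivative (r p j) (at x)" for p j x
  have im: "open (im p)" if "p \<in> P" for p unfolding im_def using open_im P(2) that by blast
  have et: "e j x \<in> topspace T" if "j \<in> I" "x \<in> k j ` D j" for j x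
    using e_in[OF that] D_sub[OF that(1)] by blast
  have Cr: "C1_on (k j ` D j) (r p j)" if "p \<in> P" "j \<in> I" for p j
    unfolding r_def using C\<rho>[OF that] .
  have Crp: "C1_on (im p) (r p (\<iota> p))" if "p \<in> P" for p
    unfolding im_def using Cr that P(2) by blast
  have r0: "r p (\<iota> p) x = 0" if "p \<in> P" "x \<in> im p" "x \<notin> K p" for p x
    using supp[OF that(1) et[OF P(2)[OF that(1)]], of x] ke[OF P(2)[OF that(1)]] that(2,3)
    unfolding r_def im_def by metis
  have rder: "(r p j has_derivative dr p j x) (at x)" if "p \<in> P" "j \<in> I" "x \<in> k j ` D j" for p j x
    unfolding dr_def by (rule C1_on_has_derivative[OF Cr[OF that(1,2)] that(3)])
  have lindr: "linear (dr p j x)" if "p \<in> P" "j \<in> I" "x \<in> k j ` D j" for p j x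
    using rder[OF that] has_derivative_linear by blast
  have dr0: "dr p (\<iota> p) x = (\<lambda>_. 0)" if "p \<in> P" "x \<in> im p" "x \<notin> K p" for p x
  proof -
    have "open (im p - K p)" using im[OF that(1)] P(3)[OF that(1)] by (simp add: compact_imp_closed open_Diff)
    then have "(r p (\<iota> p) has_derivative (\<lambda>_. 0)) (at x)"
      by (rule has_derivative_transform_within_open[OF has_derivative_const]) (use that r0 in auto)
    then show ?thesis unfolding dr_def by (rule frechet_derivative_at[symmetric])
  qed
  have slice: "((\<lambda>y. f (t, y)) has_derivative (\<lambda>h. frechet_derivative f (at (t, x)) (0, h))) (at x)"
    if "C1_on (J \<times> U) f" "t \<in> J" "x \<in> U" for f :: "real \<times> (real, 'k) vec \<Rightarrow> real" and U t x
    by (rule has_derivative_compose[where g=f and f="\<lambda>y. (t, y)", OF _ C1_on_has_derivative[OF that(1)]])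
      (use that in \<open>auto intro!: derivative_eq_intros\<close>)
  have slice': "((\<lambda>t. f (t, x)) has_real_derivative frechet_derivative f (at (t, x)) (1, 0)) (at t)"
    if "C1_on (J \<times> U) f" "t \<in> J" "x \<in> U" for f :: "real \<times> (real, 'k) vec \<Rightarrow> real" and U t x
  proof -
    have "((\<lambda>t. f (t, x)) has_derivative (\<lambda>h. frechet_derivative f (at (t, x)) (h, 0))) (at t)"
      by (rule has_derivative_compose[where g=f and f="\<lambda>t. (t, x)", OF _ C1_on_has_derivative[OF that(1)]])
        (use that in \<open>auto intro!: derivative_eq_intros\<close>)
    moreover have "(\<lambda>h. frechet_derivative f (at (t, x)) (h, 0)) = (*) (frechet_derivative f (at (t, x)) (1, 0))"
    proof
      fix h :: real
      have lin: "linear (frechet_derivative f (at (t, x)))"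
        using that by (intro linear_frechet_derivative C1_on_differentiable[OF that(1)]) auto
      show "frechet_derivative f (at (t, x)) (h, 0) = frechet_derivative f (at (t, x)) (1, 0) * h"
        using linear_cmul[OF lin, of h "(1, 0)"] by (simp add: mult.commute)
    qed
    ultimately show ?thesis by (simp only: has_field_derivative_def)
  qed
  have Cslice: "C1_on U (\<lambda>y. f (t, y))"
    if "C1_on (J \<times> U) f" "t \<in> J" for f :: "real \<times> (real, 'k) vec \<Rightarrow> real" and U t
    by (rule C1_onI[OF slice[OF that]], assumption,
        rule continuous_on_compose2[OF C1_on_continuous_derivative[OF that(1)]])
      (use that in \<open>auto intro!: continuous_intros\<close>)
  \<comment> \<open>\<open>G\<close> is the time derivative of the \<open>p\<close>-th summand of
    \<open>F\<close>; \<open>H\<close> below integrates \<open>\<rho> p'\<close> times the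
    derivative of \<open>\<rho> p\<close> along \<open>W\<close>, computed in chart
    \<open>j\<close>.\<close>
  define G where "G t p = integral UNIV (\<lambda>x. if x \<in> im p then r p (\<iota> p) x * frechet_derivative (V (\<iota> p)) (at (t, x)) (1, 0) else 0)" for t p
  define H where "H t p p' j = integral UNIV (\<lambda>x. if x \<in> k j ` D j then r p' j x * dr p j x (W j (t, x)) else 0)" for t p p' j
  have "(F has_real_derivative (\<Sum>p\<in>P. G t p)) (at t within J)" if t: "t \<in> J" for t
    unfolding F_def
  proof (rule DERIV_sum)
    fix p assume p: "p \<in> P"
    obtain a b where ab: "K p \<subseteq> cbox a b" using P(3)[OF p] bounded_subset_cbox_symmetric compact_imp_bounded by metis
    let ?f = "\<lambda>t x. if x \<in> im p then r p (\<iota> p) x * V (\<iota> p) (t, x) else 0"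
    let ?f' = "\<lambda>t x. if x \<in> im p then r p (\<iota> p) x * frechet_derivative (V (\<iota> p)) (at (t, x)) (1, 0) else 0"
    have off: "x \<notin> cbox a b \<Longrightarrow> ?f t x = 0" "x \<notin> cbox a b \<Longrightarrow> ?f' t x = 0" for t x
      using r0[OF p, of x] ab by auto
    have cr: "continuous_on (J \<times> im p) (\<lambda>z. r p (\<iota> p) (snd z))"
      by (rule continuous_on_compose2[OF C1_on_continuous_on[OF Crp[OF p]]]) (auto intro!: continuous_intros)
    have C: "C1_on (J \<times> im p) (V (\<iota> p))" using CV[OF P(2)[OF p]] by (simp add: im_def)
    have 1: "continuous_on (J \<times> UNIV) (\<lambda>z. if snd z \<in> im p then r p (\<iota> p) (snd z) * V (\<iota> p) z else 0)"
      by (rule continuous_on_ext0[OF J(1) im[OF p] P(3)[OF p] continuous_on_mult[OF cr C1_on_continuous_on[OF C]]])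
        (use r0[OF p] P(4)[OF p] in \<open>auto simp: im_def\<close>)
    have 2: "continuous_on (J \<times> UNIV) (\<lambda>z. if snd z \<in> im p then r p (\<iota> p) (snd z) * frechet_derivative (V (\<iota> p)) (at z) (1, 0) else 0)"
      by (rule continuous_on_ext0[OF J(1) im[OF p] P(3)[OF p] continuous_on_mult[OF cr C1_on_continuous_derivative[OF C]]])
        (use r0[OF p] P(4)[OF p] in \<open>auto simp: im_def\<close>)
    have "((\<lambda>t. integral (cbox a b) (?f t)) has_field_derivative integral (cbox a b) (?f' t)) (at t within J)"
    proof (rule leibniz_rule_field_derivative[OF _ _ _ t J(2)])
      fix t x assume t: "t \<in> J"
      show "((\<lambda>t. ?f t x) has_field_derivative ?f' t x) (at t within J)"
      proof (cases "x \<in> im p")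
        case True
        show ?thesis using DERIV_cmult[OF slice'[OF C t True], of "r p (\<iota> p) x"] True
          by (simp add: has_field_derivative_at_within)
      qed simp
    next
      fix t assume t: "t \<in> J"
      show "?f t integrable_on cbox a b"
      proof (rule integrable_continuous)
        have "continuous_on (cbox a b) (\<lambda>x. (t, x))" by (intro continuous_intros)
        moreover have "(\<lambda>x. (t, x)) ` cbox a b \<subseteq> J \<times> UNIV" using t by auto
        ultimately show "continuous_on (cbox a b) (?f t)"
          using continuous_on_compose2[OF 1, of "cbox a b" "\<lambda>x. (t, x)"] by (simp cong: if_cong)
      qed
    next
      show "continuous_on (J \<times> cbox a b) (\<lambda>(t, x). ?f' t x)"
        using continuous_on_subset[OF 2, of "J \<times> cbox a b"] by (simp add: case_prod_beta Sigma_mono cong: if_cong)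
    qed
    then show "((\<lambda>t. integral UNIV (\<lambda>x. if x \<in> k (\<iota> p) ` D (\<iota> p) then \<rho> p (e (\<iota> p) x) * V (\<iota> p) (t, x) else 0))
        has_real_derivative G t p) (at t within J)"
      unfolding im_def[symmetric] r_def[symmetric] G_def
      using integral_UNIV_support[of "cbox a b" "?f t" for t, OF off(1)] integral_UNIV_support[of "cbox a b" "?f' t", OF off(2)]
      by simp
  qed
  moreover have "(\<Sum>p\<in>P. G t p) = 0" if t: "t \<in> J" for t
  proof -
    have cH: "continuous_on (k j ` D j) (\<lambda>x. dr p j x (W j (t, x)))" if p: "p \<in> P" and j: "j \<in> I" for p j
    proof (rule continuous_on_linear_apply[OF lindr[OF p j]])
      show "continuous_on (k j ` D j) (\<lambda>x. dr p j x v)" for v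
        unfolding dr_def by (rule C1_on_continuous_derivative[OF Cr[OF p j]])
      have "continuous_on (k j ` D j) (\<lambda>x. \<chi> l. W j (t, x) $ l)"
        by (intro continuous_on_vec_lambda C1_on_continuous_on[OF Cslice[OF CW[OF j] t]])
      then show "continuous_on (k j ` D j) (\<lambda>x. W j (t, x))" by simp
    qed
    \<comment> \<open>Partial integration in the chart of \<open>p\<close>: the components
      \<open>g l\<close> of \<open>\<rho> p\<close> times \<open>W\<close> are compactly supported,
      so their partial derivatives have integral zero. The factor \<open>1\<close> is then written
      as the sum of all \<open>\<rho> p'\<close>.\<close>
    have GH: "G t p = - (\<Sum>p'\<in>P. H t p p' (\<iota> p))" if p: "p \<in> P" for p
    proof -
      let ?i = "\<iota> p"
      have i: "?i \<in> I" using P(2)[OF p] .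
      define g where "g l x = (if x \<in> im p then r p ?i x * W ?i (t, x) $ l else 0)" for l x
      have Cg0: "C1_on (im p) (\<lambda>x. r p ?i x * W ?i (t, x) $ l)" for l
        using C1_on_mult[OF Crp[OF p] Cslice[OF CW[OF i] t, folded im_def]] .
      have Cg: "C1_on UNIV (g l)" for l
        unfolding g_def by (rule C1_on_ext0[OF im[OF p] P(3)[OF p] Cg0]) (use r0[OF p] P(4)[OF p] in \<open>auto simp: im_def\<close>)
      have g0: "g l x = 0" if "x \<notin> K p" for l x using r0[OF p _ that] by (simp add: g_def)
      have dg: "frechet_derivative (g l) (at x) v = r p ?i x * frechet_derivative (\<lambda>z. W ?i z $ l) (at (t, x)) (0, v) + dr p ?i x v * W ?i (t, x) $ l"
        if x: "x \<in> im p" for l x v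
      proof -
        have "((\<lambda>x. r p ?i x * W ?i (t, x) $ l) has_derivative
           (\<lambda>v. r p ?i x * frechet_derivative (\<lambda>z. W ?i z $ l) (at (t, x)) (0, v) + dr p ?i x v * W ?i (t, x) $ l)) (at x)"
          using x by (intro has_derivative_mult rder p i slice[OF CW[OF i] t]) (auto simp: im_def)
        then have "(g l has_derivative
           (\<lambda>v. r p ?i x * frechet_derivative (\<lambda>z. W ?i z $ l) (at (t, x)) (0, v) + dr p ?i x v * W ?i (t, x) $ l)) (at x)"
          by (rule has_derivative_transform_within_open[OF _ im[OF p] x]) (simp add: g_def)
        then show ?thesis by (simp add: frechet_derivative_at[symmetric])
      qed
      have dg0: "frechet_derivative (g l) (at x) v = 0" if x: "x \<notin> K p" for l x v
      proof -
        have "open (- K p)" using P(3)[OF p] by (simp add: compact_imp_closed open_Compl)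
        then have "(g l has_derivative (\<lambda>_. 0)) (at x)"
          by (rule has_derivative_transform_within_open[OF has_derivative_const]) (use x g0 in auto)
        then show ?thesis by (simp add: frechet_derivative_at[symmetric])
      qed
      have intg: "(\<lambda>x. frechet_derivative (g l) (at x) (axis l 1)) integrable_on UNIV" for l
        by (rule integrable_compact_support[OF C1_on_continuous_derivative[OF Cg] compact_imp_bounded[OF P(3)[OF p]] dg0])
      have cont\<rho>: "continuous_on UNIV (\<lambda>x. if x \<in> im p then r p' ?i x * dr p ?i x (W ?i (t, x)) else 0)" if "p' \<in> P" for p'
        by (rule continuous_on_ext0'[OF im[OF p] P(3)[OF p]
              continuous_on_mult[OF C1_on_continuous_on[OF Cr[OF that i], folded im_def] cH[OF p i, folded im_def]]])
          (use dr0[OF p] P(4)[OF p] in \<open>auto simp: im_def\<close>)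
      have int\<rho>: "(\<lambda>x. if x \<in> im p then r p' ?i x * dr p ?i x (W ?i (t, x)) else 0) integrable_on UNIV" if "p' \<in> P" for p'
        by (rule integrable_compact_support[OF cont\<rho>[OF that] compact_imp_bounded[OF P(3)[OF p]]])
          (use dr0[OF p] in auto)
      have "(\<Sum>l\<in>UNIV. frechet_derivative (g l) (at x) (axis l 1)) =
          (if x \<in> im p then r p ?i x * frechet_derivative (V ?i) (at (t, x)) (1, 0) else 0)
          + (\<Sum>p'\<in>P. if x \<in> im p then r p' ?i x * dr p ?i x (W ?i (t, x)) else 0)" for x
      proof (cases "x \<in> im p")
        case False
        then have "x \<notin> K p" using P(4)[OF p] by (auto simp: im_def)
        then show ?thesis using False dg0 by simp
      next
        case x: True
        have "(\<Sum>l\<in>UNIV. dr p ?i x (axis l 1) * W ?i (t, x) $ l) = dr p ?i x (W ?i (t, x))"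
        proof -
          have "dr p ?i x (W ?i (t, x)) = dr p ?i x (\<Sum>l\<in>UNIV. W ?i (t, x) $ l *\<^sub>R axis l 1)"
            using basis_expansion[of "W ?i (t, x)"] by (simp add: scalar_mult_eq_scaleR)
          then show ?thesis
            using lindr[OF p i x[unfolded im_def]] by (simp add: linear_sum linear_cmul mult.commute)
        qed
        moreover have "(\<Sum>p'\<in>P. r p' ?i x) = 1"
          unfolding r_def using x by (intro one et[OF i]) (simp add: im_def)
        ultimately show ?thesis using x div[OF i, of "(t, x)"] t
          by (simp add: dg sum.distrib sum_distrib_left[symmetric] sum_distrib_right[symmetric] im_def[symmetric])
      qed
      then have "(\<lambda>x. if x \<in> im p then r p ?i x * frechet_derivative (V ?i) (at (t, x)) (1, 0) else 0)
         = (\<lambda>x. (\<Sum>l\<in>UNIV. frechet_derivative (g l) (at x) (axis l 1)) - (\<Sum>p'\<in>P. if x \<in> im p then r p' ?i x * dr p ?i x (W ?i (t, x)) else 0))"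
        by (simp only: add_diff_cancel_right')
      from arg_cong[OF this, of "integral UNIV"] have "G t p = integral UNIV (\<lambda>x. (\<Sum>l\<in>UNIV. frechet_derivative (g l) (at x) (axis l 1)) - (\<Sum>p'\<in>P. if x \<in> im p then r p' ?i x * dr p ?i x (W ?i (t, x)) else 0))"
        unfolding G_def .
      also have "\<dots> = (\<Sum>l\<in>UNIV. integral UNIV (\<lambda>x. frechet_derivative (g l) (at x) (axis l 1))) - (\<Sum>p'\<in>P. H t p p' ?i)"
        unfolding H_def im_def[symmetric] using P(1) intg int\<rho>
        by (subst Henstock_Kurzweil_Integration.integral_diff)
          (auto intro!: integrable_sum simp: Henstock_Kurzweil_Integration.integral_sum)
      also have "(\<Sum>l\<in>UNIV. integral UNIV (\<lambda>x. frechet_derivative (g l) (at x) (axis l 1))) = 0"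
        using integral_partial_derivative_eq_0[OF Cg compact_imp_bounded[OF P(3)[OF p]] g0] by simp
      finally show ?thesis by simp
    qed
    \<comment> \<open>Both integrands are supported over \<open>Z\<close>, the common part of the
      two compact supports. There the factor \<open>|det|\<close> in \<open>trans\<close> is exactly
      the Jacobian of the change of variables.\<close>
    have HH: "H t p p' (\<iota> p) = H t p p' (\<iota> p')" if p: "p \<in> P" and p': "p' \<in> P" for p p'
    proof -
      let ?i = "\<iota> p" and ?j = "\<iota> p'"
      have i: "?i \<in> I" and j: "?j \<in> I" using P(2)[OF p] P(2)[OF p'] .
      define Z where "Z = e ?i ` K p \<inter> e ?j ` K p'"
      have ZD: "Z \<subseteq> D ?i \<inter> D ?j" 
      proof -
        have "e ?i ` K p \<subseteq> D ?i" "e ?j ` K p' \<subseteq> D ?j"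
          by (rule image_subsetI, rule e_in[OF i subsetD[OF P(4)[OF p]]], assumption)
            (rule image_subsetI, rule e_in[OF j subsetD[OF P(4)[OF p']]], assumption)
        then show ?thesis unfolding Z_def by blast
      qed
      define S where "S = k ?i ` Z"
      let ?g = "\<lambda>x. k ?j (e ?i x)"
      have gS: "?g ` S = k ?j ` Z" unfolding S_def image_image
        using ek[OF i] ZD by (intro image_cong) auto
      have S_im: "S \<subseteq> im p" unfolding S_def im_def using ZD by blast
      have S_im': "S \<subseteq> k ?i ` (D ?i \<inter> D ?j)" unfolding S_def using ZD by blast
      have S': "S \<subseteq> K p"
      proof
        fix x assume "x \<in> S"
        then obtain y where y: "y \<in> K p" "x = k ?i (e ?i y)" unfolding S_def Z_def by blast
        then show "x \<in> K p" using ke[OF i subsetD[OF P(4)[OF p] y(1)]] by simp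
      qed
      have cS: "compact S"
      proof -
        have clZ: "closedin T (e ?j ` K p')" by (rule closed_image_compact[OF j P(3)[OF p'] P(4)[OF p']])
        \<comment> \<open>Compactness of \<open>S\<close>: it arises from \<open>K p\<close> by
          removing the image of an open set.\<close>
        have "S = K p - k ?i ` (D ?i - e ?j ` K p')"
        proof (intro set_eqI iffI)
          fix x assume "x \<in> S"
          then obtain q where q: "q \<in> Z" "x = k ?i q" unfolding S_def by blast
          then have "x \<in> K p" using \<open>x \<in> S\<close> S' by blast
          moreover have "x \<notin> k ?i ` (D ?i - e ?j ` K p')"
          proof
            assume "x \<in> k ?i ` (D ?i - e ?j ` K p')"
            then obtain q' where q': "q' \<in> D ?i" "q' \<notin> e ?j ` K p'" "x = k ?i q'" by blast
            then have "q' = q" using q(2) ek[OF i] ZD q(1) by (metis IntD1 subsetD)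
            then show False using q'(2) q(1) by (simp add: Z_def)
          qed
          ultimately show "x \<in> K p - k ?i ` (D ?i - e ?j ` K p')" by blast
        next
          fix x assume x: "x \<in> K p - k ?i ` (D ?i - e ?j ` K p')"
          then have xi: "x \<in> k ?i ` D ?i" using P(4)[OF p] by blast
          then have "e ?i x \<in> e ?j ` K p'" using x e_in[OF i xi] ke[OF i xi] by (metis DiffD2 DiffI image_eqI)
          then have "e ?i x \<in> Z" using x by (simp add: Z_def)
          then show "x \<in> S" unfolding S_def using ke[OF i xi] by (metis image_eqI)
        qed
        moreover have "open (k ?i ` (D ?i - e ?j ` K p'))"
          using clZ by (intro open_image[OF i] openin_diff open_D[OF i]) auto
        ultimately show ?thesis using P(3)[OF p] by (simp add: compact_diff)
      qed
      let ?f = "\<lambda>x. r p' ?j x * dr p ?j x (W ?j (t, x))"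
      have "H t p p' ?i = integral S (\<lambda>x. if x \<in> im p then r p' ?i x * dr p ?i x (W ?i (t, x)) else 0)"
        unfolding H_def im_def[symmetric]
      proof (rule integral_UNIV_support)
        fix x assume x: "x \<notin> S"
        show "(if x \<in> im p then r p' ?i x * dr p ?i x (W ?i (t, x)) else 0) = 0"
        proof (cases "x \<in> im p \<and> x \<in> K p \<and> r p' ?i x \<noteq> 0")
          case True
          then have xi: "x \<in> k ?i ` D ?i" by (simp add: im_def)
          have "e ?i x \<in> D ?j \<and> k ?j (e ?i x) \<in> K p'"
            using supp[OF p' et[OF i xi]] True by (simp add: r_def)
          then have "e ?i x \<in> Z" using True ek[OF j] unfolding Z_def by (metis IntI imageI)
          then have "x \<in> S" unfolding S_def using ke[OF i xi] by (metis image_eqI)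
          then show ?thesis using x by simp
        next
          case False
          then show ?thesis using dr0[OF p, of x] by auto
        qed
      qed
      also have "\<dots> = integral S (\<lambda>x. \<bar>det (matrix (frechet_derivative ?g (at x)))\<bar> * ?f (?g x))"
      proof (rule integral_cong)
        fix x assume x: "x \<in> S"
        then obtain q where q: "q \<in> D ?i" "q \<in> D ?j" "x = k ?i q" using S_im' by blast
        have xi: "x \<in> k ?i ` (D ?i \<inter> D ?j)" using x S_im' by blast
        have eq: "e ?i x = q" using q ek[OF i] by simp
        have g: "(?g has_derivative frechet_derivative ?g (at x)) (at x)"
          by (rule C1_on_has_derivative[OF C1_trans[OF i j] xi])
        have "(r p ?j has_derivative dr p ?j (?g x)) (at (?g x))"
          by (rule rder[OF p j]) (use q eq in simp)
        from has_derivative_compose[OF g this]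
        have "((\<lambda>x. r p ?j (?g x)) has_derivative (\<lambda>v. dr p ?j (?g x) (frechet_derivative ?g (at x) v))) (at x)" .
        then have "(r p ?i has_derivative (\<lambda>v. dr p ?j (?g x) (frechet_derivative ?g (at x) v))) (at x)"
          by (rule has_derivative_transform_within_open[OF _ open_image_Int[OF i j] xi])
            (auto simp: r_def ek[OF i] ek[OF j])
        then have d: "dr p ?i x v = dr p ?j (?g x) (frechet_derivative ?g (at x) v)" for v
          unfolding dr_def by (simp add: frechet_derivative_at[symmetric])
        have "k ?j q \<in> k ?j ` D ?j" using q by blast
        note lin = linear_cmul[OF lindr[OF p j this]]
        have "frechet_derivative ?g (at x) (W ?i (t, x)) = \<bar>det (matrix (frechet_derivative ?g (at x)))\<bar> *\<^sub>R W ?j (t, ?g x)"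
          using trans[OF i j _ t, of q] q eq by simp
        then have "dr p ?i x (W ?i (t, x)) = \<bar>det (matrix (frechet_derivative ?g (at x)))\<bar> * dr p ?j (?g x) (W ?j (t, ?g x))"
          unfolding d using lin by (simp add: eq)
        moreover have "r p' ?i x = r p' ?j (?g x)" using eq q ek[OF j] by (simp add: r_def)
        ultimately show "(if x \<in> im p then r p' ?i x * dr p ?i x (W ?i (t, x)) else 0) =
          \<bar>det (matrix (frechet_derivative ?g (at x)))\<bar> * ?f (?g x)"
          using x S_im by auto
      qed
      also have "\<dots> = integral (?g ` S) ?f"
      proof (rule integral_change_of_variables_real[OF cS])
        show "(?g has_derivative frechet_derivative ?g (at x)) (at x)" if "x \<in> S" for x
          using S_im' that by (intro C1_on_has_derivative[OF C1_trans[OF i j]]) auto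
        show "inj_on ?g S"
        proof (rule inj_onI)
          fix x y assume "x \<in> S" "y \<in> S" and eq: "?g x = ?g y"
          then obtain q q' where "q \<in> D ?i \<inter> D ?j" "x = k ?i q" "q' \<in> D ?i \<inter> D ?j" "y = k ?i q'" using S_im' by blast
          then show "x = y" using eq ek[OF i] ek[OF j] by (metis IntD1 IntD2)
        qed
        have sub: "?g ` S \<subseteq> k ?j ` D ?j" unfolding gS using ZD by blast
        have "continuous_on (k ?j ` D ?j) ?f"
          by (intro continuous_on_mult C1_on_continuous_on[OF Cr[OF p' j]] cH[OF p j])
        then show "continuous_on (?g ` S) ?f" by (rule continuous_on_subset[OF _ sub])
      qed
      also have "\<dots> = integral (k ?j ` Z) (\<lambda>x. if x \<in> k ?j ` D ?j then ?f x else 0)"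
        unfolding gS using ZD by (intro integral_cong) auto
      also have "\<dots> = H t p p' ?j"
        unfolding H_def
      proof (rule integral_UNIV_support[symmetric])
        fix x assume x: "x \<notin> k ?j ` Z"
        show "(if x \<in> k ?j ` D ?j then ?f x else 0) = 0"
        proof (cases "x \<in> k ?j ` D ?j \<and> r p' ?j x \<noteq> 0")
          case True
          then have xj: "x \<in> k ?j ` D ?j" by blast
          have xK: "x \<in> K p'" using r0[OF p', of x] True by (auto simp: im_def)
          have nZ: "e ?j x \<notin> e ?i ` K p"
            using x xK ke[OF j xj] unfolding Z_def by (metis IntI image_eqI)
          have cl: "closedin T (e ?i ` K p)" by (rule closed_image_compact[OF i P(3)[OF p] P(4)[OF p]])
          have "open (k ?j ` (D ?j - e ?i ` K p))"
            using cl by (intro open_image[OF j] openin_diff open_D[OF j]) auto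
          moreover have "x \<in> k ?j ` (D ?j - e ?i ` K p)" using nZ e_in[OF j xj] ke[OF j xj] by (metis DiffI image_eqI)
          moreover have "0 = r p ?j y" if y: "y \<in> k ?j ` (D ?j - e ?i ` K p)" for y
          proof (rule ccontr)
            obtain q where q: "q \<in> D ?j" "q \<notin> e ?i ` K p" "y = k ?j q" using y by blast
            assume "0 \<noteq> r p ?j y"
            then have "\<rho> p q \<noteq> 0" using q ek[OF j] by (simp add: r_def)
            then have "q \<in> D ?i \<and> k ?i q \<in> K p" using supp[OF p] D_sub[OF j] q(1) by blast
            then show False using q(2) ek[OF i] by (metis imageI)
          qed
          ultimately have "(r p ?j has_derivative (\<lambda>_. 0)) (at x)"
            by (rule has_derivative_transform_within_open[OF has_derivative_const])
          then show ?thesis unfolding dr_def by (simp add: frechet_derivative_at[symmetric])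
        qed auto
      qed
      finally show ?thesis .
    qed
    have "(\<Sum>p\<in>P. G t p) = - (\<Sum>p\<in>P. \<Sum>p'\<in>P. H t p p' (\<iota> p'))"
    proof -
      have "G t p = - (\<Sum>p'\<in>P. H t p p' (\<iota> p'))" if "p \<in> P" for p
        unfolding GH[OF that] using HH[OF that] by (metis (no_types, lifting) sum.cong)
      then show ?thesis by (simp add: sum_negf)
    qed
    \<comment> \<open>With \<open>p'\<close>, and hence the chart, fixed, the differentials of all
      \<open>\<rho> p\<close> can be added under one integral, where they sum to the differential of
      \<open>1\<close>.\<close>
    also have "(\<Sum>p\<in>P. \<Sum>p'\<in>P. H t p p' (\<iota> p')) = (\<Sum>p'\<in>P. \<Sum>p\<in>P. H t p p' (\<iota> p'))" by (rule sum.swap)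
    also have "\<dots> = 0"
    proof (rule sum.neutral, rule ballI)
      fix p' assume p': "p' \<in> P"
      let ?j = "\<iota> p'"
      have j: "?j \<in> I" using P(2)[OF p'] .
      let ?h = "\<lambda>p x. if x \<in> im p' then r p' ?j x * dr p ?j x (W ?j (t, x)) else 0"
      have "continuous_on UNIV (?h p)" if "p \<in> P" for p
        by (rule continuous_on_ext0'[OF im[OF p'] P(3)[OF p']
              continuous_on_mult[OF C1_on_continuous_on[OF Cr[OF p' j], folded im_def] cH[OF that j, folded im_def]]])
          (use r0[OF p'] P(4)[OF p'] in \<open>auto simp: im_def\<close>)
      then have "?h p integrable_on UNIV" if "p \<in> P" for p
        using that by (intro integrable_compact_support[OF _ compact_imp_bounded[OF P(3)[OF p']]])
          (use r0[OF p'] in auto)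
      then have "(\<Sum>p\<in>P. H t p p' ?j) = integral UNIV (\<lambda>x. \<Sum>p\<in>P. ?h p x)"
        unfolding H_def im_def[symmetric] using P(1) by (simp add: Henstock_Kurzweil_Integration.integral_sum)
      also have "(\<lambda>x. \<Sum>p\<in>P. ?h p x) = (\<lambda>_. 0)"
      proof
        fix x
        show "(\<Sum>p\<in>P. ?h p x) = 0"
        proof (cases "x \<in> im p'")
          case True
          then have xj: "x \<in> k ?j ` D ?j" by (simp add: im_def)
          have "((\<lambda>x. \<Sum>p\<in>P. r p ?j x) has_derivative (\<lambda>v. \<Sum>p\<in>P. dr p ?j x v)) (at x)"
            by (intro has_derivative_sum rder j xj)
          moreover have "((\<lambda>x. \<Sum>p\<in>P. r p ?j x) has_derivative (\<lambda>_. 0)) (at x)"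
            by (rule has_derivative_transform_within_open[OF has_derivative_const[of 1] open_im[OF j] xj])
              (simp add: r_def one et[OF j])
          ultimately have "(\<Sum>p\<in>P. dr p ?j x v) = 0" for v
            using fun_cong[OF has_derivative_unique, of _ _ x _ v] by blast
          then show ?thesis using True by (simp add: sum_distrib_left[symmetric])
        qed simp
      qed
      finally show "(\<Sum>p\<in>P. H t p p' ?j) = 0" by simp
    qed
    finally show ?thesis by simp
  qed
  ultimately have "\<And>t. t \<in> J \<Longrightarrow> (F has_field_derivative 0) (at t within J)" by metis
  then obtain c where "\<And>t. t \<in> J \<Longrightarrow> F t = c"
    using has_field_derivative_zero_constant[OF J(2)] by metis
  then show ?thesis using st by simp
qed

end

text \<open>The exterior derivative evaluated on constant fields, over an arbitrary normed space, so
  that it serves time times a fibre as well as products of chart domains.\<close>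

definition closed_two_form_at :: "('e::real_normed_vector \<Rightarrow> 'e \<Rightarrow> 'e \<Rightarrow> real) \<Rightarrow> 'e \<Rightarrow> bool" where
  "closed_two_form_at \<Phi> z \<longleftrightarrow> (\<forall>u v w. frechet_derivative (\<lambda>z. \<Phi> z v w) (at z) u
     - frechet_derivative (\<lambda>z. \<Phi> z u w) (at z) v + frechet_derivative (\<lambda>z. \<Phi> z u v) (at z) w = 0)"

lemma linear_vec_expansion:
  fixes f :: "real^'k \<Rightarrow> real"
  assumes "linear f"
  shows "f v = (\<Sum>a\<in>UNIV. v $ a * f (axis a 1))"
proof -
  have "f v = f (\<Sum>a\<in>UNIV. v $ a *\<^sub>R axis a 1)"
    using basis_expansion[of v] by (simp add: scalar_mult_eq_scaleR)
  then show ?thesis by (simp add: linear_sum[OF assms] linear_cmul[OF assms])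
qed

lemma bilinear_gram:
  fixes B :: "real \<times> (real^'k) \<Rightarrow> real \<times> (real^'k) \<Rightarrow> real"
  assumes "bilinear B"
  shows "B (0, v) (0, w) = v \<bullet> ((\<chi> a b. B (0, axis a 1) (0, axis b 1)) *v w)"
proof -
  have lin: "linear (\<lambda>v. (0 :: real, v :: real^'k))" by (rule linearI) auto
  have 1: "linear (\<lambda>v. B (0, v) y)" for y
    using linear_compose[OF lin, of "\<lambda>x. B x y"] assms unfolding bilinear_def o_def by blast
  have 2: "linear (\<lambda>w. B x (0, w))" for x
    using linear_compose[OF lin, of "B x"] assms unfolding bilinear_def o_def by blast
  have "B (0, v) (0, w) = (\<Sum>a\<in>UNIV. v $ a * B (0, axis a 1) (0, w))"
    using linear_vec_expansion[OF 1] .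
  also have "\<dots> = (\<Sum>a\<in>UNIV. v $ a * (\<Sum>b\<in>UNIV. w $ b * B (0, axis a 1) (0, axis b 1)))"
    by (intro sum.cong refl arg_cong2[where f="(*)"] linear_vec_expansion[OF 2])
  finally show ?thesis
    by (simp add: inner_vec_def matrix_vector_mult_def mult.commute)
qed

text \<open>Since \<open>A X = - \<eta>\<close>, the vector \<open>(1, - X)\<close> is orthogonal to
  the fibre directions for \<open>\<Psi>\<close>; as \<open>\<Psi>\<close> is closed, the flow of
  this horizontal lift of time preserves the forms on the fibres. The proof uses the infinitesimal
  version: \<open>liouville_divergence\<close> provides the continuity equation for the density, and
  \<open>integral_flux_constant\<close> integrates it.\<close>

lemma (in closed_C1_manifold) fibre_volume_constant:
  fixes \<Psi> :: "'i \<Rightarrow> real \<times> (real, 'k) vec \<Rightarrow> real \<times> (real, 'k) vec \<Rightarrow> real \<times> (real, 'k) vec \<Rightarrow> real"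
  assumes P: "finite P" "\<And>p. p \<in> P \<Longrightarrow> \<iota> p \<in> I" "\<And>p. p \<in> P \<Longrightarrow> compact (K p)"
      "\<And>p. p \<in> P \<Longrightarrow> K p \<subseteq> k (\<iota> p) ` D (\<iota> p)"
    and supp: "\<And>p q. p \<in> P \<Longrightarrow> q \<in> topspace T \<Longrightarrow> \<rho> p q \<noteq> 0 \<Longrightarrow> q \<in> D (\<iota> p) \<and> k (\<iota> p) q \<in> K p"
    and one: "\<And>q. q \<in> topspace T \<Longrightarrow> (\<Sum>p\<in>P. \<rho> p q) = (1::real)"
    and C\<rho>: "\<And>p j. p \<in> P \<Longrightarrow> j \<in> I \<Longrightarrow> C1_on (k j ` D j) (\<lambda>x. \<rho> p (e j x))"
    and J: "open J" "convex J"
    and C: "\<And>i v w. i \<in> I \<Longrightarrow> C1_on (J \<times> k i ` D i) (\<lambda>z. \<Psi> i z v w)"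
    and bil: "\<And>i z. i \<in> I \<Longrightarrow> z \<in> J \<times> k i ` D i \<Longrightarrow> bilinear (\<Psi> i z)"
    and anti: "\<And>i z v w. i \<in> I \<Longrightarrow> z \<in> J \<times> k i ` D i \<Longrightarrow> \<Psi> i z v w = - \<Psi> i z w v"
    and nondeg: "\<And>i z v. i \<in> I \<Longrightarrow> z \<in> J \<times> k i ` D i \<Longrightarrow> v \<noteq> 0 \<Longrightarrow> \<exists>w. \<Psi> i z (0, w) (0, v) \<noteq> 0"
    and closed: "\<And>i z. i \<in> I \<Longrightarrow> z \<in> J \<times> k i ` D i \<Longrightarrow> closed_two_form_at (\<Psi> i) z"
    and trans: "\<And>i j q t s v w. i \<in> I \<Longrightarrow> j \<in> I \<Longrightarrow> q \<in> D i \<inter> D j \<Longrightarrow> t \<in> J \<Longrightarrow>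
      \<Psi> i (t, k i q) (s, v) (0, w) = \<Psi> j (t, k j q)
        (s, frechet_derivative (\<lambda>x. k j (e i x)) (at (k i q)) v)
        (0, frechet_derivative (\<lambda>x. k j (e i x)) (at (k i q)) w)"
  defines "F \<equiv> \<lambda>t. \<Sum>p\<in>P. integral UNIV (\<lambda>x. if x \<in> k (\<iota> p) ` D (\<iota> p)
     then \<rho> p (e (\<iota> p) x) * sqrt \<bar>det (\<chi> a b. \<Psi> (\<iota> p) (t, x) (0, axis a 1) (0, axis b 1))\<bar> else 0)"
  assumes st: "s \<in> J" "t \<in> J"
  shows "F s = F t"
proof -
  define A where "A i z = (\<chi> a b. \<Psi> i z (0, axis a 1) (0, axis b 1))" for i z
  define \<eta> where "\<eta> i z = (\<chi> b. \<Psi> i z (1, 0) (0, axis b 1))" for i z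
  define V where "V i z = sqrt \<bar>det (A i z)\<bar>" for i z
  define X where "X i z = cramer_solve (A i z) (- \<eta> i z)" for i z
  define W where "W i z = V i z *\<^sub>R X i z" for i z
  have S: "open (J \<times> k i ` D i)" if "i \<in> I" for i using J(1) open_im[OF that] by (rule open_Times)
  have gram: "\<Psi> i z (0, v) (0, w) = v \<bullet> (A i z *v w)" if "i \<in> I" "z \<in> J \<times> k i ` D i" for i z v w
    unfolding A_def by (rule bilinear_gram[OF bil[OF that]])
  have \<eta>: "\<Psi> i z (1, 0) (0, w) = \<eta> i z \<bullet> w" if "i \<in> I" "z \<in> J \<times> k i ` D i" for i z w
  proof -
    have "linear (\<lambda>v. (0 :: real, v :: (real, 'k) vec))" by (rule linearI) auto
    moreover have "linear (\<Psi> i z (1, 0))" using bil[OF that] unfolding bilinear_def by blast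
    ultimately have "linear (\<lambda>w. \<Psi> i z (1, 0) (0, w))"
      using linear_compose unfolding o_def by blast
    from linear_vec_expansion[OF this, of w] show ?thesis
      by (simp add: \<eta>_def inner_vec_def mult.commute)
  qed
  have detA: "det (A i z) \<noteq> 0" if "i \<in> I" "z \<in> J \<times> k i ` D i" for i z
  proof
    assume "det (A i z) = 0"
    then have "\<not> invertible (A i z)" by (simp add: invertible_det_nz)
    then obtain v where "A i z *v v = 0" "v \<noteq> 0"
      by (metis invertible_left_inverse matrix_left_invertible_ker)
    then show False using nondeg[OF that \<open>v \<noteq> 0\<close>] gram[OF that] by simp
  qed
  have CA: "C1_on (J \<times> k i ` D i) (\<lambda>z. A i z $ a $ b)" if "i \<in> I" for i a b
    unfolding A_def using C[OF that] by simp
  have C\<eta>: "C1_on (J \<times> k i ` D i) (\<lambda>z. \<eta> i z $ a)" if "i \<in> I" for i a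
    unfolding \<eta>_def using C[OF that] by simp
  have CV: "C1_on (J \<times> k i ` D i) (V i)" if "i \<in> I" for i
    unfolding V_def using C1_on_sqrt_abs[OF C1_on_det[OF CA[OF that]] detA[OF that]] by simp
  have CX: "C1_on (J \<times> k i ` D i) (\<lambda>z. X i z $ l)" if "i \<in> I" for i l
    unfolding X_def by (rule C1_on_cramer_solve[OF CA[OF that] _ detA[OF that]])
      (simp_all add: C1_on_uminus C\<eta>[OF that])
  have CW: "C1_on (J \<times> k i ` D i) (\<lambda>z. W i z $ l)" if "i \<in> I" for i l
    unfolding W_def using C1_on_mult[OF CV[OF that] CX[OF that]] by simp
  have div: "(\<Sum>l\<in>UNIV. frechet_derivative (\<lambda>z. W i z $ l) (at z) (0, axis l 1)) = frechet_derivative (V i) (at z) (1, 0)"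
    if i: "i \<in> I" and z: "z \<in> J \<times> k i ` D i" for i z
  proof -
    have cl: "frechet_derivative (\<lambda>z. \<Psi> i z v w) (at z) u
     - frechet_derivative (\<lambda>z. \<Psi> i z u w) (at z) v + frechet_derivative (\<lambda>z. \<Psi> i z u v) (at z) w = 0" for u v w
      using closed[OF that] unfolding closed_two_form_at_def by blast
    have an: "frechet_derivative (\<lambda>z. \<Psi> i z v w) (at z) u = - frechet_derivative (\<lambda>z. \<Psi> i z w v) (at z) u" for u v w
    proof -
      have "((\<lambda>z. - \<Psi> i z w v) has_derivative frechet_derivative (\<lambda>z. \<Psi> i z v w) (at z)) (at z)"
        by (rule has_derivative_transform_within_open[OF C1_on_has_derivative[OF C[OF i] z] S[OF i] z]) (rule anti[OF i])
      moreover have "((\<lambda>z. - \<Psi> i z w v) has_derivative (\<lambda>h. - frechet_derivative (\<lambda>z. \<Psi> i z w v) (at z) h)) (at z)"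
        by (rule has_derivative_minus[OF C1_on_has_derivative[OF C[OF i] z]])
      ultimately show ?thesis by (rule fun_cong[OF has_derivative_unique])
    qed
    have "(\<Sum>l\<in>UNIV. frechet_derivative (\<lambda>z. sqrt \<bar>det (A i z)\<bar> * cramer_solve (A i z) (- \<eta> i z) $ l) (at z) (0, axis l 1))
      = frechet_derivative (\<lambda>z. sqrt \<bar>det (A i z)\<bar>) (at z) (1, 0)"
    proof (rule liouville_divergence[where A="A i" and \<eta>="\<eta> i" and S="J \<times> k i ` D i"])
      show "open (J \<times> k i ` D i)" using S[OF i] .
      show "C1_on (J \<times> k i ` D i) (\<lambda>z. A i z $ a $ b)" for a b using CA[OF i] .
      show "C1_on (J \<times> k i ` D i) (\<lambda>z. \<eta> i z $ a)" for a using C\<eta>[OF i] .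
      show "det (A i z) \<noteq> 0" if "z \<in> J \<times> k i ` D i" for z using detA[OF i that] .
      show "z \<in> J \<times> k i ` D i" using z .
      show "A i z $ a $ b = - A i z $ b $ a" if "z \<in> J \<times> k i ` D i" for z a b
        unfolding A_def vec_lambda_beta by (rule anti[OF i that])
      \<comment> \<open>Closedness on three fibre directions is the cyclic identity for
        \<open>A\<close>; with the time direction as one argument it is the evolution equation
        proved next.\<close>
      show "frechet_derivative (\<lambda>z. A i z $ a $ b) (at z) (0, axis l 1) + frechet_derivative (\<lambda>z. A i z $ b $ l) (at z) (0, axis a 1)
        + frechet_derivative (\<lambda>z. A i z $ l $ a) (at z) (0, axis b 1) = 0" for l a b
        using cl[of "(0, axis a 1)" "(0, axis b 1)" "(0, axis l 1)"] an[of "(0, axis b 1)" "(0, axis l 1)" "(0, axis a 1)"]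
        unfolding A_def vec_lambda_beta by linarith
      show "frechet_derivative (\<lambda>z. A i z $ a $ b) (at z) (1, 0)
        = frechet_derivative (\<lambda>z. \<eta> i z $ b) (at z) (0, axis a 1) - frechet_derivative (\<lambda>z. \<eta> i z $ a) (at z) (0, axis b 1)" for a b
        using cl[of "(0, axis a 1)" "(0, axis b 1)" "(1, 0)"] unfolding A_def \<eta>_def vec_lambda_beta by linarith
    qed
    then show ?thesis
      by (simp add: W_def[abs_def] V_def[abs_def] X_def[abs_def])
  qed
  \<comment> \<open>With \<open>M\<close> the Jacobian of the transition, the Gram matrices satisfy
    \<open>A_i = M^T A_j M\<close>, so the density picks up \<open>|det M|\<close>, while uniqueness
    of the solution of \<open>A X = - \<eta>\<close> makes \<open>X\<close> a genuine vector
    field.\<close>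
  have tr: "frechet_derivative (\<lambda>x. k j (e i x)) (at (k i q)) (W i (t, k i q))
      = \<bar>det (matrix (frechet_derivative (\<lambda>x. k j (e i x)) (at (k i q))))\<bar> *\<^sub>R W j (t, k j q)"
    if i: "i \<in> I" and j: "j \<in> I" and q: "q \<in> D i \<inter> D j" and t: "t \<in> J" for i j q t
  proof -
    let ?T = "frechet_derivative (\<lambda>x. k j (e i x)) (at (k i q))"
    define M where "M = matrix ?T"
    have "linear ?T" using q by (intro linear_frechet_derivative C1_on_differentiable[OF C1_trans[OF i j]]) auto
    then have T: "?T v = M *v v" for v unfolding M_def by (simp add: matrix_works)
    have zi: "(t, k i q) \<in> J \<times> k i ` D i" and zj: "(t, k j q) \<in> J \<times> k j ` D j" using q t by auto
    let ?Ai = "A i (t, k i q)" and ?Aj = "A j (t, k j q)"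
    have "v \<bullet> (?Ai *v w) = v \<bullet> ((transpose M ** ?Aj ** M) *v w)" for v w
    proof -
      have adj: "(M *v v) \<bullet> y = v \<bullet> (transpose M *v y)" for y
        by (metis dot_lmul_matrix inner_commute transpose_matrix_vector)
      show ?thesis
        using trans[OF i j q t, of 0 v w] unfolding T gram[OF i zi] gram[OF j zj] adj matrix_vector_mul_assoc matrix_mul_assoc .
    qed
    then have "?Ai *v w = (transpose M ** ?Aj ** M) *v w" for w by (metis vector_eq_rdot inner_commute)
    then have Aij: "?Ai = transpose M ** ?Aj ** M" by (simp add: matrix_eq)
    then have detij: "det ?Ai = det M * det M * det ?Aj" by (simp add: det_mul)
    then have "det M \<noteq> 0" using detA[OF i zi] by auto
    have Vij: "V i (t, k i q) = \<bar>det M\<bar> * V j (t, k j q)"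
      unfolding V_def detij by (simp add: abs_mult real_sqrt_mult)
    have X_i: "?Ai *v X i (t, k i q) = - \<eta> i (t, k i q)"
      using cramer_solve[OF detA[OF i zi]] unfolding X_def by blast
    \<comment> \<open>Tested only against vectors in the range of \<open>M\<close>; the right
      inverse \<open>N\<close> below makes these all vectors.\<close>
    have "(M *v v) \<bullet> (?Aj *v (M *v X i (t, k i q))) = (M *v v) \<bullet> (- \<eta> j (t, k j q))" for v
    proof -
      have "(M *v v) \<bullet> (?Aj *v (M *v X i (t, k i q))) = v \<bullet> (?Ai *v X i (t, k i q))"
        using trans[OF i j q t, of 0 v "X i (t, k i q)"] unfolding T gram[OF i zi] gram[OF j zj] by simp
      also have "\<dots> = - (\<eta> i (t, k i q) \<bullet> v)" unfolding X_i by (simp add: inner_commute)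
      also have "\<eta> i (t, k i q) \<bullet> v = \<eta> j (t, k j q) \<bullet> (M *v v)"
        using trans[OF i j q t, of 1 0 v] unfolding T \<eta>[OF i zi, symmetric] \<eta>[OF j zj, symmetric] by simp
      finally show ?thesis by (simp add: inner_commute)
    qed
    moreover obtain N where "M ** N = mat 1"
      using \<open>det M \<noteq> 0\<close> invertible_det_nz[of M] unfolding invertible_def by blast
    then have "M *v (N *v y) = y" for y by (simp add: matrix_vector_mul_assoc)
    ultimately have "y \<bullet> (?Aj *v (M *v X i (t, k i q))) = y \<bullet> (- \<eta> j (t, k j q))" for y by metis
    then have "?Aj *v (M *v X i (t, k i q)) = - \<eta> j (t, k j q)" by (metis vector_eq_rdot inner_commute)
    then have "M *v X i (t, k i q) = X j (t, k j q)"
      using cramer_solve[OF detA[OF j zj]] unfolding X_def by blast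
    then show ?thesis unfolding T M_def[symmetric] W_def Vij
      by (simp add: matrix_vector_mult_scaleR)
  qed
  show ?thesis unfolding F_def A_def[symmetric] V_def[symmetric]
    by (rule integral_flux_constant[where V=V and W=W and \<rho>=\<rho> and K=K and J=J, OF P supp one C\<rho> J CV CW div tr st])
qed

section \<open>Charts of complex manifolds\<close>

text \<open>The equation \<open>d \<Omega> = \<Theta> \<and> \<Omega>\<close> at one point, freed
  from charts so that it can be carried to pair coordinates and to the parameter plane of a
  sphere.\<close>

definition lee_identity_at ::
  "('e::real_normed_vector \<Rightarrow> 'e \<Rightarrow> real) \<Rightarrow> ('e \<Rightarrow> 'e \<Rightarrow> 'e \<Rightarrow> real) \<Rightarrow> 'e \<Rightarrow> bool" where
  "lee_identity_at \<Theta> \<Omega> z \<longleftrightarrow> (\<forall>u v w. frechet_derivative (\<lambda>z. \<Omega> z v w) (at z) u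
     - frechet_derivative (\<lambda>z. \<Omega> z u w) (at z) v + frechet_derivative (\<lambda>z. \<Omega> z u v) (at z) w
     = \<Theta> z u * \<Omega> z v w - \<Theta> z v * \<Omega> z u w + \<Theta> z w * \<Omega> z u v)"

text \<open>The factor \<open>exp (- F)\<close> contributes \<open>- dF \<and> \<Omega>\<close> to
  the exterior derivative, which cancels against the Lee identity because
  \<open>dF = \<Theta>\<close> at \<open>z\<close>.\<close>

lemma conformal_closed_two_form:
  fixes \<Omega> :: "'e::euclidean_space \<Rightarrow> 'e \<Rightarrow> 'e \<Rightarrow> real"
  assumes F: "(F has_derivative \<Theta> z) (at z)" and \<Omega>: "\<And>v w. (\<lambda>z. \<Omega> z v w) differentiable (at z)"
    and lee: "lee_identity_at \<Theta> \<Omega> z"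
  shows "closed_two_form_at (\<lambda>z v w. exp (- F z) * \<Omega> z v w) z"
proof -
  have "((\<lambda>z. exp (- F z)) has_derivative (\<lambda>u. exp (- F z) * - \<Theta> z u)) (at z)"
    using F by (auto intro!: derivative_eq_intros)
  note has_derivative_mult[OF this frechet_derivative_works[THEN iffD1, OF \<Omega>]]
  from fun_cong[OF frechet_derivative_at[OF this]]
  have D: "frechet_derivative (\<lambda>z. exp (- F z) * \<Omega> z v w) (at z) u
    = exp (- F z) * (frechet_derivative (\<lambda>z. \<Omega> z v w) (at z) u - \<Theta> z u * \<Omega> z v w)" for u v w
    by (simp add: algebra_simps)
  have "frechet_derivative (\<lambda>z. \<Omega> z v w) (at z) u - \<Theta> z u * \<Omega> z v w
     - (frechet_derivative (\<lambda>z. \<Omega> z u w) (at z) v - \<Theta> z v * \<Omega> z u w)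
     + (frechet_derivative (\<lambda>z. \<Omega> z u v) (at z) w - \<Theta> z w * \<Omega> z u v) = 0" for u v w
    using lee[unfolded lee_identity_at_def, rule_format, of v w u] by linarith
  then show ?thesis unfolding closed_two_form_at_def D
    by (simp add: right_diff_distrib[symmetric] distrib_left[symmetric])
qed

text \<open>The pulled-back form uses the same \<open>L'\<close> at all points, so only
  \<open>\<Phi>\<close> is differentiated and no second derivative of \<open>L\<close>
  occurs.\<close>

lemma closed_two_form_affine_pullback:
  fixes \<Phi> :: "'e::euclidean_space \<Rightarrow> 'e \<Rightarrow> 'e \<Rightarrow> real"
  assumes "closed_two_form_at \<Phi> (L z)" "(L has_derivative L') (at z)"
    and "\<And>v w. (\<lambda>z. \<Phi> z v w) differentiable (at (L z))"
  shows "closed_two_form_at (\<lambda>z v w. \<Phi> (L z) (L' v) (L' w)) z"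
proof -
  have "frechet_derivative (\<lambda>z. \<Phi> (L z) v w) (at z) u = frechet_derivative (\<lambda>z. \<Phi> z v w) (at (L z)) (L' u)" for u v w
    using fun_cong[OF frechet_derivative_at[OF has_derivative_compose[OF assms(2) frechet_derivative_works[THEN iffD1, OF assms(3)]]]]
    by simp
  then show ?thesis using assms(1) unfolding closed_two_form_at_def by simp
qed

context
  fixes M :: "('a, 'n::finite) cmfd" and c
  assumes M: "complex_manifold M" and c: "c \<in> atlas M"
begin

lemma chart_open: "openin (mtop M) (fst c)" and chart_image_open: "open (chart_image c)"
  and chart_homeo: "homeomorphic_map (subtopology (mtop M) (fst c)) (top_of_set (chart_image c)) (snd c)"
  using M c unfolding complex_manifold_def by blast+

lemma chart_sub: "fst c \<subseteq> topspace (mtop M)"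
  using chart_open openin_subset by blast

lemma chart_inj: "inj_on (snd c) (fst c)"
  using homeomorphic_imp_injective_map[OF chart_homeo] chart_sub by (simp add: inf_absorb2)

lemma chart_inv_chart: "p \<in> fst c \<Longrightarrow> chart_inv c (snd c p) = p"
  unfolding chart_inv_def by (rule inv_into_f_f[OF chart_inj])

lemma chart_in: "p \<in> fst c \<Longrightarrow> snd c p \<in> chart_image c"
  unfolding chart_image_def by blast

lemma chart_chart_inv: "x \<in> chart_image c \<Longrightarrow> snd c (chart_inv c x) = x"
  and chart_inv_in: "x \<in> chart_image c \<Longrightarrow> chart_inv c x \<in> fst c"
  unfolding chart_image_def using chart_inv_chart by auto

lemma chart_homeo_maps:
  "homeomorphic_maps (subtopology (mtop M) (fst c)) (top_of_set (chart_image c)) (snd c) (chart_inv c)"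
proof -
  obtain g where g: "homeomorphic_maps (subtopology (mtop M) (fst c)) (top_of_set (chart_image c)) (snd c) g"
    using chart_homeo homeomorphic_map_maps by blast
  have "g x = chart_inv c x" if "x \<in> chart_image c" for x
    using g chart_inv_in[OF that] chart_chart_inv[OF that] chart_sub
    unfolding homeomorphic_maps_def by (metis IntI topspace_subtopology subsetD)
  then show ?thesis by (intro homeomorphic_maps_eq[OF g]) auto
qed

lemma chart_preimage_open: "open V \<Longrightarrow> openin (mtop M) {p \<in> fst c. snd c p \<in> V}"
proof -
  assume V: "open V"
  have "continuous_map (subtopology (mtop M) (fst c)) euclidean (snd c)"
    using chart_homeo_maps unfolding homeomorphic_maps_def by (simp add: continuous_map_in_subtopology)
  then have "openin (subtopology (mtop M) (fst c)) {p \<in> topspace (subtopology (mtop M) (fst c)). snd c p \<in> V}"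
    using V by (intro openin_continuous_map_preimage) auto
  then show ?thesis
    using chart_open chart_sub by (simp add: openin_open_subtopology inf_absorb2)
qed

lemma chart_image_of_open: "openin (mtop M) U \<Longrightarrow> U \<subseteq> fst c \<Longrightarrow> open (snd c ` U)"
proof -
  assume U: "openin (mtop M) U" "U \<subseteq> fst c"
  have "open_map (subtopology (mtop M) (fst c)) (top_of_set (chart_image c)) (snd c)"
    using chart_homeo by (rule homeomorphic_imp_open_map)
  moreover have "openin (subtopology (mtop M) (fst c)) U" using U by (simp add: openin_open_subtopology chart_open)
  ultimately show "open (snd c ` U)"
    using openin_open_eq[OF chart_image_open] unfolding open_map_def by blast
qed

end

lemma chart_overlap_open:
  assumes "complex_manifold M" "c \<in> atlas M" "d \<in> atlas M"
  shows "open (snd c ` (fst c \<inter> fst d))"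
  by (intro chart_image_of_open[OF assms(1,2)] openin_Int chart_open[OF assms(1,2)] chart_open[OF assms(1,3)]) auto

lemma transition_C1_on:
  assumes "complex_manifold M" "c \<in> atlas M" "d \<in> atlas M"
  shows "C1_on (snd c ` (fst c \<inter> fst d)) (transition c d)"
  using assms chart_overlap_open[OF assms] unfolding complex_manifold_def
  by (intro cmap_holomorphic_C1_on) auto

lemma transition_self: "complex_manifold M \<Longrightarrow> c \<in> atlas M \<Longrightarrow> p \<in> fst c \<Longrightarrow> frechet_derivative (transition c c) (at (snd c p)) = (\<lambda>v. v)"
proof -
  assume M: "complex_manifold M" "c \<in> atlas M" and p: "p \<in> fst c"
  have "(transition c c has_derivative (\<lambda>v. v)) (at (snd c p))"
    by (rule has_derivative_transform_within_open[OF has_derivative_ident chart_image_open[OF M] chart_in[OF M p]])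
      (simp add: transition_def chart_chart_inv[OF M])
  then show ?thesis by (rule frechet_derivative_at[symmetric])
qed

lemma transition_0:
  "complex_manifold M \<Longrightarrow> c \<in> atlas M \<Longrightarrow> c' \<in> atlas M \<Longrightarrow> p \<in> fst c \<inter> fst c' \<Longrightarrow>
    frechet_derivative (transition c c') (at (snd c p)) 0 = 0"
  by (intro linear_0 linear_frechet_derivative C1_on_differentiable[OF transition_C1_on]) auto

section \<open>Pair coordinates on products\<close>

lemma linear_i: "linear ((*s) \<i> :: complex^'k \<Rightarrow> _)"
  by (rule linearI) (simp_all add: vec_eq_iff algebra_simps)

text \<open>Product charts take values in a space indexed by a sum type. Passing to genuine pairs
  makes boxes, slices and partial derivatives in the two factors directly available.\<close>

definition vec_pair :: "(complex^'n) \<times> (complex^'m) \<Rightarrow> complex^('n + 'm)" where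
  "vec_pair z = vec_join (fst z) (snd z)"

definition vec_split :: "complex^('n + 'm) \<Rightarrow> (complex^'n) \<times> (complex^'m)" where
  "vec_split x = (\<chi> i. x $ Inl i, \<chi> i. x $ Inr i)"

lemma vec_pair_split [simp]: "vec_pair (vec_split x) = x"
  by (auto simp: vec_pair_def vec_split_def vec_join_def vec_eq_iff split: sum.splits)

lemma vec_split_pair [simp]: "vec_split (vec_pair z) = z"
  by (auto simp: vec_pair_def vec_split_def vec_join_def vec_eq_iff prod_eq_iff)

lemma bounded_linear_vec_pair: "bounded_linear vec_pair"
  by (intro linear_conv_bounded_linear[THEN iffD1] linearI)
    (auto simp: vec_pair_def vec_join_def vec_eq_iff split: sum.splits)

lemma bounded_linear_vec_split: "bounded_linear vec_split"
  by (intro linear_conv_bounded_linear[THEN iffD1] linearI)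
    (auto simp: vec_split_def vec_eq_iff prod_eq_iff)

lemma vec_pair_cmult: "\<i> *s vec_pair v = vec_pair (\<i> *s fst v, \<i> *s snd v)"
  by (auto simp: vec_pair_def vec_join_def vec_eq_iff split: sum.splits)

lemma vec_pair_eq_0: "vec_pair v = 0 \<longleftrightarrow> v = 0"
  by (metis bounded_linear.linear bounded_linear_vec_pair linear_0 vec_split_pair)

lemma chart_image_prod: "chart_image (prod_chart c d) = vec_pair ` (chart_image c \<times> chart_image d)"
  by (force simp: chart_image_def prod_chart_def vec_pair_def image_iff)

lemma chart_inv_prod:
  assumes "inj_on (snd c) (fst c)" "inj_on (snd d) (fst d)" "x \<in> chart_image c" "y \<in> chart_image d"
  shows "chart_inv (prod_chart c d) (vec_pair (x, y)) = (chart_inv c x, chart_inv d y)"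
proof -
  obtain p q where pq: "p \<in> fst c" "x = snd c p" "q \<in> fst d" "y = snd d q"
    using assms(3,4) unfolding chart_image_def by blast
  have j: "vec_join u v = vec_join u' v' \<longleftrightarrow> u = u' \<and> v = v'" for u u' :: "complex^'b" and v v' :: "complex^'d"
    by (metis fst_conv snd_conv vec_pair_def vec_split_pair)
  have "inj_on (snd (prod_chart c d)) (fst (prod_chart c d))"
    using assms(1,2) unfolding inj_on_def prod_chart_def by (auto simp: j)
  then have "chart_inv (prod_chart c d) (snd (prod_chart c d) (p, q)) = (p, q)"
    unfolding chart_inv_def by (rule inv_into_f_f) (use pq in \<open>simp add: prod_chart_def\<close>)
  then show ?thesis using pq assms(1,2) by (simp add: prod_chart_def vec_pair_def chart_inv_def inv_into_f_f)
qed

lemma transition_prod_has_derivative: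
  assumes X: "complex_manifold X" "c \<in> atlas X" "c' \<in> atlas X" and Y: "complex_manifold Y" "d \<in> atlas Y" "d' \<in> atlas Y"
    and p: "p \<in> fst c \<inter> fst c'" and q: "q \<in> fst d \<inter> fst d'"
  shows "frechet_derivative (transition (prod_chart c d) (prod_chart c' d')) (at (vec_pair (snd c p, snd d q))) (vec_pair v)
    = vec_pair (frechet_derivative (transition c c') (at (snd c p)) (fst v), frechet_derivative (transition d d') (at (snd d q)) (snd v))"
proof -
  let ?U = "vec_split -` (chart_image c \<times> chart_image d)"
  let ?g = "\<lambda>x. vec_pair (transition c c' (fst (vec_split x)), transition d d' (snd (vec_split x)))"
  let ?x = "vec_pair (snd c p, snd d q)"
  let ?A = "frechet_derivative (transition c c') (at (snd c p))" and ?B = "frechet_derivative (transition d d') (at (snd d q))"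
  have U: "open ?U"
    by (intro open_vimage open_Times chart_image_open[OF X(1,2)] chart_image_open[OF Y(1,2)]
        linear_continuous_on bounded_linear_vec_split)
  have eq: "transition (prod_chart c d) (prod_chart c' d') x = ?g x" if "x \<in> ?U" for x
  proof -
    obtain a b where ab: "vec_split x = (a, b)" by fastforce
    then have x: "x = vec_pair (a, b)" by (metis vec_pair_split)
    have "a \<in> chart_image c" "b \<in> chart_image d" using that ab by auto
    from chart_inv_prod[OF chart_inj[OF X(1,2)] chart_inj[OF Y(1,2)] this]
    show ?thesis unfolding x by (simp add: transition_def prod_chart_def[of c' d'] vec_pair_def[symmetric])
       (simp add: vec_pair_def)
  qed
  have xU: "?x \<in> ?U" using p q by (simp add: chart_image_def)
  have A: "(transition c c' has_derivative ?A) (at (fst (vec_split ?x)))"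
    using C1_on_has_derivative[OF transition_C1_on[OF X]] p by auto
  have B: "(transition d d' has_derivative ?B) (at (snd (vec_split ?x)))"
    using C1_on_has_derivative[OF transition_C1_on[OF Y]] q by auto
  have s: "(vec_split has_derivative vec_split) (at ?x)"
    by (rule bounded_linear_imp_has_derivative[OF bounded_linear_vec_split])
  have "(?g has_derivative (\<lambda>v. vec_pair (?A (fst (vec_split v)), ?B (snd (vec_split v))))) (at ?x)"
    by (intro bounded_linear.has_derivative[OF bounded_linear_vec_pair] has_derivative_Pair
        has_derivative_compose[OF has_derivative_fst[OF s] A] has_derivative_compose[OF has_derivative_snd[OF s] B])
  then have "(transition (prod_chart c d) (prod_chart c' d') has_derivative (\<lambda>v. vec_pair (?A (fst (vec_split v)), ?B (snd (vec_split v))))) (at ?x)"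
    by (rule has_derivative_transform_within_open[OF _ U xU]) (rule eq[symmetric])
  then show ?thesis by (simp add: frechet_derivative_at[symmetric])
qed

section \<open>Locally conformally Kaehler structures on products\<close>

locale lck_product =
  fixes X :: "('a, 'n::finite) cmfd" and Y :: "('b, 'm::finite) cmfd"
    and h :: "('a \<times> 'b, 'n + 'm) field2" and \<theta> :: "('a \<times> 'b, 'n + 'm) field1"
  assumes X: "complex_manifold X" and Y: "complex_manifold Y"
    and herm: "hermitian_metric (prod_cmfd X Y) h" and lee: "lee_form (prod_cmfd X Y) h \<theta>"
begin

definition \<Theta> :: "('a, 'n) chart \<Rightarrow> ('b, 'm) chart \<Rightarrow> ((complex, 'n) vec \<times> (complex, 'm) vec)
    \<Rightarrow> ((complex, 'n) vec \<times> (complex, 'm) vec) \<Rightarrow> real" where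
  "\<Theta> c d z v = \<theta> (prod_chart c d) (vec_pair z) (vec_pair v)"

definition \<Omega> :: "('a, 'n) chart \<Rightarrow> ('b, 'm) chart \<Rightarrow> ((complex, 'n) vec \<times> (complex, 'm) vec)
    \<Rightarrow> ((complex, 'n) vec \<times> (complex, 'm) vec) \<Rightarrow> ((complex, 'n) vec \<times> (complex, 'm) vec) \<Rightarrow> real" where
  "\<Omega> c d z v w = fundamental_form h (prod_chart c d) (vec_pair z) (vec_pair v) (vec_pair w)"

abbreviation dom :: "('a, 'n) chart \<Rightarrow> ('b, 'm) chart \<Rightarrow> ((complex, 'n) vec \<times> (complex, 'm) vec) set" where
  "dom c d \<equiv> chart_image c \<times> chart_image d"

lemma prod_atlas: "c \<in> atlas X \<Longrightarrow> d \<in> atlas Y \<Longrightarrow> prod_chart c d \<in> atlas (prod_cmfd X Y)"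
  unfolding prod_cmfd_def by auto

lemma dom_open: "c \<in> atlas X \<Longrightarrow> d \<in> atlas Y \<Longrightarrow> open (dom c d)"
  by (intro open_Times chart_image_open[OF X] chart_image_open[OF Y])

lemma vec_pair_dom: "z \<in> dom c d \<Longrightarrow> vec_pair z \<in> chart_image (prod_chart c d)"
  unfolding chart_image_prod by blast

lemma one_form: "smooth_one_form (prod_cmfd X Y) \<theta>"
  using lee unfolding lee_form_def closed_one_form_def by blast

lemma metric_field: "smooth_bilinear_field (prod_cmfd X Y) h"
  using herm unfolding hermitian_metric_def by blast

lemma linear_vec_pair: "linear vec_pair"
  by (rule bounded_linear.linear[OF bounded_linear_vec_pair])

lemma linear_\<Theta>: "c \<in> atlas X \<Longrightarrow> d \<in> atlas Y \<Longrightarrow> z \<in> dom c d \<Longrightarrow> linear (\<Theta> c d z)"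
proof -
  assume cd: "c \<in> atlas X" "d \<in> atlas Y" and z: "z \<in> dom c d"
  have "linear (\<theta> (prod_chart c d) (vec_pair z))"
    using one_form prod_atlas[OF cd] vec_pair_dom[OF z] unfolding smooth_one_form_def by blast
  from linear_compose[OF linear_vec_pair this] show ?thesis
    unfolding \<Theta>_def[abs_def] o_def .
qed

lemma bilinear_h: "c \<in> atlas X \<Longrightarrow> d \<in> atlas Y \<Longrightarrow> z \<in> dom c d \<Longrightarrow> bilinear (h (prod_chart c d) (vec_pair z))"
  using metric_field prod_atlas vec_pair_dom unfolding smooth_bilinear_field_def by blast

lemma bilinear_\<Omega>: "c \<in> atlas X \<Longrightarrow> d \<in> atlas Y \<Longrightarrow> z \<in> dom c d \<Longrightarrow> bilinear (\<Omega> c d z)"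
proof -
  assume cd: "c \<in> atlas X" "d \<in> atlas Y" and z: "z \<in> dom c d"
  note b = bilinear_h[OF cd z, unfolded bilinear_def]
  have "linear (\<lambda>v. h (prod_chart c d) (vec_pair z) (\<i> *s vec_pair v) w)" for w
    using linear_compose[OF linear_compose[OF linear_vec_pair linear_i], of "\<lambda>v. h (prod_chart c d) (vec_pair z) v w"] b
    unfolding o_def by blast
  moreover have "linear (\<lambda>w. h (prod_chart c d) (vec_pair z) v (vec_pair w))" for v
    using linear_compose[OF linear_vec_pair, of "h (prod_chart c d) (vec_pair z) v"] b
    unfolding o_def by blast
  ultimately show ?thesis unfolding bilinear_def \<Omega>_def fundamental_form_def by blast
qed

lemma C1_field: "C1_on (chart_image (prod_chart c d)) f \<Longrightarrow> C1_on (dom c d) (\<lambda>z. f (vec_pair z))"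
  by (rule C1_on_compose[OF _ C1_on_bounded_linear[OF bounded_linear_vec_pair]]) (auto simp: chart_image_prod)

lemma frechet_vec_pair:
  assumes "c \<in> atlas X" "d \<in> atlas Y" "z \<in> dom c d" "C1_on (chart_image (prod_chart c d)) f"
  shows "frechet_derivative (\<lambda>z. f (vec_pair z)) (at z) u = frechet_derivative f (at (vec_pair z)) (vec_pair u)"
proof -
  have "((\<lambda>z. f (vec_pair z)) has_derivative (\<lambda>u. frechet_derivative f (at (vec_pair z)) (vec_pair u))) (at z)"
    by (rule has_derivative_compose[OF bounded_linear_imp_has_derivative[OF bounded_linear_vec_pair]
          C1_on_has_derivative[OF assms(4) vec_pair_dom[OF assms(3)]]])
  then show ?thesis by (simp add: frechet_derivative_at[symmetric])
qed

lemma C1_\<theta>: "c \<in> atlas X \<Longrightarrow> d \<in> atlas Y \<Longrightarrow> C1_on (chart_image (prod_chart c d)) (\<lambda>x. \<theta> (prod_chart c d) x v)"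
  using one_form prod_atlas unfolding smooth_one_form_def by (blast intro: smooth_on_imp_C1_on)

lemma C1_h: "c \<in> atlas X \<Longrightarrow> d \<in> atlas Y \<Longrightarrow> C1_on (chart_image (prod_chart c d)) (\<lambda>x. h (prod_chart c d) x v w)"
  using metric_field prod_atlas unfolding smooth_bilinear_field_def by (blast intro: smooth_on_imp_C1_on)

lemma C1_\<Theta>: "c \<in> atlas X \<Longrightarrow> d \<in> atlas Y \<Longrightarrow> C1_on (dom c d) (\<lambda>z. \<Theta> c d z v)"
  unfolding \<Theta>_def by (rule C1_field[OF C1_\<theta>])

lemma C1_\<Omega>: "c \<in> atlas X \<Longrightarrow> d \<in> atlas Y \<Longrightarrow> C1_on (dom c d) (\<lambda>z. \<Omega> c d z v w)"
  unfolding \<Omega>_def fundamental_form_def by (rule C1_field[OF C1_h])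

lemma closed_\<Theta>:
  assumes cd: "c \<in> atlas X" "d \<in> atlas Y" and z: "z \<in> dom c d"
  shows "frechet_derivative (\<lambda>z. \<Theta> c d z v) (at z) u = frechet_derivative (\<lambda>z. \<Theta> c d z u) (at z) v"
proof -
  have "ext_deriv1 \<theta> (prod_chart c d) (vec_pair z) (vec_pair u) (vec_pair v) = 0"
    using lee prod_atlas[OF cd] vec_pair_dom[OF z] unfolding lee_form_def closed_one_form_def by blast
  then show ?thesis unfolding \<Theta>_def ext_deriv1_def
    by (simp add: frechet_vec_pair[OF cd z C1_\<theta>[OF cd]])
qed

lemma lee_\<Omega>:
  assumes cd: "c \<in> atlas X" "d \<in> atlas Y" and z: "z \<in> dom c d"
  shows "lee_identity_at (\<Theta> c d) (\<Omega> c d) z"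
proof -
  have "ext_deriv2 (fundamental_form h) (prod_chart c d) (vec_pair z) u v w
      = wedge12 \<theta> (fundamental_form h) (prod_chart c d) (vec_pair z) u v w" for u v w
    using lee prod_atlas[OF cd] vec_pair_dom[OF z] unfolding lee_form_def by blast
  then show ?thesis
    unfolding \<Theta>_def \<Omega>_def ext_deriv2_def wedge12_def fundamental_form_def lee_identity_at_def
    by (simp add: frechet_vec_pair[OF cd z C1_h[OF cd]])
qed

text \<open>Antisymmetry combines invariance of the metric under \<open>\<i>\<close> with the fact
  that \<open>\<i>\<close> squares to \<open>- 1\<close>. Positivity is that of the metric, since
  \<open>\<Omega>\<close> on \<open>v\<close> and \<open>\<i> v\<close> is the metric of
  \<open>\<i> v\<close> with itself.\<close>

lemma \<Omega>_hermitian: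
  assumes cd: "c \<in> atlas X" "d \<in> atlas Y" and z: "z \<in> dom c d"
  shows "\<Omega> c d z v w = - \<Omega> c d z w v"
    and "v \<noteq> 0 \<Longrightarrow> \<Omega> c d z v (\<i> *s fst v, \<i> *s snd v) > 0"
proof -
  let ?h = "h (prod_chart c d) (vec_pair z)"
  have sym: "?h v w = ?h w v" and I: "?h (\<i> *s v) (\<i> *s w) = ?h v w" and pos: "v \<noteq> 0 \<Longrightarrow> ?h v v > 0" for v w
    using herm prod_atlas[OF cd] vec_pair_dom[OF z] unfolding hermitian_metric_def by blast+
  have lin: "linear (?h v)" for v using bilinear_h[OF cd z] unfolding bilinear_def by blast
  have "\<i> *s (\<i> *s a) = - a" for a :: "(complex, 'n + 'm) vec" by (simp add: vec_eq_iff)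
  then have "?h (\<i> *s a) b = - ?h (\<i> *s b) a" for a b
    using I[of "\<i> *s a" b] sym[of "\<i> *s b" a] lin[of "\<i> *s b"] sym[of "- a" "\<i> *s b"]
    by (simp add: linear_neg)
  then show "\<Omega> c d z v w = - \<Omega> c d z w v" unfolding \<Omega>_def fundamental_form_def .
  show "\<Omega> c d z v (\<i> *s fst v, \<i> *s snd v) > 0" if "v \<noteq> 0"
    using pos[of "vec_pair v"] that I[of "vec_pair v" "vec_pair v"]
    unfolding \<Omega>_def fundamental_form_def vec_pair_cmult[symmetric] by (simp add: vec_pair_eq_0)
qed

context
  fixes c c' d d' p q
  assumes c: "c \<in> atlas X" "c' \<in> atlas X" and d: "d \<in> atlas Y" "d' \<in> atlas Y"
    and p: "p \<in> fst c \<inter> fst c'" and q: "q \<in> fst d \<inter> fst d'"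
begin

abbreviation (input) "tangent_X \<equiv> frechet_derivative (transition c c') (at (snd c p))"
abbreviation (input) "tangent_Y \<equiv> frechet_derivative (transition d d') (at (snd d q))"

lemma \<Theta>_transition:
  "\<Theta> c d (snd c p, snd d q) v = \<Theta> c' d' (snd c' p, snd d' q) (tangent_X (fst v), tangent_Y (snd v))"
proof -
  have "(p, q) \<in> fst (prod_chart c d) \<inter> fst (prod_chart c' d')" using p q by (simp add: prod_chart_def)
  then have "\<theta> (prod_chart c d) (snd (prod_chart c d) (p, q)) (vec_pair v) =
    \<theta> (prod_chart c' d') (snd (prod_chart c' d') (p, q))
      (frechet_derivative (transition (prod_chart c d) (prod_chart c' d')) (at (snd (prod_chart c d) (p, q))) (vec_pair v))"
    using one_form prod_atlas[OF c(1) d(1)] prod_atlas[OF c(2) d(2)] unfolding smooth_one_form_def Let_def by blast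
  moreover have "snd (prod_chart c d) (p, q) = vec_pair (snd c p, snd d q)" for c :: "('a, 'n) chart" and d :: "('b, 'm) chart"
    by (simp add: prod_chart_def vec_pair_def)
  ultimately show ?thesis
    unfolding \<Theta>_def by (simp add: transition_prod_has_derivative[OF X c Y d p q])
qed

lemma \<Omega>_transition:
  "\<Omega> c d (snd c p, snd d q) v w = \<Omega> c' d' (snd c' p, snd d' q) (tangent_X (fst v), tangent_Y (snd v)) (tangent_X (fst w), tangent_Y (snd w))"
proof -
  have "(p, q) \<in> fst (prod_chart c d) \<inter> fst (prod_chart c' d')" using p q by (simp add: prod_chart_def)
  then have h: "h (prod_chart c d) (snd (prod_chart c d) (p, q)) v w =
    h (prod_chart c' d') (snd (prod_chart c' d') (p, q))
      (frechet_derivative (transition (prod_chart c d) (prod_chart c' d')) (at (snd (prod_chart c d) (p, q))) v)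
      (frechet_derivative (transition (prod_chart c d) (prod_chart c' d')) (at (snd (prod_chart c d) (p, q))) w)" for v w
    using metric_field prod_atlas[OF c(1) d(1)] prod_atlas[OF c(2) d(2)] unfolding smooth_bilinear_field_def Let_def by blast
  have s: "snd (prod_chart c d) (p, q) = vec_pair (snd c p, snd d q)" for c :: "('a, 'n) chart" and d :: "('b, 'm) chart"
    by (simp add: prod_chart_def vec_pair_def)
  \<comment> \<open>The fundamental form inserts \<open>\<i>\<close> into its first argument. The
    transformation rule of the metric carries over to it because the differentials of the transition
    maps are complex linear.\<close>
  have "tangent_X (\<i> *s x) = \<i> *s tangent_X x" for x
  proof -
    have "snd c p \<in> snd c ` (fst c \<inter> fst c')" using p by blast
    then obtain D where D: "(transition c c' has_derivative D) (at (snd c p))" "\<forall>a v. D (a *s v) = a *s D v"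
      using X c unfolding complex_manifold_def cmap_holomorphic_on_def by blast
    then show ?thesis by (simp add: frechet_derivative_at[symmetric])
  qed
  moreover have "tangent_Y (\<i> *s x) = \<i> *s tangent_Y x" for x
  proof -
    have "snd d q \<in> snd d ` (fst d \<inter> fst d')" using q by blast
    then obtain D where D: "(transition d d' has_derivative D) (at (snd d q))" "\<forall>a v. D (a *s v) = a *s D v"
      using Y d unfolding complex_manifold_def cmap_holomorphic_on_def by blast
    then show ?thesis by (simp add: frechet_derivative_at[symmetric])
  qed
  ultimately show ?thesis
    using h[of "\<i> *s vec_pair v" "vec_pair w"]
    unfolding \<Omega>_def fundamental_form_def s vec_pair_cmult transition_prod_has_derivative[OF X c Y d p q]
    by simp
qed

end

end

text \<open>The values of \<open>g\<close> carry no topology. This includes truth values, and in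
  that form the existence of a primitive is propagated from slice to slice.\<close>

lemma connected_space_locally_constant:
  assumes "connected_space T" "\<And>q. q \<in> topspace T \<Longrightarrow> \<exists>N. openin T N \<and> q \<in> N \<and> (\<forall>q'\<in>N. g q' = g q)"
    and a: "a \<in> topspace T" and b: "b \<in> topspace T"
  shows "g a = g b"
proof -
  have "openin T {q \<in> topspace T. P (g q)}" for P
  proof (subst openin_subopen, intro ballI)
    fix q assume q: "q \<in> {q \<in> topspace T. P (g q)}"
    then have "q \<in> topspace T" by simp
    from assms(2)[OF this] obtain N where N: "openin T N" "q \<in> N" "\<forall>q'\<in>N. g q' = g q" by (elim exE conjE)
    have "N \<subseteq> {q \<in> topspace T. P (g q)}"
    proof
      fix x assume "x \<in> N"
      then have "g x = g q" "x \<in> topspace T" using N(3) openin_subset[OF N(1)] by blast+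
      then show "x \<in> {q \<in> topspace T. P (g q)}" using q by simp
    qed
    with N(1,2) show "\<exists>N. openin T N \<and> q \<in> N \<and> N \<subseteq> {q \<in> topspace T. P (g q)}"
      by blast
  qed
  from this[of "\<lambda>v. v = g a"] this[of "\<lambda>v. v \<noteq> g a"]
  have o: "openin T {q \<in> topspace T. g q = g a}" "openin T {q \<in> topspace T. g q \<noteq> g a}" .
  moreover have "topspace T - {q \<in> topspace T. g q = g a} = {q \<in> topspace T. g q \<noteq> g a}" by auto
  ultimately have "openin T {q \<in> topspace T. g q = g a}" "closedin T {q \<in> topspace T. g q = g a}"
    unfolding closedin_def by auto
  then have "{q \<in> topspace T. g q = g a} = {} \<or> {q \<in> topspace T. g q = g a} = topspace T"
    using assms(1) unfolding connected_space_clopen_in by blast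
  moreover have "a \<in> {q \<in> topspace T. g q = g a}" using a by simp
  ultimately have "b \<in> {q \<in> topspace T. g q = g a}" using b by (metis empty_iff)
  then show ?thesis by simp
qed

lemma has_derivative_slice_fst:
  assumes "(H has_derivative H') (at (x, y))"
  shows "((\<lambda>x. H (x, y)) has_derivative (\<lambda>a. H' (a, 0))) (at x)"
  by (rule has_derivative_compose[of "\<lambda>x. (x, y)" "\<lambda>a. (a, 0)"])
    (use assms in \<open>auto intro: has_derivative_Pair has_derivative_ident has_derivative_const\<close>)

lemma has_derivative_slice_snd:
  assumes "(H has_derivative H') (at (x, y))"
  shows "((\<lambda>y. H (x, y)) has_derivative (\<lambda>b. H' (0, b))) (at y)"
  by (rule has_derivative_compose[of "\<lambda>y. (x, y)" "\<lambda>b. (0, b)"])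
    (use assms in \<open>auto intro: has_derivative_Pair has_derivative_ident has_derivative_const\<close>)

section \<open>Primitives of the Lee form on slices\<close>

context lck_product begin

definition fibre_primitive :: "'a \<Rightarrow> ('b \<Rightarrow> real) \<Rightarrow> bool" where
  "fibre_primitive p f \<longleftrightarrow> (\<forall>c\<in>atlas X. p \<in> fst c \<longrightarrow> (\<forall>d\<in>atlas Y. \<forall>y\<in>chart_image d.
     ((\<lambda>y. f (chart_inv d y)) has_derivative (\<lambda>b. \<Theta> c d (snd c p, y) (0, b))) (at y)))"

text \<open>The first factor is kept in coordinates while the second is all of \<open>Y\<close>: a
  primitive on a tube around a slice.\<close>

definition local_primitive :: "('a, 'n) chart \<Rightarrow> (complex, 'n) vec set \<Rightarrow> ((complex, 'n) vec \<Rightarrow> 'b \<Rightarrow> real) \<Rightarrow> bool" where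
  "local_primitive c B f \<longleftrightarrow> (\<forall>d\<in>atlas Y. \<forall>z\<in>B \<times> chart_image d.
     ((\<lambda>z. f (fst z) (chart_inv d (snd z))) has_derivative \<Theta> c d z) (at z))"

lemma \<Theta>_transition_Y:
  assumes c: "c \<in> atlas X" and d: "d \<in> atlas Y" "d' \<in> atlas Y" and p: "p \<in> fst c" and q: "q \<in> fst d \<inter> fst d'"
  shows "\<Theta> c d (snd c p, snd d q) (a, 0) = \<Theta> c d' (snd c p, snd d' q) (a, 0)"
  using \<Theta>_transition[OF c c d _ q, of p "(a, 0)"] p
  by (simp add: transition_self[OF X c p] transition_0[OF Y d q])

lemma \<Theta>_transition_X:
  assumes c: "c \<in> atlas X" "c' \<in> atlas X" and d: "d \<in> atlas Y" and p: "p \<in> fst c \<inter> fst c'" and q: "q \<in> fst d"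
  shows "\<Theta> c d (snd c p, snd d q) (0, b) = \<Theta> c' d (snd c' p, snd d q) (0, b)"
  using \<Theta>_transition[OF c d d p, of q "(0, b)"] q
  by (simp add: transition_self[OF Y d q] transition_0[OF X c p])

lemma \<Omega>_transition_X:
  assumes c: "c \<in> atlas X" "c' \<in> atlas X" and d: "d \<in> atlas Y" and p: "p \<in> fst c \<inter> fst c'" and q: "q \<in> fst d"
  shows "\<Omega> c d (snd c p, snd d q) (0, a) (0, b) = \<Omega> c' d (snd c' p, snd d q) (0, a) (0, b)"
  using \<Omega>_transition[OF c d d p, of q "(0, a)" "(0, b)"] q
  by (simp add: transition_self[OF Y d q] transition_0[OF X c p])

lemma poincare_box:
  assumes c: "c \<in> atlas X" and d: "d \<in> atlas Y" and B: "open B" "convex B" "B \<subseteq> chart_image c"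
    and D: "open D" "convex D" "D \<subseteq> chart_image d"
  obtains H where "\<And>z. z \<in> B \<times> D \<Longrightarrow> (H has_derivative \<Theta> c d z) (at z)"
proof (rule poincare[of "B \<times> D" "\<Theta> c d"])
  have sub: "B \<times> D \<subseteq> dom c d" using B D by auto
  show "open (B \<times> D)" "convex (B \<times> D)" using B D by (auto intro: open_Times convex_Times)
  show "linear (\<Theta> c d z)" if "z \<in> B \<times> D" for z using linear_\<Theta>[OF c d] sub that by blast
  show "C1_on (B \<times> D) (\<lambda>z. \<Theta> c d z v)" for v by (rule C1_on_subset[OF C1_\<Theta>[OF c d] sub])
  show "frechet_derivative (\<lambda>z. \<Theta> c d z v) (at z) u = frechet_derivative (\<lambda>z. \<Theta> c d z u) (at z) v"
    if "z \<in> B \<times> D" for z u v using closed_\<Theta>[OF c d] sub that by blast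
qed (use that in blast)

lemma fibre_primitive_of_local:
  assumes c: "c \<in> atlas X" and B: "B \<subseteq> chart_image c" and f: "local_primitive c B f" and x: "x \<in> B"
  shows "fibre_primitive (chart_inv c x) (f x)"
  unfolding fibre_primitive_def
proof (intro ballI impI)
  fix c' d y assume c': "c' \<in> atlas X" "chart_inv c x \<in> fst c'" and d: "d \<in> atlas Y" and y: "y \<in> chart_image d"
  have xc: "x \<in> chart_image c" using x B by blast
  have "((\<lambda>z. f (fst z) (chart_inv d (snd z))) has_derivative \<Theta> c d (x, y)) (at (x, y))"
    using f d x y unfolding local_primitive_def by blast
  from has_derivative_slice_snd[OF this]
  have "((\<lambda>y. f x (chart_inv d y)) has_derivative (\<lambda>b. \<Theta> c d (x, y) (0, b))) (at y)" by simp
  moreover have "\<Theta> c d (x, y) (0, b) = \<Theta> c' d (snd c' (chart_inv c x), y) (0, b)" for b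
    using \<Theta>_transition_X[OF c c'(1) d, of "chart_inv c x" "chart_inv d y"] c'(2)
      chart_inv_in[OF X c xc] chart_inv_in[OF Y d y] by (simp add: chart_chart_inv[OF X c xc] chart_chart_inv[OF Y d y])
  ultimately show "((\<lambda>y. f x (chart_inv d y)) has_derivative (\<lambda>b. \<Theta> c' d (snd c' (chart_inv c x), y) (0, b))) (at y)"
    by simp
qed

text \<open>The tube over a convex \<open>B\<close> retracts onto the slice over \<open>x1\<close>:
  to the given primitive on that slice one adds the primitive along \<open>B\<close> that vanishes
  at \<open>x1\<close>. Near a point of \<open>Y\<close>, a potential \<open>H\<close> from
  \<open>poincare_box\<close> identifies the sum as \<open>H\<close> plus a constant, which proves
  joint differentiability.\<close>

lemma extend_primitive:
  assumes c: "c \<in> atlas X" and B: "open B" "convex B" "B \<subseteq> chart_image c" and x1: "x1 \<in> B"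
    and f1: "fibre_primitive (chart_inv c x1) f1"
  obtains f where "local_primitive c B f"
proof -
  \<comment> \<open>\<open>S q \<phi>\<close> says that \<open>\<phi>\<close> is the primitive along
    \<open>B \<times> {q}\<close> with value \<open>0\<close> at \<open>x1\<close>. On
    \<open>B\<close> it is unique, so its choice by \<open>SOME\<close> agrees there with every
    local formula.\<close>
  define S where "S q \<phi> \<longleftrightarrow> \<phi> x1 = 0 \<and> (\<forall>d\<in>atlas Y. q \<in> fst d \<longrightarrow>
    (\<forall>x\<in>B. (\<phi> has_derivative (\<lambda>a. \<Theta> c d (x, snd d q) (a, 0))) (at x)))" for q and \<phi> :: "(complex, 'n) vec \<Rightarrow> real"
  have conB: "connected B" using B(2) by (rule convex_connected)
  have S_unique: "\<phi> x = \<psi> x" if su: "S q \<phi>" "S q \<psi>" "q \<in> topspace (mtop Y)" "x \<in> B" for q \<phi> \<psi> x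
  proof -
    obtain d where d: "d \<in> atlas Y" "q \<in> fst d" using su(3) Y unfolding complex_manifold_def by blast
    have "\<phi> x - \<psi> x = \<phi> x1 - \<psi> x1"
      by (rule has_derivative_zero_unique_on[OF B(1) conB, where D="\<lambda>x a. \<Theta> c d (x, snd d q) (a, 0)"])
        (use that d x1 in \<open>auto simp: S_def\<close>)
    then show ?thesis using that unfolding S_def by simp
  qed
  define f where "f x q = f1 q + (SOME \<phi>. S q \<phi>) x" for x q
  have "local_primitive c B f"
    unfolding local_primitive_def
  proof (intro ballI)
    fix d z assume d: "d \<in> atlas Y" and z: "z \<in> B \<times> chart_image d"
    obtain x y where xy: "z = (x, y)" "x \<in> B" "y \<in> chart_image d" using z by blast
    obtain r where r: "r > 0" "ball y r \<subseteq> chart_image d"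
      using chart_image_open[OF Y d] xy(3) open_contains_ball by blast
    obtain H where H: "\<And>z. z \<in> B \<times> ball y r \<Longrightarrow> (H has_derivative \<Theta> c d z) (at z)"
      using poincare_box[OF c d B open_ball convex_ball r(2)] by blast
    have Sh: "S (chart_inv d y') (\<lambda>x. H (x, y') - H (x1, y'))" if y': "y' \<in> ball y r" for y'
      unfolding S_def
    proof (intro conjI ballI impI)
      have yi: "y' \<in> chart_image d" using r y' by blast
      fix d' x' assume d': "d' \<in> atlas Y" "chart_inv d y' \<in> fst d'" and x': "x' \<in> B"
      have "((\<lambda>x. H (x, y') - H (x1, y')) has_derivative (\<lambda>a. \<Theta> c d (x', y') (a, 0) - 0)) (at x')"
        by (intro has_derivative_diff has_derivative_const has_derivative_slice_fst H) (use x' y' in auto)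
      moreover have xi: "x' \<in> chart_image c" using x' B(3) by blast
      have "\<Theta> c d (x', y') (a, 0) = \<Theta> c d' (x', snd d' (chart_inv d y')) (a, 0)" for a
        using \<Theta>_transition_Y[OF c d d'(1), of "chart_inv c x'" "chart_inv d y'"] d'(2)
          chart_inv_in[OF X c xi] chart_inv_in[OF Y d yi]
        by (simp add: chart_chart_inv[OF X c xi] chart_chart_inv[OF Y d yi])
      ultimately show "((\<lambda>x. H (x, y') - H (x1, y')) has_derivative (\<lambda>a. \<Theta> c d' (x', snd d' (chart_inv d y')) (a, 0))) (at x')"
        by simp
    qed simp
    have f_eq: "f x' (chart_inv d y') = f1 (chart_inv d y') + (H (x', y') - H (x1, y'))"
      if "x' \<in> B" "y' \<in> ball y r" for x' y'
    proof -
      have "chart_inv d y' \<in> topspace (mtop Y)"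
        using chart_inv_in[OF Y d] chart_sub[OF Y d] that(2) r(2) by blast
      then have "(SOME \<phi>. S (chart_inv d y') \<phi>) x' = H (x', y') - H (x1, y')"
        using S_unique[OF someI[of "S (chart_inv d y')", OF Sh[OF that(2)]] Sh[OF that(2)]] that(1) by blast
      then show ?thesis by (simp add: f_def)
    qed
    have x1c: "x1 \<in> chart_image c" using x1 B by blast
    \<comment> \<open>On the slice over \<open>x1\<close> both \<open>f1\<close> and
      \<open>H\<close> are primitives of the same form, so they differ by a constant on the
      ball.\<close>
    have const: "f1 (chart_inv d y') - H (x1, y') = f1 (chart_inv d y) - H (x1, y)" if "y' \<in> ball y r" for y'
    proof (rule has_derivative_zero_unique_on[OF open_ball connected_ball, where D="\<lambda>y b. \<Theta> c d (x1, y) (0, b)"])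
      show "((\<lambda>y. f1 (chart_inv d y)) has_derivative (\<lambda>b. \<Theta> c d (x1, y'') (0, b))) (at y'')" if "y'' \<in> ball y r" for y''
      proof -
        have "y'' \<in> chart_image d" using that r by blast
        then show ?thesis using f1 c chart_inv_in[OF X c x1c] d unfolding fibre_primitive_def
          using chart_chart_inv[OF X c x1c] by metis
      qed
      show "((\<lambda>y. H (x1, y)) has_derivative (\<lambda>b. \<Theta> c d (x1, y'') (0, b))) (at y'')" if "y'' \<in> ball y r" for y''
        by (rule has_derivative_slice_snd[OF H]) (use that x1 in auto)
    qed (use that r in auto)
    have "((\<lambda>z. H z + (f1 (chart_inv d y) - H (x1, y))) has_derivative (\<lambda>v. \<Theta> c d z v + 0)) (at z)"
      by (intro has_derivative_add has_derivative_const H) (use xy r in auto)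
    then have "((\<lambda>z. H z + (f1 (chart_inv d y) - H (x1, y))) has_derivative \<Theta> c d z) (at z)" by simp
    then show "((\<lambda>z. f (fst z) (chart_inv d (snd z))) has_derivative \<Theta> c d z) (at z)"
    proof (rule has_derivative_transform_within_open)
      show "open (B \<times> ball y r)" using B by (intro open_Times open_ball)
      show "z \<in> B \<times> ball y r" using xy r by simp
      fix z' assume "z' \<in> B \<times> ball y r"
      then have "fst z' \<in> B" "snd z' \<in> ball y r" by auto
      from f_eq[OF this] const[OF this(2)]
      show "H z' + (f1 (chart_inv d y) - H (x1, y)) = f (fst z') (chart_inv d (snd z'))" by simp
    qed
  qed
  then show ?thesis using that by blast
qed

text \<open>By \<open>extend_primitive\<close>, having a primitive on its slice is a locally
  constant property of the base point, and \<open>X\<close> is connected.\<close>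

lemma fibre_primitive_everywhere:
  assumes "p0 \<in> topspace (mtop X)" "fibre_primitive p0 f0" and p: "p \<in> topspace (mtop X)"
  shows "\<exists>f. fibre_primitive p f"
proof -
  have "(\<exists>f. fibre_primitive p0 f) = (\<exists>f. fibre_primitive p f)"
  proof (rule connected_space_locally_constant[of "mtop X" "\<lambda>p. \<exists>f. fibre_primitive p f"])
    show "connected_space (mtop X)" using X unfolding complex_manifold_def by blast
    fix q assume "q \<in> topspace (mtop X)"
    then obtain c where c: "c \<in> atlas X" "q \<in> fst c" using X unfolding complex_manifold_def by blast
    obtain r where r: "r > 0" "ball (snd c q) r \<subseteq> chart_image c"
      using chart_image_open[OF X c(1)] chart_in[OF X c] open_contains_ball by blast
    have all: "\<exists>f. fibre_primitive q2 f" if q1: "q1 \<in> fst c" "snd c q1 \<in> ball (snd c q) r" and q2: "q2 \<in> fst c" "snd c q2 \<in> ball (snd c q) r"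
      and f: "fibre_primitive q1 f" for q1 q2 f
    proof -
      have "fibre_primitive (chart_inv c (snd c q1)) f" using f q1(1) by (simp add: chart_inv_chart[OF X c(1)])
      then obtain g where "local_primitive c (ball (snd c q) r) g"
        using extend_primitive[OF c(1) open_ball convex_ball r(2) q1(2)] by blast
      from fibre_primitive_of_local[OF c(1) r(2) this q2(2)] show ?thesis
        using q2(1) by (auto simp: chart_inv_chart[OF X c(1)])
    qed
    show "\<exists>N. openin (mtop X) N \<and> q \<in> N \<and> (\<forall>q'\<in>N. (\<exists>f. fibre_primitive q' f) = (\<exists>f. fibre_primitive q f))"
    proof (intro exI[of _ "{p \<in> fst c. snd c p \<in> ball (snd c q) r}"] conjI ballI)
      show "openin (mtop X) {p \<in> fst c. snd c p \<in> ball (snd c q) r}" by (rule chart_preimage_open[OF X c(1) open_ball])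
      show "q \<in> {p \<in> fst c. snd c p \<in> ball (snd c q) r}" using c r by simp
      show "(\<exists>f. fibre_primitive q' f) = (\<exists>f. fibre_primitive q f)" if "q' \<in> {p \<in> fst c. snd c p \<in> ball (snd c q) r}" for q'
        using all[of q' q] all[of q q'] that c r by auto
    qed
  qed (use assms in auto)
  then show ?thesis using assms by blast
qed

lemma fibre_primitive_unique:
  assumes p: "p \<in> topspace (mtop X)" and f: "fibre_primitive p f" and g: "fibre_primitive p g"
    and a: "a \<in> topspace (mtop Y)" and b: "b \<in> topspace (mtop Y)"
  shows "f a - g a = f b - g b"
proof (rule connected_space_locally_constant[of "mtop Y" "\<lambda>q. f q - g q"])
  show "connected_space (mtop Y)" using Y unfolding complex_manifold_def by blast
  fix q assume "q \<in> topspace (mtop Y)"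
  then obtain d where d: "d \<in> atlas Y" "q \<in> fst d" using Y unfolding complex_manifold_def by blast
  obtain c where c: "c \<in> atlas X" "p \<in> fst c" using p X unfolding complex_manifold_def by blast
  obtain r where r: "r > 0" "ball (snd d q) r \<subseteq> chart_image d"
    using chart_image_open[OF Y d(1)] chart_in[OF Y d] open_contains_ball by blast
  show "\<exists>N. openin (mtop Y) N \<and> q \<in> N \<and> (\<forall>q'\<in>N. f q' - g q' = f q - g q)"
  proof (intro exI[of _ "{p \<in> fst d. snd d p \<in> ball (snd d q) r}"] conjI ballI)
    show "openin (mtop Y) {p \<in> fst d. snd d p \<in> ball (snd d q) r}" by (rule chart_preimage_open[OF Y d(1) open_ball])
    show "q \<in> {p \<in> fst d. snd d p \<in> ball (snd d q) r}" using d r by simp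
    fix q' assume q': "q' \<in> {p \<in> fst d. snd d p \<in> ball (snd d q) r}"
    have "f (chart_inv d (snd d q')) - g (chart_inv d (snd d q')) = f (chart_inv d (snd d q)) - g (chart_inv d (snd d q))"
    proof (rule has_derivative_zero_unique_on[OF open_ball connected_ball, where D="\<lambda>y b. \<Theta> c d (snd c p, y) (0, b)"])
      fix y assume "y \<in> ball (snd d q) r"
      then have "y \<in> chart_image d" using r by blast
      then show "((\<lambda>y. f (chart_inv d y)) has_derivative (\<lambda>b. \<Theta> c d (snd c p, y) (0, b))) (at y)"
        "((\<lambda>y. g (chart_inv d y)) has_derivative (\<lambda>b. \<Theta> c d (snd c p, y) (0, b))) (at y)"
        using f g c d unfolding fibre_primitive_def by blast+
    qed (use q' d r in auto)
    then show "f q' - g q' = f q - g q" using q' d by (simp add: chart_inv_chart[OF Y d(1)])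
  qed
qed (use a b in auto)

end

section \<open>Integration over the second factor\<close>

text \<open>Any real-linear isomorphism will do, so one is chosen instead of written down.
  \<open>'m bit0\<close> has \<open>2 * CARD('m)\<close> elements, which is the real dimension, and
  it carries the well-order that the integration locale requires.\<close>

definition to_cvec :: "real^('m::finite bit0) \<Rightarrow> complex^'m" where
  "to_cvec = (SOME f. linear f \<and> bij f \<and> linear (inv f))"

definition of_cvec :: "complex^'m \<Rightarrow> real^('m::finite bit0)" where
  "of_cvec = inv to_cvec"

lemma cvec_iso: "linear (to_cvec :: real^('m::finite bit0) \<Rightarrow> complex^'m) \<and>
  bij (to_cvec :: real^('m::finite bit0) \<Rightarrow> complex^'m) \<and> linear (inv (to_cvec :: real^('m::finite bit0) \<Rightarrow> complex^'m))"
proof -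
  have "DIM(real^('m bit0)) = DIM(complex^'m)" by simp
  then obtain f :: "real^('m bit0) \<Rightarrow> complex^'m" and g where
    fg: "linear f" "linear g" "\<And>x. norm (f x) = norm x" "\<And>y. norm (g y) = norm y" "\<And>x. g (f x) = x" "\<And>y. f (g y) = y"
    by (rule isomorphisms_UNIV_UNIV) blast
  have "inv f = g" using fg by (intro inv_equality) auto
  moreover have "bij f" using fg by (intro o_bij[of g]) auto
  ultimately have "\<exists>f :: real^('m bit0) \<Rightarrow> complex^'m. linear f \<and> bij f \<and> linear (inv f)"
    using fg(1,2) by blast
  then show ?thesis unfolding to_cvec_def by (rule someI_ex)
qed

lemma of_to_cvec [simp]: "of_cvec (to_cvec x) = x"
  unfolding of_cvec_def using cvec_iso by (metis bij_inv_eq_iff)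

lemma to_of_cvec [simp]: "to_cvec (of_cvec y) = y"
  unfolding of_cvec_def using cvec_iso by (metis bij_inv_eq_iff)

lemma bounded_linear_to_cvec: "bounded_linear to_cvec"
  and bounded_linear_of_cvec: "bounded_linear of_cvec"
  unfolding of_cvec_def using cvec_iso by (auto simp: linear_conv_bounded_linear)

lemma of_cvec_image: "of_cvec ` S = {x. to_cvec x \<in> S}"
  by (auto simp: image_iff) (metis of_to_cvec)

locale compact_lck_product = lck_product X Y h \<theta>
  for X :: "('a, 'n::finite) cmfd" and Y :: "('b, 'm::finite) cmfd" and h \<theta> +
  assumes compact_Y: "compact_space (mtop Y)"

sublocale compact_lck_product \<subseteq> R: closed_C1_manifold "mtop Y" "atlas Y" fst
  "\<lambda>d q. of_cvec (snd d q)" "\<lambda>d x. chart_inv d (to_cvec x)"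
proof
  show "compact_space (mtop Y)" by (rule compact_Y)
  show "Hausdorff_space (mtop Y)" "(\<Union>i\<in>atlas Y. fst i) = topspace (mtop Y)"
    using Y unfolding complex_manifold_def by blast+
  fix i assume i: "i \<in> atlas Y"
  show "openin (mtop Y) (fst i)" by (rule chart_open[OF Y i])
  have im: "(\<lambda>q. of_cvec (snd i q)) ` U = of_cvec ` (snd i ` U)" for U by auto
  show "open ((\<lambda>q. of_cvec (snd i q)) ` fst i)"
    unfolding im of_cvec_image chart_image_def[symmetric]
    using open_vimage[OF chart_image_open[OF Y i] linear_continuous_on[OF bounded_linear_to_cvec]]
    by (simp add: vimage_def)
  have "homeomorphic_maps (top_of_set (chart_image i)) (top_of_set (of_cvec ` chart_image i)) of_cvec to_cvec"
    unfolding homeomorphic_maps_def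
    by (auto simp: linear_continuous_on bounded_linear_to_cvec bounded_linear_of_cvec)
  from homeomorphic_maps_compose[OF conjI[OF chart_homeo_maps[OF Y i] this]]
  show "homeomorphic_maps (subtopology (mtop Y) (fst i)) (top_of_set ((\<lambda>q. of_cvec (snd i q)) ` fst i))
     (\<lambda>q. of_cvec (snd i q)) (\<lambda>x. chart_inv i (to_cvec x))"
    unfolding im chart_image_def[symmetric] by (simp add: o_def)
  fix j assume j: "j \<in> atlas Y"
  show "C1_on ((\<lambda>q. of_cvec (snd i q)) ` (fst i \<inter> fst j)) (\<lambda>x. of_cvec (snd j (chart_inv i (to_cvec x))))"
    by (rule C1_on_linear_compose[OF bounded_linear_of_cvec],
        rule C1_on_compose[OF transition_C1_on[OF Y i j] C1_on_bounded_linear[OF bounded_linear_to_cvec], unfolded transition_def o_def])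
      auto
qed

context compact_lck_product begin

abbreviation "rim d \<equiv> (\<lambda>q. of_cvec (snd d q)) ` fst d"

lemma rim_iff: "x \<in> rim d \<longleftrightarrow> to_cvec x \<in> chart_image d"
proof -
  have "rim d = of_cvec ` chart_image d" unfolding chart_image_def by auto
  then show ?thesis by (simp add: of_cvec_image)
qed

text \<open>The absolute Pfaffian of the fundamental form on the slice over \<open>p\<close>, that
  is, the density of its top power divided by the factorial of \<open>CARD('m)\<close>. It depends
  on \<open>p\<close> but not on the chart around \<open>p\<close>, hence the choice.\<close>

definition vol_density :: "'a \<Rightarrow> ('b, 'm) chart \<Rightarrow> (real, 'm bit0) vec \<Rightarrow> real" where
  "vol_density p d x = (let c = SOME c. c \<in> atlas X \<and> p \<in> fst c in
    sqrt \<bar>det (\<chi> a b. \<Omega> c d (snd c p, to_cvec x) (0, to_cvec (axis a 1)) (0, to_cvec (axis b 1)))\<bar>)"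

lemma vol_density_eq:
  assumes c: "c \<in> atlas X" "p \<in> fst c" and d: "d \<in> atlas Y" and x: "x \<in> rim d"
  shows "vol_density p d x = sqrt \<bar>det (\<chi> a b. \<Omega> c d (snd c p, to_cvec x) (0, to_cvec (axis a 1)) (0, to_cvec (axis b 1)))\<bar>"
proof -
  define c0 where "c0 = (SOME c. c \<in> atlas X \<and> p \<in> fst c)"
  have c0: "c0 \<in> atlas X" "p \<in> fst c0"
    unfolding c0_def using someI[of "\<lambda>c. c \<in> atlas X \<and> p \<in> fst c" c] c by blast+
  obtain q where q: "q \<in> fst d" "x = of_cvec (snd d q)" using x by blast
  have "\<Omega> c0 d (snd c0 p, to_cvec x) (0, a) (0, b) = \<Omega> c d (snd c p, to_cvec x) (0, a) (0, b)" for a b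
    using \<Omega>_transition_X[OF c0(1) c(1) d, of p q] c0 c q by simp
  then show ?thesis unfolding vol_density_def c0_def[symmetric] Let_def by simp
qed

text \<open>Volume of the slice over \<open>p\<close> for the fundamental form rescaled by
  \<open>exp (- \<phi>)\<close>, whose top power carries the weight \<open>exp (- m \<phi>)\<close>
  with \<open>m = CARD('m)\<close>. \<open>\<rho>\<close> and \<open>\<iota>\<close> are meant to be
  a partition of unity on \<open>Y\<close> and its charts.\<close>

definition fibre_volume :: "'r set \<Rightarrow> ('r \<Rightarrow> 'b \<Rightarrow> real) \<Rightarrow> ('r \<Rightarrow> ('b, 'm) chart) \<Rightarrow> 'a \<Rightarrow> ('b \<Rightarrow> real) \<Rightarrow> real" where
  "fibre_volume P \<rho> \<iota> p \<phi> = (\<Sum>r\<in>P. integral UNIV (\<lambda>x. if x \<in> rim (\<iota> r)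
     then \<rho> r (chart_inv (\<iota> r) (to_cvec x)) *
       (exp (- real CARD('m) * \<phi> (chart_inv (\<iota> r) (to_cvec x))) * vol_density p (\<iota> r) x) else 0))"

lemma fibre_volume_shift:
  assumes P: "\<And>r. r \<in> P \<Longrightarrow> \<iota> r \<in> atlas Y" and eq: "\<And>q. q \<in> topspace (mtop Y) \<Longrightarrow> \<phi> q = \<psi> q + s"
  shows "fibre_volume P \<rho> \<iota> p \<phi> = exp (- real CARD('m) * s) * fibre_volume P \<rho> \<iota> p \<psi>"
  unfolding fibre_volume_def sum_distrib_left
proof (rule sum.cong[OF refl])
  fix r assume r: "r \<in> P"
  have "integral UNIV (\<lambda>x. if x \<in> rim (\<iota> r) then \<rho> r (chart_inv (\<iota> r) (to_cvec x)) *
       (exp (- real CARD('m) * \<phi> (chart_inv (\<iota> r) (to_cvec x))) * vol_density p (\<iota> r) x) else 0)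
    = integral UNIV (\<lambda>x. exp (- real CARD('m) * s) * (if x \<in> rim (\<iota> r) then \<rho> r (chart_inv (\<iota> r) (to_cvec x)) *
       (exp (- real CARD('m) * \<psi> (chart_inv (\<iota> r) (to_cvec x))) * vol_density p (\<iota> r) x) else 0))"
  proof (rule integral_cong)
    fix x :: "(real, 'm bit0) vec"
    show "(if x \<in> rim (\<iota> r) then \<rho> r (chart_inv (\<iota> r) (to_cvec x)) *
       (exp (- real CARD('m) * \<phi> (chart_inv (\<iota> r) (to_cvec x))) * vol_density p (\<iota> r) x) else 0) =
       exp (- real CARD('m) * s) * (if x \<in> rim (\<iota> r) then \<rho> r (chart_inv (\<iota> r) (to_cvec x)) *
       (exp (- real CARD('m) * \<psi> (chart_inv (\<iota> r) (to_cvec x))) * vol_density p (\<iota> r) x) else 0)"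
    proof (cases "x \<in> rim (\<iota> r)")
      case True
      then have "chart_inv (\<iota> r) (to_cvec x) \<in> topspace (mtop Y)"
        using chart_inv_in[OF Y P[OF r]] chart_sub[OF Y P[OF r]] by (auto simp: rim_iff)
      from eq[OF this] show ?thesis by (simp add: algebra_simps exp_add[symmetric])
    qed simp
  qed
  then show "integral UNIV (\<lambda>x. if x \<in> rim (\<iota> r) then \<rho> r (chart_inv (\<iota> r) (to_cvec x)) *
       (exp (- real CARD('m) * \<phi> (chart_inv (\<iota> r) (to_cvec x))) * vol_density p (\<iota> r) x) else 0)
    = exp (- real CARD('m) * s) * integral UNIV (\<lambda>x. if x \<in> rim (\<iota> r) then \<rho> r (chart_inv (\<iota> r) (to_cvec x)) *
       (exp (- real CARD('m) * \<psi> (chart_inv (\<iota> r) (to_cvec x))) * vol_density p (\<iota> r) x) else 0)"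
    by (simp only: integral_mult_right)
qed

lemma C1_local_primitive:
  assumes c: "c \<in> atlas X" and d: "d \<in> atlas Y" and B: "B \<subseteq> chart_image c" and f: "local_primitive c B f"
  shows "C1_on (B \<times> chart_image d) (\<lambda>z. f (fst z) (chart_inv d (snd z)))"
  by (rule C1_onI[where f'="\<Theta> c d"])
    (use f d B in \<open>auto simp: local_primitive_def intro: continuous_on_subset[OF C1_on_continuous_on[OF C1_\<Theta>[OF c d]]]\<close>)

text \<open>Each of the \<open>2 * CARD('m)\<close> rows contributes a factor, and the root halves
  the exponent.\<close>

lemma sqrt_det_scale:
  fixes M :: "'m bit0 \<Rightarrow> 'm bit0 \<Rightarrow> real"
  shows "sqrt \<bar>det (\<chi> a b. exp (- r) * M a b)\<bar> = exp (- real CARD('m) * r) * sqrt \<bar>det (\<chi> a b. M a b)\<bar>"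
proof -
  have "(\<chi> a b. exp (- r) * M a b) = (\<chi> a. exp (- r) *s (\<chi> b. M a b))"
    by (simp add: vec_eq_iff)
  then have "det (\<chi> a b. exp (- r) * M a b) = exp (- r) ^ (2 * CARD('m)) * det (\<chi> a b. M a b)"
    using det_rows_mul[of "\<lambda>_. exp (- r)" "\<lambda>a. \<chi> b. M a b"] by simp
  moreover have "exp (- r) ^ (2 * CARD('m)) = (exp (- real CARD('m) * r))\<^sup>2"
    by (simp add: exp_of_nat_mult[symmetric] power2_eq_square exp_add[symmetric])
  ultimately show ?thesis by (simp add: abs_mult real_sqrt_mult)
qed

lemma nondegenerate_\<Omega>:
  assumes "c \<in> atlas X" "d \<in> atlas Y" "z \<in> dom c d" "v \<noteq> 0"
  shows "\<Omega> c d z (0, \<i> *s v) (0, v) < 0"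
  using \<Omega>_hermitian(2)[OF assms(1-3), of "(0, v)"] \<Omega>_hermitian(1)[OF assms(1-3), of "(0, \<i> *s v)" "(0, v)"] assms(4)
  by (simp add: zero_prod_def)

text \<open>The segment from \<open>x0\<close> to \<open>x1\<close> sweeps out a family of slices.
  Pulled back to time times \<open>Y\<close>, the form \<open>exp (- f) \<Omega>\<close> is closed
  because \<open>f\<close> is a primitive on the tube, and nondegenerate on the slices because their
  tangent spaces are stable under \<open>\<i>\<close>; so the fibre volume agrees at the times
  \<open>0\<close> and \<open>1\<close>.\<close>

lemma fibre_volume_local_constant:
  assumes P: "finite P" "\<And>r. r \<in> P \<Longrightarrow> \<iota> r \<in> atlas Y" "\<And>r. r \<in> P \<Longrightarrow> compact (K r)"
      "\<And>r. r \<in> P \<Longrightarrow> K r \<subseteq> rim (\<iota> r)"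
    and supp: "\<And>r q. r \<in> P \<Longrightarrow> q \<in> topspace (mtop Y) \<Longrightarrow> \<rho> r q \<noteq> 0 \<Longrightarrow> q \<in> fst (\<iota> r) \<and> of_cvec (snd (\<iota> r) q) \<in> K r"
    and one: "\<And>q. q \<in> topspace (mtop Y) \<Longrightarrow> (\<Sum>r\<in>P. \<rho> r q) = (1::real)"
    and C\<rho>: "\<And>r j. r \<in> P \<Longrightarrow> j \<in> atlas Y \<Longrightarrow> C1_on (rim j) (\<lambda>x. \<rho> r (chart_inv j (to_cvec x)))"
    and c: "c \<in> atlas X" and B: "open B" "convex B" "B \<subseteq> chart_image c"
    and f: "local_primitive c B f" and x: "x0 \<in> B" "x1 \<in> B"
  shows "fibre_volume P \<rho> \<iota> (chart_inv c x0) (f x0) = fibre_volume P \<rho> \<iota> (chart_inv c x1) (f x1)"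
proof -
  define u where "u = x1 - x0"
  \<comment> \<open>The times at which the line through \<open>x0\<close> and \<open>x1\<close> lies
    in \<open>B\<close>: open and convex because \<open>B\<close> is, and containing
    \<open>0\<close> and \<open>1\<close>.\<close>
  define J where "J = (\<lambda>t. x0 + t *\<^sub>R u) -` B"
  define L where "L z = (x0 + fst z *\<^sub>R u, to_cvec (snd z))" for z :: "real \<times> (real, 'm bit0) vec"
  define L' where "L' z = (fst z *\<^sub>R u, to_cvec (snd z))" for z :: "real \<times> (real, 'm bit0) vec"
  define \<Phi> where "\<Phi> i z v w = exp (- f (fst z) (chart_inv i (snd z))) * \<Omega> c i z v w" for i z v w
  define \<Psi> where "\<Psi> i z v w = \<Phi> i (L z) (L' v) (L' w)" for i z v w
  have J: "open J" "convex J"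
  proof -
    show "open J" unfolding J_def by (intro open_vimage B) (intro continuous_intros)
    have "J = (\<lambda>t. t *\<^sub>R u) -` ((+) (- x0) ` B)" unfolding J_def by (force simp: image_iff)
    then show "convex J" using convex_linear_vimage[of "\<lambda>t. t *\<^sub>R u" "(+) (- x0) ` B"] convex_translation[OF B(2), of "- x0"]
      by (simp add: linear_scaleR_left)
  qed
  have L_in: "L z \<in> B \<times> chart_image i" if "z \<in> J \<times> rim i" for z i
    using that rim_iff[of "snd z" i] by (auto simp: J_def L_def simp del: image_iff)
  have sub: "B \<times> chart_image i \<subseteq> dom c i" for i using B by auto
  have LD: "(L has_derivative L') (at z)" for z
    unfolding L_def[abs_def] L'_def[abs_def]
    by (auto intro!: derivative_eq_intros bounded_linear.has_derivative[OF bounded_linear_to_cvec])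
  have blL': "bounded_linear L'" using LD has_derivative_bounded_linear by blast
  have CL: "C1_on S L" for S by (rule C1_onI[OF LD]) simp
  have C\<Phi>: "C1_on (B \<times> chart_image i) (\<lambda>z. \<Phi> i z v w)" if i: "i \<in> atlas Y" for i v w
    unfolding \<Phi>_def
    by (intro C1_on_mult C1_on_exp C1_on_uminus C1_local_primitive[OF c i B(3) f] C1_on_subset[OF C1_\<Omega>[OF c i] sub])
  have Om_anti: "\<Phi> i z v w = - \<Phi> i z w v" if "i \<in> atlas Y" "z \<in> B \<times> chart_image i" for i z v w
    using \<Omega>_hermitian(1)[OF c that(1) subsetD[OF sub that(2)], of v w] by (simp add: \<Phi>_def)
  have eq: "fibre_volume P \<rho> \<iota> (chart_inv c (x0 + t *\<^sub>R u)) (f (x0 + t *\<^sub>R u)) =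
    (\<Sum>p\<in>P. integral UNIV (\<lambda>x. if x \<in> rim (\<iota> p)
     then \<rho> p (chart_inv (\<iota> p) (to_cvec x)) * sqrt \<bar>det (\<chi> a b. \<Psi> (\<iota> p) (t, x) (0, axis a 1) (0, axis b 1))\<bar> else 0))"
    if t: "t \<in> J" for t
    unfolding fibre_volume_def
  proof (intro sum.cong refl integral_cong)
    fix r x assume r: "r \<in> P"
    show "(if x \<in> rim (\<iota> r) then \<rho> r (chart_inv (\<iota> r) (to_cvec x)) *
       (exp (- real CARD('m) * f (x0 + t *\<^sub>R u) (chart_inv (\<iota> r) (to_cvec x))) * vol_density (chart_inv c (x0 + t *\<^sub>R u)) (\<iota> r) x) else 0)
      = (if x \<in> rim (\<iota> r) then \<rho> r (chart_inv (\<iota> r) (to_cvec x)) * sqrt \<bar>det (\<chi> a b. \<Psi> (\<iota> r) (t, x) (0, axis a 1) (0, axis b 1))\<bar> else 0)"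
    proof (cases "x \<in> rim (\<iota> r)")
      case True
      have xt: "x0 + t *\<^sub>R u \<in> chart_image c" using t B(3) by (auto simp: J_def)
      note vol_density_eq[OF c chart_inv_in[OF X c xt] P(2)[OF r] True]
      moreover have "\<Psi> (\<iota> r) (t, x) (0, v) (0, w) = exp (- f (x0 + t *\<^sub>R u) (chart_inv (\<iota> r) (to_cvec x))) *
         \<Omega> c (\<iota> r) (x0 + t *\<^sub>R u, to_cvec x) (0, to_cvec v) (0, to_cvec w)" for v w
        by (simp add: \<Psi>_def \<Phi>_def L_def L'_def)
      ultimately show ?thesis using True by (simp add: sqrt_det_scale chart_chart_inv[OF X c xt])
    qed simp
  qed
  have "0 \<in> J" "1 \<in> J" using x by (auto simp: J_def u_def)
  have "(\<Sum>p\<in>P. integral UNIV (\<lambda>x. if x \<in> rim (\<iota> p)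
     then \<rho> p (chart_inv (\<iota> p) (to_cvec x)) * sqrt \<bar>det (\<chi> a b. \<Psi> (\<iota> p) (0, x) (0, axis a 1) (0, axis b 1))\<bar> else 0))
     = (\<Sum>p\<in>P. integral UNIV (\<lambda>x. if x \<in> rim (\<iota> p)
     then \<rho> p (chart_inv (\<iota> p) (to_cvec x)) * sqrt \<bar>det (\<chi> a b. \<Psi> (\<iota> p) (1, x) (0, axis a 1) (0, axis b 1))\<bar> else 0))"
  proof (rule R.fibre_volume_constant[where \<Psi>=\<Psi> and J=J and K=K and \<rho>=\<rho> and P=P and \<iota>=\<iota> and s=0 and t=1])
    show "finite P" by (rule P(1))
    show "\<iota> r \<in> atlas Y" "compact (K r)" "K r \<subseteq> rim (\<iota> r)" if "r \<in> P" for r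
      using P(2-4)[OF that] .
    show "q \<in> fst (\<iota> r) \<and> of_cvec (snd (\<iota> r) q) \<in> K r" if "r \<in> P" "q \<in> topspace (mtop Y)" "\<rho> r q \<noteq> 0" for r q
      using supp[OF that] .
    show "(\<Sum>r\<in>P. \<rho> r q) = 1" if "q \<in> topspace (mtop Y)" for q using one[OF that] .
    show "C1_on (rim j) (\<lambda>x. \<rho> r (chart_inv j (to_cvec x)))" if "r \<in> P" "j \<in> atlas Y" for r j using C\<rho>[OF that] .
    show "open J" using J(1) .
    show "convex J" using J(2) .
    show "0 \<in> J" using \<open>0 \<in> J\<close> .
    show "1 \<in> J" using \<open>1 \<in> J\<close> .
  next
    fix i assume i: "i \<in> atlas Y"
    show "C1_on (J \<times> rim i) (\<lambda>z. \<Psi> i z v w)" for v w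
      unfolding \<Psi>_def by (rule C1_on_compose[OF C\<Phi>[OF i] CL], rule image_subsetI, rule L_in)
    fix z assume z: "z \<in> J \<times> rim i"
    note zi = L_in[OF z]
    note b = bilinear_\<Omega>[OF c i subsetD[OF sub zi], unfolded bilinear_def]
    have linL: "linear L'" using blL' by (rule bounded_linear.linear)
    have key: "linear (\<lambda>w. k * g (L' w))" if "linear g" for k :: real and g
      by (rule linearI) (simp_all add: linear_add[OF linL] linear_cmul[OF linL] linear_add[OF that]
          linear_cmul[OF that] algebra_simps)
    show "bilinear (\<Psi> i z)"
      unfolding bilinear_def \<Psi>_def \<Phi>_def
    proof (intro conjI allI)
      fix v
      show "linear (\<lambda>w. exp (- f (fst (L z)) (chart_inv i (snd (L z)))) * \<Omega> c i (L z) (L' v) (L' w))"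
        by (rule key) (use b in blast)
      show "linear (\<lambda>w. exp (- f (fst (L z)) (chart_inv i (snd (L z)))) * \<Omega> c i (L z) (L' w) (L' v))"
        by (rule key[of "\<lambda>w. \<Omega> c i (L z) w (L' v)"]) (use b in blast)
    qed
    show "\<Psi> i z v w = - \<Psi> i z w v" for v w unfolding \<Psi>_def by (rule Om_anti[OF i zi])
    show "\<exists>w. \<Psi> i z (0, w) (0, v) \<noteq> 0" if v: "v \<noteq> 0" for v
    proof (intro exI)
      have "to_cvec v \<noteq> 0" using v by (metis bounded_linear.linear bounded_linear_of_cvec linear_0 of_to_cvec)
      from nondegenerate_\<Omega>[OF c i subsetD[OF sub zi] this]
      show "\<Psi> i z (0, of_cvec (\<i> *s to_cvec v)) (0, v) \<noteq> 0" by (simp add: \<Psi>_def \<Phi>_def L'_def)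
    qed
    have F: "((\<lambda>z. f (fst z) (chart_inv i (snd z))) has_derivative \<Theta> c i (L z)) (at (L z))"
      using bspec[OF bspec[OF f[unfolded local_primitive_def] i] zi] .
    have "closed_two_form_at (\<Phi> i) (L z)" unfolding \<Phi>_def
      by (rule conformal_closed_two_form[OF F C1_on_differentiable[OF C1_\<Omega>[OF c i] subsetD[OF sub zi]] lee_\<Omega>[OF c i subsetD[OF sub zi]]])
    then show "closed_two_form_at (\<Psi> i) z" unfolding \<Psi>_def
      by (rule closed_two_form_affine_pullback[OF _ LD C1_on_differentiable[OF C\<Phi>[OF i] zi]])
  next
    fix i j q t s and v w :: "(real, 'm bit0) vec" assume i: "i \<in> atlas Y" and j: "j \<in> atlas Y" and q: "q \<in> fst i \<inter> fst j" and t: "t \<in> J"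
    have xt: "x0 + t *\<^sub>R u \<in> chart_image c" using t B(3) by (auto simp: J_def)
    let ?p = "chart_inv c (x0 + t *\<^sub>R u)"
    have p: "?p \<in> fst c" by (rule chart_inv_in[OF X c xt])
    have "(transition i j has_derivative frechet_derivative (transition i j) (at (snd i q))) (at (to_cvec (of_cvec (snd i q))))"
      using C1_on_has_derivative[OF transition_C1_on[OF Y i j]] q by auto
    from has_derivative_compose[OF bounded_linear_imp_has_derivative[OF bounded_linear_to_cvec] this]
    have "((\<lambda>x. of_cvec (transition i j (to_cvec x))) has_derivative
      (\<lambda>v. of_cvec (frechet_derivative (transition i j) (at (snd i q)) (to_cvec v)))) (at (of_cvec (snd i q)))"
      by (rule bounded_linear.has_derivative[OF bounded_linear_of_cvec])
    then have fd: "frechet_derivative (\<lambda>x. of_cvec (snd j (chart_inv i (to_cvec x)))) (at (of_cvec (snd i q)))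
      = (\<lambda>v. of_cvec (frechet_derivative (transition i j) (at (snd i q)) (to_cvec v)))"
      unfolding transition_def o_def by (rule frechet_derivative_at[symmetric])
    \<comment> \<open>The chart \<open>c\<close> of \<open>X\<close> is the same on both sides, so
      the first tangent map is the identity and the time direction \<open>s *\<^sub>R u\<close> is
      unchanged.\<close>
    show "\<Psi> i (t, of_cvec (snd i q)) (s, v) (0, w) = \<Psi> j (t, of_cvec (snd j q))
        (s, frechet_derivative (\<lambda>x. of_cvec (snd j (chart_inv i (to_cvec x)))) (at (of_cvec (snd i q))) v)
        (0, frechet_derivative (\<lambda>x. of_cvec (snd j (chart_inv i (to_cvec x)))) (at (of_cvec (snd i q))) w)"
      using \<Omega>_transition[OF c c i j _ q, of ?p "(s *\<^sub>R u, to_cvec v)" "(0, to_cvec w)"] p q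
      by (simp add: fd \<Psi>_def \<Phi>_def L_def L'_def chart_chart_inv[OF X c xt] transition_self[OF X c p, simplified chart_chart_inv[OF X c xt]]
          chart_inv_chart[OF Y i] chart_inv_chart[OF Y j])
  qed
  then show ?thesis using eq[OF \<open>0 \<in> J\<close>] eq[OF \<open>1 \<in> J\<close>] by (simp add: u_def)
qed

end

section \<open>Positive slice volume, smooth primitives and exactness\<close>

lemma integral_pos_continuous:
  fixes f :: "'e::euclidean_space \<Rightarrow> real"
  assumes f: "continuous_on UNIV f" "\<And>x. f x \<ge> 0" and K: "bounded K" "\<And>x. x \<notin> K \<Longrightarrow> f x = 0" and x: "f x0 > 0"
  shows "integral UNIV f > 0"
proof -
  obtain a where a: "insert x0 K \<subseteq> box (- a) a" using K(1) bounded_subset_box_symmetric[of "insert x0 K"] by auto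
  have ne: "box (- a) a \<noteq> {}" using a by blast
  have x0: "x0 \<in> cbox (- a) a" using a box_subset_cbox by blast
  have cont: "continuous_on (cbox (- a) a) f" using f(1) continuous_on_subset by blast
  have "integral (cbox (- a) a) f \<noteq> 0"
    using integral_cbox_eq_0_iff[OF cont ne f(2)] x x0 by force
  moreover have "integral (cbox (- a) a) f \<ge> 0"
    using f(2) by (intro integral_nonneg integrable_continuous cont)
  moreover have "integral UNIV f = integral (cbox (- a) a) f"
    by (rule integral_UNIV_support) (use a K(2) box_subset_cbox in blast)
  ultimately show ?thesis by linarith
qed

lemma Ck_on_cong:
  fixes f g :: "'e::real_normed_vector \<Rightarrow> 'f::real_normed_vector"
  assumes "open S" "\<And>x. x \<in> S \<Longrightarrow> f x = g x" "Ck_on k S g"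
  shows "Ck_on k S f"
  using assms
proof (induction k arbitrary: f g)
  case 0
  then show ?case by (simp cong: continuous_on_cong)
next
  case (Suc k)
  have D: "(f has_derivative frechet_derivative g (at x)) (at x)" if "x \<in> S" for x
  proof (rule has_derivative_transform_within_open[OF _ Suc.prems(1) that])
    show "(g has_derivative frechet_derivative g (at x)) (at x)"
      using Suc.prems(3) that by (simp add: frechet_derivative_works[symmetric])
  qed (simp add: Suc.prems(2))
  then have "f differentiable (at x)" if "x \<in> S" for x using that unfolding differentiable_def by blast
  moreover have "frechet_derivative f (at x) v = frechet_derivative g (at x) v" if "x \<in> S" for x v
    using frechet_derivative_at[OF D[OF that]] by simp
  then have "Ck_on k S (\<lambda>x. frechet_derivative f (at x) v)" for v
    by (rule Suc.IH[OF Suc.prems(1), of _ "\<lambda>x. frechet_derivative g (at x) v"]) (use Suc.prems(3) in simp_all)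
  ultimately show ?case by simp
qed

text \<open>Derivatives of \<open>f\<close> of order \<open>l + 1\<close> are derivatives of order
  \<open>l\<close> of the smooth \<open>f'\<close>. This upgrades the primitive, known only to be
  differentiable, to the smooth function that \<open>exact_one_form\<close> demands.\<close>

lemma smooth_on_of_derivative:
  fixes f :: "'e::real_normed_vector \<Rightarrow> real"
  assumes S: "open S" and D: "\<And>x. x \<in> S \<Longrightarrow> (f has_derivative f' x) (at x)" and f': "\<And>v. smooth_on S (\<lambda>x. f' x v)"
  shows "smooth_on S f"
  unfolding smooth_on_def
proof
  fix k
  show "Ck_on k S f"
  proof (cases k)
    case 0
    then show ?thesis using D by (auto intro!: continuous_at_imp_continuous_on has_derivative_continuous)
  next
    case (Suc l)
    have "Ck_on l S (\<lambda>x. frechet_derivative f (at x) v)" for v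
    proof (rule Ck_on_cong[OF S])
      show "frechet_derivative f (at x) v = f' x v" if "x \<in> S" for x
        using frechet_derivative_at[OF D[OF that]] by simp
      show "Ck_on l S (\<lambda>x. f' x v)" using f' unfolding smooth_on_def by blast
    qed
    moreover have "f differentiable (at x)" if "x \<in> S" for x using D[OF that] unfolding differentiable_def by blast
    ultimately show ?thesis using Suc by simp
  qed
qed

lemma (in lck_product) exact_one_formI:
  assumes F: "\<And>c d z. c \<in> atlas X \<Longrightarrow> d \<in> atlas Y \<Longrightarrow> z \<in> dom c d \<Longrightarrow>
    ((\<lambda>z. F (chart_inv c (fst z), chart_inv d (snd z))) has_derivative \<Theta> c d z) (at z)"
  shows "exact_one_form (prod_cmfd X Y) \<theta>"
proof -
  have at: "\<exists>c d. c \<in> atlas X \<and> d \<in> atlas Y \<and> e = prod_chart c d" if "e \<in> atlas (prod_cmfd X Y)" for e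
    using that unfolding prod_cmfd_def by auto
  have op: "open (chart_image e)" if e_at: "e \<in> atlas (prod_cmfd X Y)" for e
  proof -
    obtain c d where e: "c \<in> atlas X" "d \<in> atlas Y" "e = prod_chart c d" using at[OF e_at] by blast
    have "chart_image e = vec_split -` (dom c d)" unfolding e(3) chart_image_prod
      by (auto simp: image_iff) (metis vec_pair_split mem_Times_iff prod.collapse)
    then show ?thesis
      using open_vimage[OF dom_open[OF e(1,2)] linear_continuous_on[OF bounded_linear_vec_split]] by simp
  qed
  have D: "((F \<circ> chart_inv e) has_derivative \<theta> e x) (at x)" if e: "e \<in> atlas (prod_cmfd X Y)" and x: "x \<in> chart_image e" for e x
  proof -
    obtain c d where cd: "c \<in> atlas X" "d \<in> atlas Y" "e = prod_chart c d" using at[OF e] by blast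
    obtain z where z: "z \<in> dom c d" "x = vec_pair z" using x unfolding cd(3) chart_image_prod by blast
    have "((\<lambda>z. F (chart_inv c (fst z), chart_inv d (snd z))) has_derivative \<Theta> c d z) (at (vec_split x))"
      using F[OF cd(1,2) z(1)] z(2) by simp
    from has_derivative_compose[OF bounded_linear_imp_has_derivative[OF bounded_linear_vec_split] this]
    have "((\<lambda>x. F (chart_inv c (fst (vec_split x)), chart_inv d (snd (vec_split x)))) has_derivative \<theta> e x) (at x)"
      by (simp add: \<Theta>_def cd(3) z(2))
    then show ?thesis
    proof (rule has_derivative_transform_within_open[OF _ op[OF e] x])
      fix x' assume "x' \<in> chart_image e"
      then obtain a b where ab: "a \<in> chart_image c" "b \<in> chart_image d" "x' = vec_pair (a, b)"
        unfolding cd(3) chart_image_prod by blast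
      show "F (chart_inv c (fst (vec_split x')), chart_inv d (snd (vec_split x'))) = (F \<circ> chart_inv e) x'"
        unfolding cd(3) ab(3) o_def
        by (simp add: chart_inv_prod[OF chart_inj[OF X cd(1)] chart_inj[OF Y cd(2)] ab(1,2)])
    qed
  qed
  show ?thesis
    unfolding exact_one_form_def smooth_function_def
  proof (intro conjI exI[of _ F] ballI allI)
    show "smooth_one_form (prod_cmfd X Y) \<theta>" by (rule one_form)
    fix e assume e: "e \<in> atlas (prod_cmfd X Y)"
    show "smooth_on (chart_image e) (F \<circ> chart_inv e)"
    proof (rule smooth_on_of_derivative[OF op[OF e] D[OF e]])
      show "smooth_on (chart_image e) (\<lambda>x. \<theta> e x v)" for v
        using one_form e unfolding smooth_one_form_def by blast
    qed
    show "\<theta> e x v = frechet_derivative (F \<circ> chart_inv e) (at x) v" if "x \<in> chart_image e" for x v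
      using frechet_derivative_at[OF D[OF e that]] by simp
  qed
qed

context compact_lck_product begin

text \<open>A kernel vector would pair to zero with its multiple by \<open>\<i>\<close>, against
  \<open>nondegenerate_\<Omega>\<close>.\<close>

lemma det_\<Omega>_nonzero:
  assumes c: "c \<in> atlas X" and d: "d \<in> atlas Y" and z: "z \<in> dom c d"
  shows "det (\<chi> a b. \<Omega> c d z (0, to_cvec (axis a 1)) (0, to_cvec (axis b 1))) \<noteq> 0"
proof
  let ?M = "\<chi> a b. \<Omega> c d z (0, to_cvec (axis a 1)) (0, to_cvec (axis b 1))"
  let ?B = "\<lambda>(x :: real \<times> (real, 'm bit0) vec) (y :: real \<times> (real, 'm bit0) vec). \<Omega> c d z (0, to_cvec (snd x)) (0, to_cvec (snd y))"
  have j: "linear (\<lambda>x :: real \<times> (real, 'm bit0) vec. (0, to_cvec (snd x)))"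
    using cvec_iso by (auto simp: linear_iff)
  have bil: "bilinear ?B"
    unfolding bilinear_def
  proof (intro conjI allI)
    fix v :: "real \<times> (real, 'm bit0) vec"
    have "linear (\<Omega> c d z (0, to_cvec (snd v)))" "linear (\<lambda>x. \<Omega> c d z x (0, to_cvec (snd v)))"
      using bilinear_\<Omega>[OF c d z] unfolding bilinear_def by blast+
    from linear_compose[OF j this(1)] linear_compose[OF j this(2)]
    show "linear (\<lambda>y. ?B v y)" "linear (\<lambda>x. ?B x v)" unfolding o_def .
  qed
  assume "det ?M = 0"
  then have "\<not> invertible ?M" by (simp add: invertible_det_nz)
  then obtain v where v: "?M *v v = 0" "v \<noteq> 0"
    by (metis invertible_left_inverse matrix_left_invertible_ker)
  have "to_cvec v \<noteq> 0" using v(2) by (metis bounded_linear.linear bounded_linear_of_cvec linear_0 of_to_cvec)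
  from nondegenerate_\<Omega>[OF c d z this]
  show False using bilinear_gram[OF bil, of "of_cvec (\<i> *s to_cvec v)" v] v(1) by simp
qed

text \<open>This legitimises the logarithm of the volume. All weights \<open>\<rho>\<close> are
  nonnegative, and at any point of \<open>Y\<close> one of them is positive, where the density is
  positive as well.\<close>

lemma fibre_volume_pos:
  assumes P: "finite P" "\<And>r. r \<in> P \<Longrightarrow> \<iota> r \<in> atlas Y" "\<And>r. r \<in> P \<Longrightarrow> compact (K r)"
      "\<And>r. r \<in> P \<Longrightarrow> K r \<subseteq> rim (\<iota> r)"
    and supp: "\<And>r q. r \<in> P \<Longrightarrow> q \<in> topspace (mtop Y) \<Longrightarrow> \<rho> r q \<noteq> 0 \<Longrightarrow> q \<in> fst (\<iota> r) \<and> of_cvec (snd (\<iota> r) q) \<in> K r"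
    and nonneg: "\<And>r q. r \<in> P \<Longrightarrow> q \<in> topspace (mtop Y) \<Longrightarrow> \<rho> r q \<ge> (0::real)"
    and one: "\<And>q. q \<in> topspace (mtop Y) \<Longrightarrow> (\<Sum>r\<in>P. \<rho> r q) = (1::real)"
    and C\<rho>: "\<And>r j. r \<in> P \<Longrightarrow> j \<in> atlas Y \<Longrightarrow> C1_on (rim j) (\<lambda>x. \<rho> r (chart_inv j (to_cvec x)))"
    and p: "p \<in> topspace (mtop X)" and \<phi>: "fibre_primitive p \<phi>"
  shows "fibre_volume P \<rho> \<iota> p \<phi> > 0"
proof -
  obtain c where c: "c \<in> atlas X" "p \<in> fst c" using p X unfolding complex_manifold_def by blast
  have pc: "snd c p \<in> chart_image c" by (rule chart_in[OF X c])
  let ?g = "\<lambda>r x. \<rho> r (chart_inv (\<iota> r) (to_cvec x)) * (exp (- real CARD('m) * \<phi> (chart_inv (\<iota> r) (to_cvec x))) * vol_density p (\<iota> r) x)"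
  let ?f = "\<lambda>r x. if x \<in> rim (\<iota> r) then ?g r x else 0"
  have inv_top: "chart_inv (\<iota> r) (to_cvec x) \<in> topspace (mtop Y)" if "r \<in> P" "x \<in> rim (\<iota> r)" for r x
    using chart_inv_in[OF Y P(2)[OF that(1)]] chart_sub[OF Y P(2)[OF that(1)]] that(2) unfolding rim_iff by blast
  have dens_pos: "vol_density p (\<iota> r) x > 0" if "r \<in> P" "x \<in> rim (\<iota> r)" for r x
    using det_\<Omega>_nonzero[OF c(1) P(2)[OF that(1)], of "(snd c p, to_cvec x)"] pc that(2)
    unfolding vol_density_eq[OF c P(2)[OF that(1)] that(2)] rim_iff by simp
  have off: "\<rho> r (chart_inv (\<iota> r) (to_cvec x)) = 0" if "r \<in> P" "x \<in> rim (\<iota> r)" "x \<notin> K r" for r x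
    using supp[OF that(1) inv_top[OF that(1,2)]] that(2,3) chart_chart_inv[OF Y P(2)[OF that(1)]]
    unfolding rim_iff by auto
  have g_nonneg: "?g r x \<ge> 0" if "r \<in> P" "x \<in> rim (\<iota> r)" for r x
    using nonneg[OF that(1) inv_top[OF that]] dens_pos[OF that] by simp
  have cont: "continuous_on UNIV (?f r)" if r: "r \<in> P" for r
  proof (rule continuous_on_ext0'[OF R.open_im[OF P(2)[OF r]] P(3)[OF r] _ _ P(4)[OF r]])
    have i: "\<iota> r \<in> atlas Y" using P(2)[OF r] .
    have "continuous_on (rim (\<iota> r)) (\<lambda>x. \<phi> (chart_inv (\<iota> r) (to_cvec x)))"
    proof (rule continuous_on_compose2[of "chart_image (\<iota> r)" "\<lambda>y. \<phi> (chart_inv (\<iota> r) y)"])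
      show "continuous_on (chart_image (\<iota> r)) (\<lambda>y. \<phi> (chart_inv (\<iota> r) y))"
      proof (intro continuous_at_imp_continuous_on ballI)
        fix y assume y: "y \<in> chart_image (\<iota> r)"
        show "isCont (\<lambda>y. \<phi> (chart_inv (\<iota> r) y)) y"
          by (rule has_derivative_continuous[OF bspec[OF bspec[OF mp[OF bspec[OF \<phi>[unfolded fibre_primitive_def] c(1)] c(2)] i] y]])
      qed
      show "continuous_on (rim (\<iota> r)) to_cvec" by (rule linear_continuous_on[OF bounded_linear_to_cvec])
      show "to_cvec ` rim (\<iota> r) \<subseteq> chart_image (\<iota> r)" by (rule image_subsetI) (simp only: rim_iff)
    qed
    moreover have "continuous_on (rim (\<iota> r)) (vol_density p (\<iota> r))"
    proof (rule continuous_on_eq)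
      have "C1_on (rim (\<iota> r)) (\<lambda>x. \<Omega> c (\<iota> r) (snd c p, to_cvec x) v w)" for v w
      proof (rule C1_on_compose[OF C1_\<Omega>[OF c(1) i] C1_on_Pair[OF C1_on_const C1_on_bounded_linear[OF bounded_linear_to_cvec]]], rule image_subsetI)
        fix x assume "x \<in> rim (\<iota> r)"
        then show "(snd c p, to_cvec x) \<in> dom c (\<iota> r)" using pc by (simp only: rim_iff mem_Sigma_iff)
      qed
      then have "C1_on (rim (\<iota> r)) (\<lambda>x. (\<chi> a b. \<Omega> c (\<iota> r) (snd c p, to_cvec x) (0, to_cvec (axis a 1)) (0, to_cvec (axis b 1))) $ i $ j)" for i j
        by simp
      then have "continuous_on (rim (\<iota> r)) (\<lambda>x. det (\<chi> a b. \<Omega> c (\<iota> r) (snd c p, to_cvec x) (0, to_cvec (axis a 1)) (0, to_cvec (axis b 1))))"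
        by (rule C1_on_continuous_on[OF C1_on_det])
      then show "continuous_on (rim (\<iota> r)) (\<lambda>x. sqrt \<bar>det (\<chi> a b. \<Omega> c (\<iota> r) (snd c p, to_cvec x) (0, to_cvec (axis a 1)) (0, to_cvec (axis b 1)))\<bar>)"
        by (intro continuous_on_real_sqrt continuous_on_rabs)
      show "sqrt \<bar>det (\<chi> a b. \<Omega> c (\<iota> r) (snd c p, to_cvec x) (0, to_cvec (axis a 1)) (0, to_cvec (axis b 1)))\<bar> = vol_density p (\<iota> r) x"
        if "x \<in> rim (\<iota> r)" for x by (rule vol_density_eq[OF c i that, symmetric])
    qed
    ultimately show "continuous_on (rim (\<iota> r)) (?g r)"
      by (intro continuous_on_mult continuous_on_exp continuous_on_const C1_on_continuous_on[OF C\<rho>[OF r i]])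
    show "?g r x = 0" if "x \<in> rim (\<iota> r)" "x \<notin> K r" for x using off[OF r that] by simp
  qed
  have f_nonneg: "?f r x \<ge> 0" if "r \<in> P" for r x using g_nonneg[OF that] by simp
  have f_off: "?f r x = 0" if "r \<in> P" "x \<notin> K r" for r x using off that by simp
  have bdd: "bounded (K r)" if "r \<in> P" for r using compact_imp_bounded[OF P(3)[OF that]] .
  obtain q where q: "q \<in> topspace (mtop Y)" using Y unfolding complex_manifold_def by blast
  have "\<exists>r\<in>P. \<rho> r q \<noteq> 0"
  proof (rule ccontr)
    assume "\<not> (\<exists>r\<in>P. \<rho> r q \<noteq> 0)"
    then have "(\<Sum>r\<in>P. \<rho> r q) = 0" by (intro sum.neutral) blast
    then show False using one[OF q] by simp
  qed
  then obtain r where r: "r \<in> P" "\<rho> r q > 0" using nonneg[OF _ q] by (metis less_eq_real_def)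
  have qi: "q \<in> fst (\<iota> r)" using supp[OF r(1) q] r(2) by simp
  have x: "of_cvec (snd (\<iota> r) q) \<in> rim (\<iota> r)" using qi by blast
  have pos: "?f r (of_cvec (snd (\<iota> r) q)) > 0"
    using x r(2) dens_pos[OF r(1) x] by (simp add: chart_inv_chart[OF Y P(2)[OF r(1)] qi])
  show ?thesis
    unfolding fibre_volume_def
  proof (rule sum_pos2[OF P(1) r(1)])
    show "0 < integral UNIV (?f r)"
      by (rule integral_pos_continuous[OF cont[OF r(1)] f_nonneg[OF r(1)] bdd[OF r(1)] f_off[OF r(1)] pos])
    show "0 \<le> integral UNIV (?f s)" if "s \<in> P" for s
      by (rule integral_nonneg[OF integrable_compact_support[OF cont[OF that] bdd[OF that] f_off[OF that]] f_nonneg[OF that]])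
  qed
qed

text \<open>The chosen primitives \<open>f p\<close> carry constants that depend arbitrarily on
  \<open>p\<close>. Adding \<open>s\<close> to one multiplies the volume by
  \<open>exp (- m s)\<close>, so \<open>f p + ln (V p (f p)) / m\<close> is free of the choice. It
  can therefore be computed from a primitive on a tube, along which the volume is constant.\<close>

lemma exact_of_fibre_primitive:
  assumes p0: "p0 \<in> topspace (mtop X)" and f0: "fibre_primitive p0 f0"
  shows "exact_one_form (prod_cmfd X Y) \<theta>"
proof -
  obtain P :: "(('b, 'm) chart \<times> (real, 'm bit0) vec \<times> real) set" and \<rho> \<iota> K where
    P: "finite P" "\<And>r. r \<in> P \<Longrightarrow> \<iota> r \<in> atlas Y" "\<And>r. r \<in> P \<Longrightarrow> compact (K r)"
      "\<And>r. r \<in> P \<Longrightarrow> K r \<subseteq> rim (\<iota> r)"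
    and supp: "\<And>r q. r \<in> P \<Longrightarrow> q \<in> topspace (mtop Y) \<Longrightarrow> \<rho> r q \<noteq> 0 \<Longrightarrow> q \<in> fst (\<iota> r) \<and> of_cvec (snd (\<iota> r) q) \<in> K r"
    and nonneg: "\<And>r q. r \<in> P \<Longrightarrow> q \<in> topspace (mtop Y) \<Longrightarrow> \<rho> r q \<ge> (0::real)"
    and one: "\<And>q. q \<in> topspace (mtop Y) \<Longrightarrow> (\<Sum>r\<in>P. \<rho> r q) = (1::real)"
    and C\<rho>: "\<And>r j. r \<in> P \<Longrightarrow> j \<in> atlas Y \<Longrightarrow> C1_on (rim j) (\<lambda>x. \<rho> r (chart_inv j (to_cvec x)))"
    by (rule R.partition_of_unity) blast
  let ?m = "real CARD('m)"
  define V where "V p \<phi> = fibre_volume P \<rho> \<iota> p \<phi>" for p \<phi>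
  have V_const: "V (chart_inv c x0) (f x0) = V (chart_inv c x1) (f x1)"
    if "c \<in> atlas X" "open B" "convex B" "B \<subseteq> chart_image c" "local_primitive c B f" "x0 \<in> B" "x1 \<in> B" for c B f x0 x1
    unfolding V_def by (rule fibre_volume_local_constant[OF P supp one C\<rho> that])
  have V_pos: "V p \<phi> > 0" if "p \<in> topspace (mtop X)" "fibre_primitive p \<phi>" for p \<phi>
    unfolding V_def by (rule fibre_volume_pos[OF P supp nonneg one C\<rho> that])
  define f where "f p = (SOME f. fibre_primitive p f)" for p
  have f: "fibre_primitive p (f p)" if "p \<in> topspace (mtop X)" for p
    unfolding f_def by (rule someI_ex[OF fibre_primitive_everywhere[OF p0 f0 that]])
  define F where "F = (\<lambda>(p, q). f p q + ln (V p (f p)) / ?m)"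
  show ?thesis
  proof (rule exact_one_formI[of F])
    fix c d z assume c: "c \<in> atlas X" and d: "d \<in> atlas Y" and z: "z \<in> dom c d"
    obtain x y where xy: "z = (x, y)" "x \<in> chart_image c" "y \<in> chart_image d" using z by blast
    obtain r where r: "r > 0" "ball x r \<subseteq> chart_image c"
      using chart_image_open[OF X c] xy(2) open_contains_ball by blast
    have xr: "x \<in> ball x r" using r by simp
    have top: "chart_inv c x' \<in> topspace (mtop X)" if "x' \<in> ball x r" for x'
      using chart_inv_in[OF X c] chart_sub[OF X c] r(2) that by blast
    obtain g where g: "local_primitive c (ball x r) g"
      using extend_primitive[OF c open_ball convex_ball r(2) xr f[OF top[OF xr]]] by blast
    have gx: "fibre_primitive (chart_inv c x') (g x')" if "x' \<in> ball x r" for x'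
      by (rule fibre_primitive_of_local[OF c r(2) g that])
    have Fg: "F (chart_inv c x', q) = g x' q + ln (V (chart_inv c x) (g x)) / ?m"
      if x': "x' \<in> ball x r" and q: "q \<in> topspace (mtop Y)" for x' q
    proof -
      \<comment> \<open>The discrepancy between the chosen primitive and that of the tube is
        constant on the slice, so its value at the single point \<open>q\<close> determines
        it.\<close>
      define s where "s = f (chart_inv c x') q - g x' q"
      have sh: "f (chart_inv c x') q' = g x' q' + s" if "q' \<in> topspace (mtop Y)" for q'
        using fibre_primitive_unique[OF top[OF x'] f[OF top[OF x']] gx[OF x'] that q] by (simp add: s_def)
      have "V (chart_inv c x') (f (chart_inv c x')) = exp (- ?m * s) * V (chart_inv c x') (g x')"
        unfolding V_def by (rule fibre_volume_shift[OF P(2) sh])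
      also have "V (chart_inv c x') (g x') = V (chart_inv c x) (g x)"
        by (rule V_const[OF c open_ball convex_ball r(2) g x' xr])
      finally have "ln (V (chart_inv c x') (f (chart_inv c x'))) = - ?m * s + ln (V (chart_inv c x) (g x))"
        using V_pos[OF top[OF xr] gx[OF xr]] by (simp add: ln_mult)
      then show ?thesis unfolding F_def by (simp add: s_def field_simps)
    qed
    have "((\<lambda>z. g (fst z) (chart_inv d (snd z)) + ln (V (chart_inv c x) (g x)) / ?m) has_derivative (\<lambda>v. \<Theta> c d z v + 0)) (at z)"
      using bspec[OF bspec[OF g[unfolded local_primitive_def] d], of z] xy r
      by (intro has_derivative_add has_derivative_const) auto
    then have "((\<lambda>z. g (fst z) (chart_inv d (snd z)) + ln (V (chart_inv c x) (g x)) / ?m) has_derivative \<Theta> c d z) (at z)" by simp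
    then show "((\<lambda>z. F (chart_inv c (fst z), chart_inv d (snd z))) has_derivative \<Theta> c d z) (at z)"
    proof (rule has_derivative_transform_within_open)
      show "open (ball x r \<times> chart_image d)" by (intro open_Times open_ball chart_image_open[OF Y d])
      show "z \<in> ball x r \<times> chart_image d" using xy r by simp
      fix z' assume z': "z' \<in> ball x r \<times> chart_image d"
      then have z1: "fst z' \<in> ball x r" and z2: "snd z' \<in> chart_image d" by (simp_all only: mem_Times_iff)
      from Fg[OF z1 subsetD[OF chart_sub[OF Y d] chart_inv_in[OF Y d z2]]]
      show "g (fst z') (chart_inv d (snd z')) + ln (V (chart_inv c x) (g x)) / ?m = F (chart_inv c (fst z'), chart_inv d (snd z'))"
        by (rule sym)
    qed
  qed
qed

end

section \<open>Integration over a sphere in the first factor\<close>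

lemma linear_apply_has_derivative:
  fixes \<alpha> :: "'e::euclidean_space \<Rightarrow> 'g::euclidean_space \<Rightarrow> real"
  assumes N: "open N" "z \<in> N" and lin: "\<And>y. y \<in> N \<Longrightarrow> linear (\<alpha> y)"
    and \<alpha>: "\<And>v. ((\<lambda>y. \<alpha> y v) has_derivative \<alpha>' v) (at z)" and w: "(w has_derivative w') (at z)"
  shows "((\<lambda>y. \<alpha> y (w y)) has_derivative (\<lambda>u. \<alpha>' (w z) u + \<alpha> z (w' u))) (at z)"
proof -
  have "((\<lambda>y. \<Sum>b\<in>Basis. (w z \<bullet> b) *\<^sub>R \<alpha> y b) has_derivative (\<lambda>u. \<Sum>b\<in>Basis. (w z \<bullet> b) *\<^sub>R \<alpha>' b u)) (at z)"
    by (intro has_derivative_sum has_derivative_scaleR_right \<alpha>)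
  then have "((\<lambda>y. \<alpha> y (w z)) has_derivative (\<lambda>u. \<Sum>b\<in>Basis. (w z \<bullet> b) *\<^sub>R \<alpha>' b u)) (at z)"
    by (rule has_derivative_transform_within_open[OF _ N]) (rule linear_basis_expansion[OF lin, symmetric])
  from has_derivative_unique[OF \<alpha> this] have 1: "\<alpha>' (w z) u = (\<Sum>b\<in>Basis. (w z \<bullet> b) *\<^sub>R \<alpha>' b u)" for u
    by (rule fun_cong)
  have wb: "((\<lambda>y. w y \<bullet> b) has_derivative (\<lambda>u. w' u \<bullet> b)) (at z)" for b
    by (rule bounded_linear.has_derivative[OF bounded_linear_inner_left w])
  have "((\<lambda>y. \<Sum>b\<in>Basis. (w y \<bullet> b) *\<^sub>R \<alpha> y b) has_derivative
     (\<lambda>u. \<Sum>b\<in>Basis. (w z \<bullet> b) *\<^sub>R \<alpha>' b u + (w' u \<bullet> b) *\<^sub>R \<alpha> z b)) (at z)"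
    by (intro has_derivative_sum has_derivative_scaleR wb \<alpha>)
  then have "((\<lambda>y. \<alpha> y (w y)) has_derivative
     (\<lambda>u. \<Sum>b\<in>Basis. (w z \<bullet> b) *\<^sub>R \<alpha>' b u + (w' u \<bullet> b) *\<^sub>R \<alpha> z b)) (at z)"
    by (rule has_derivative_transform_within_open[OF _ N]) (rule linear_basis_expansion[OF lin, symmetric])
  then show ?thesis
    unfolding sum.distrib 1[symmetric] linear_basis_expansion[OF lin[OF N(2)], of "w' _", symmetric] .
qed

text \<open>Abstract setting in which exterior differentiation commutes with pull-back: the terms
  with second derivatives of \<open>P\<close> cancel in the alternating sums by virtue of
  \<open>sym\<close>.\<close>

locale twice_differentiable_map =
  fixes P :: "'e::euclidean_space \<Rightarrow> 'g::euclidean_space" and DP :: "'e \<Rightarrow> 'e \<Rightarrow> 'g"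
    and D2 :: "'e \<Rightarrow> 'e \<Rightarrow> 'g" and N S z
  assumes N: "open N" "z \<in> N" and PS: "\<And>y. y \<in> N \<Longrightarrow> P y \<in> S"
    and P: "(P has_derivative DP z) (at z)" and D2: "\<And>v. ((\<lambda>y. DP y v) has_derivative D2 v) (at z)"
    and sym: "\<And>u v. D2 v u = D2 u v"
begin

lemma pullback_one_form_derivative:
  assumes lin: "\<And>y. y \<in> S \<Longrightarrow> linear (\<alpha> y)" and \<alpha>: "\<And>v. (\<lambda>y. \<alpha> y v) differentiable (at (P z))"
  shows "frechet_derivative (\<lambda>y. \<alpha> (P y) (DP y v) :: real) (at z) u
    = frechet_derivative (\<lambda>y. \<alpha> y (DP z v)) (at (P z)) (DP z u) + \<alpha> (P z) (D2 v u)"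
proof -
  have "((\<lambda>y. \<alpha> (P y) v) has_derivative (\<lambda>u. frechet_derivative (\<lambda>y. \<alpha> y v) (at (P z)) (DP z u))) (at z)" for v
    by (rule has_derivative_compose[OF P frechet_derivative_works[THEN iffD1, OF \<alpha>]])
  then have "((\<lambda>y. \<alpha> (P y) (DP y v)) has_derivative
     (\<lambda>u. frechet_derivative (\<lambda>y. \<alpha> y (DP z v)) (at (P z)) (DP z u) + \<alpha> (P z) (D2 v u))) (at z)"
    by (intro linear_apply_has_derivative[of N z "\<lambda>y. \<alpha> (P y)", OF N lin[OF PS] _ D2])
  from fun_cong[OF frechet_derivative_at[OF this], of u] show ?thesis by simp
qed

lemma pullback_lee_identity:
  assumes bil: "\<And>y. y \<in> S \<Longrightarrow> bilinear (\<Omega> y)" and \<Omega>: "\<And>v w. (\<lambda>y. \<Omega> y v w :: real) differentiable (at (P z))"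
    and anti: "\<And>v w. \<Omega> (P z) v w = - \<Omega> (P z) w v" and lee: "lee_identity_at \<Theta> \<Omega> (P z)"
  shows "lee_identity_at (\<lambda>y v. \<Theta> (P y) (DP y v)) (\<lambda>y v w. \<Omega> (P y) (DP y v) (DP y w)) z"
proof -
  have lin1: "linear (\<lambda>v. \<Omega> y v w)" and lin2: "linear (\<lambda>w. \<Omega> y v w)" if "y \<in> S" for y v w
    using bil[OF that] unfolding bilinear_def by blast+
  have \<Omega>P: "((\<lambda>y. \<Omega> (P y) v w) has_derivative (\<lambda>u. frechet_derivative (\<lambda>y. \<Omega> y v w) (at (P z)) (DP z u))) (at z)" for v w
    by (rule has_derivative_compose[OF P frechet_derivative_works[THEN iffD1, OF \<Omega>]])
  have 1: "((\<lambda>y. \<Omega> (P y) (DP y v) w) has_derivative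
     (\<lambda>u. frechet_derivative (\<lambda>y. \<Omega> y (DP z v) w) (at (P z)) (DP z u) + \<Omega> (P z) (D2 v u) w)) (at z)" for v w
    by (rule linear_apply_has_derivative[of N z "\<lambda>y v. \<Omega> (P y) v w", OF N lin1[OF PS] \<Omega>P D2])
  have 2: "((\<lambda>y. \<Omega> (P y) (DP y v) (DP y w)) has_derivative
     (\<lambda>u. frechet_derivative (\<lambda>y. \<Omega> y (DP z v) (DP z w)) (at (P z)) (DP z u) + \<Omega> (P z) (D2 v u) (DP z w)
       + \<Omega> (P z) (DP z v) (D2 w u))) (at z)" for v w
    by (rule linear_apply_has_derivative[of N z "\<lambda>y w. \<Omega> (P y) (DP y v) w", OF N lin2[OF PS] 1 D2])
  have fd: "frechet_derivative (\<lambda>y. \<Omega> (P y) (DP y v) (DP y w)) (at z) u =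
     frechet_derivative (\<lambda>y. \<Omega> y (DP z v) (DP z w)) (at (P z)) (DP z u) + \<Omega> (P z) (D2 v u) (DP z w)
       + \<Omega> (P z) (DP z v) (D2 w u)" for u v w
    using fun_cong[OF frechet_derivative_at[OF 2]] by simp
  show ?thesis
    unfolding lee_identity_at_def fd
  proof (intro allI)
    fix u v w
    have "\<Omega> (P z) (D2 v u) (DP z w) = \<Omega> (P z) (D2 u v) (DP z w)" by (simp add: sym[of v u])
    moreover have "\<Omega> (P z) (DP z v) (D2 w u) = - \<Omega> (P z) (D2 u w) (DP z v)" using anti[of "DP z v"] by (simp add: sym[of w u])
    moreover have "\<Omega> (P z) (DP z u) (D2 w v) = \<Omega> (P z) (DP z u) (D2 v w)" by (simp add: sym[of w v])
    ultimately show "frechet_derivative (\<lambda>y. \<Omega> y (DP z v) (DP z w)) (at (P z)) (DP z u) + \<Omega> (P z) (D2 v u) (DP z w)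
       + \<Omega> (P z) (DP z v) (D2 w u)
       - (frechet_derivative (\<lambda>y. \<Omega> y (DP z u) (DP z w)) (at (P z)) (DP z v) + \<Omega> (P z) (D2 u v) (DP z w)
       + \<Omega> (P z) (DP z u) (D2 w v))
       + (frechet_derivative (\<lambda>y. \<Omega> y (DP z u) (DP z v)) (at (P z)) (DP z w) + \<Omega> (P z) (D2 u w) (DP z v)
       + \<Omega> (P z) (DP z u) (D2 v w))
       = \<Theta> (P z) (DP z u) * \<Omega> (P z) (DP z v) (DP z w) - \<Theta> (P z) (DP z v) * \<Omega> (P z) (DP z u) (DP z w)
       + \<Theta> (P z) (DP z w) * \<Omega> (P z) (DP z u) (DP z v)"
      using lee[unfolded lee_identity_at_def, rule_format, of "DP z v" "DP z w" "DP z u"] by linarith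
  qed
qed

end

text \<open>\<open>\<sigma>\<close> is parametrised by the whole plane, so the pulled-back forms
  live on the plane times a chart of \<open>Y\<close>. Over convex pieces of the chart this is
  convex, and the Poincare lemma applies. Critical points are allowed, as polar coordinates have
  them at the poles.\<close>

locale surface_lck_product = lck_product X Y h \<theta>
  for X :: "('a, 'n::finite) cmfd" and Y :: "('b, 'm::finite) cmfd" and h \<theta> +
  fixes \<sigma> :: "real \<times> real \<Rightarrow> 'a"
  assumes \<sigma>_in: "\<And>x. \<sigma> x \<in> topspace (mtop X)"
    and \<sigma>_open: "\<And>U. openin (mtop X) U \<Longrightarrow> open (\<sigma> -` U)"
    and \<sigma>_C1: "\<And>c. c \<in> atlas X \<Longrightarrow> C1_on (\<sigma> -` fst c) (\<lambda>x. snd c (\<sigma> x))"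
    and \<sigma>_C2: "\<And>c v. c \<in> atlas X \<Longrightarrow> C1_on (\<sigma> -` fst c) (\<lambda>x. frechet_derivative (\<lambda>x. snd c (\<sigma> x)) (at x) v)"
    and \<sigma>_sym: "\<And>c x u v. c \<in> atlas X \<Longrightarrow> \<sigma> x \<in> fst c \<Longrightarrow>
      frechet_derivative (\<lambda>x. frechet_derivative (\<lambda>x. snd c (\<sigma> x)) (at x) v) (at x) u
      = frechet_derivative (\<lambda>x. frechet_derivative (\<lambda>x. snd c (\<sigma> x)) (at x) u) (at x) v"
begin

definition tangent :: "('a, 'n) chart \<Rightarrow> real \<times> real \<Rightarrow> real \<times> real \<Rightarrow> (complex, 'n) vec" where
  "tangent c x v = frechet_derivative (\<lambda>x. snd c (\<sigma> x)) (at x) v"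

definition chart_at :: "real \<times> real \<Rightarrow> ('a, 'n) chart" where
  "chart_at x = (SOME c. c \<in> atlas X \<and> \<sigma> x \<in> fst c)"

lemma chart_at: "chart_at x \<in> atlas X" "\<sigma> x \<in> fst (chart_at x)"
proof -
  have "\<exists>c. c \<in> atlas X \<and> \<sigma> x \<in> fst c" using \<sigma>_in[of x] X unfolding complex_manifold_def by blast
  from someI_ex[OF this] show "chart_at x \<in> atlas X" "\<sigma> x \<in> fst (chart_at x)" unfolding chart_at_def by blast+
qed

lemma \<sigma>_dom_open: "c \<in> atlas X \<Longrightarrow> open (\<sigma> -` fst c)"
  by (rule \<sigma>_open[OF chart_open[OF X]])

lemma tangent: "c \<in> atlas X \<Longrightarrow> \<sigma> x \<in> fst c \<Longrightarrow> ((\<lambda>x. snd c (\<sigma> x)) has_derivative tangent c x) (at x)"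
  unfolding tangent_def[abs_def] using C1_on_has_derivative[OF \<sigma>_C1, of c x] by simp

lemma tangent_linear: "c \<in> atlas X \<Longrightarrow> \<sigma> x \<in> fst c \<Longrightarrow> linear (tangent c x)"
  using tangent has_derivative_linear by blast

lemma tangent_transition:
  assumes "c \<in> atlas X" "c' \<in> atlas X" "\<sigma> x \<in> fst c \<inter> fst c'"
  shows "tangent c' x v = frechet_derivative (transition c c') (at (snd c (\<sigma> x))) (tangent c x v)"
proof -
  have t: "(transition c c' has_derivative frechet_derivative (transition c c') (at (snd c (\<sigma> x)))) (at (snd c (\<sigma> x)))"
    by (rule C1_on_has_derivative[OF transition_C1_on[OF X assms(1,2)]]) (rule imageI[OF assms(3)])
  have "\<sigma> x \<in> fst c" "\<sigma> x \<in> fst c'" using assms(3) by blast+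
  from has_derivative_compose[OF tangent[OF assms(1) this(1)] t]
  have "((\<lambda>x. snd c' (\<sigma> x)) has_derivative (\<lambda>v. frechet_derivative (transition c c') (at (snd c (\<sigma> x))) (tangent c x v))) (at x)"
    by (rule has_derivative_transform_within_open[OF _ \<sigma>_dom_open[OF assms(1)]])
      (use \<open>\<sigma> x \<in> fst c\<close> in \<open>simp_all add: transition_def chart_inv_chart[OF X assms(1)]\<close>)
  from fun_cong[OF has_derivative_unique[OF tangent[OF assms(2) \<open>\<sigma> x \<in> fst c'\<close>] this]] show ?thesis .
qed

definition lift :: "('a, 'n) chart \<Rightarrow> (real \<times> real) \<times> (complex, 'm) vec \<Rightarrow> (complex, 'n) vec \<times> (complex, 'm) vec" where
  "lift c z = (snd c (\<sigma> (fst z)), snd z)"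

definition Dlift :: "('a, 'n) chart \<Rightarrow> (real \<times> real) \<times> (complex, 'm) vec \<Rightarrow> (real \<times> real) \<times> (complex, 'm) vec
    \<Rightarrow> (complex, 'n) vec \<times> (complex, 'm) vec" where
  "Dlift c z v = (tangent c (fst z) (fst v), snd v)"

text \<open>The image of \<open>\<sigma>\<close> may meet many charts of \<open>X\<close>, so one is
  picked at each point. By \<open>pulled_back_eq\<close> the value does not depend on the pick, and
  a fixed chart describes the form near each point.\<close>

definition \<Theta>\<sigma> :: "('b, 'm) chart \<Rightarrow> (real \<times> real) \<times> (complex, 'm) vec \<Rightarrow> (real \<times> real) \<times> (complex, 'm) vec \<Rightarrow> real" where
  "\<Theta>\<sigma> d z v = (let c = chart_at (fst z) in \<Theta> c d (lift c z) (Dlift c z v))"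

definition \<Omega>\<sigma> :: "('b, 'm) chart \<Rightarrow> (real \<times> real) \<times> (complex, 'm) vec \<Rightarrow> (real \<times> real) \<times> (complex, 'm) vec
    \<Rightarrow> (real \<times> real) \<times> (complex, 'm) vec \<Rightarrow> real" where
  "\<Omega>\<sigma> d z v w = (let c = chart_at (fst z) in \<Omega> c d (lift c z) (Dlift c z v) (Dlift c z w))"

lemma lift_in: "c \<in> atlas X \<Longrightarrow> \<sigma> (fst z) \<in> fst c \<Longrightarrow> snd z \<in> chart_image d \<Longrightarrow> lift c z \<in> dom c d"
  unfolding lift_def using chart_in[OF X] by simp

text \<open>One formula for a simultaneous change of charts on both factors: with
  \<open>d = d'\<close> it yields independence of the chart of \<open>X\<close>, on vectors tangent
  to the sphere independence of the chart of \<open>Y\<close>.\<close>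

lemma pulled_back_change_chart:
  assumes c: "c \<in> atlas X" "\<sigma> x \<in> fst c" and d: "d \<in> atlas Y" "d' \<in> atlas Y" and q: "q \<in> fst d \<inter> fst d'"
  shows "\<Theta>\<sigma> d (x, snd d q) v = \<Theta> c d' (lift c (x, snd d' q)) (tangent c x (fst v), frechet_derivative (transition d d') (at (snd d q)) (snd v))"
    and "\<Omega>\<sigma> d (x, snd d q) v w = \<Omega> c d' (lift c (x, snd d' q)) (tangent c x (fst v), frechet_derivative (transition d d') (at (snd d q)) (snd v))
      (tangent c x (fst w), frechet_derivative (transition d d') (at (snd d q)) (snd w))"
proof -
  have p: "\<sigma> x \<in> fst (chart_at x) \<inter> fst c" using chart_at(2) c(2) by blast
  note t = tangent_transition[OF chart_at(1) c(1) p, symmetric]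
  show "\<Theta>\<sigma> d (x, snd d q) v = \<Theta> c d' (lift c (x, snd d' q)) (tangent c x (fst v), frechet_derivative (transition d d') (at (snd d q)) (snd v))"
    using \<Theta>_transition[OF chart_at(1) c(1) d p q] by (simp add: \<Theta>\<sigma>_def Let_def lift_def Dlift_def t)
  show "\<Omega>\<sigma> d (x, snd d q) v w = \<Omega> c d' (lift c (x, snd d' q)) (tangent c x (fst v), frechet_derivative (transition d d') (at (snd d q)) (snd v))
      (tangent c x (fst w), frechet_derivative (transition d d') (at (snd d q)) (snd w))"
    using \<Omega>_transition[OF chart_at(1) c(1) d p q] by (simp add: \<Omega>\<sigma>_def Let_def lift_def Dlift_def t)
qed

lemma pulled_back_eq:
  assumes c: "c \<in> atlas X" "\<sigma> (fst z) \<in> fst c" and d: "d \<in> atlas Y" and y: "snd z \<in> chart_image d"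
  shows "\<Theta>\<sigma> d z v = \<Theta> c d (lift c z) (Dlift c z v)" and "\<Omega>\<sigma> d z v w = \<Omega> c d (lift c z) (Dlift c z v) (Dlift c z w)"
proof -
  let ?q = "chart_inv d (snd z)"
  have q: "?q \<in> fst d \<inter> fst d" and e: "(fst z, snd d ?q) = z"
    using chart_inv_in[OF Y d y] chart_chart_inv[OF Y d y] by simp_all
  have s: "frechet_derivative (transition d d) (at (snd d ?q)) = (\<lambda>v. v)"
    by (rule transition_self[OF Y d]) (use q in blast)
  show "\<Theta>\<sigma> d z v = \<Theta> c d (lift c z) (Dlift c z v)"
    using pulled_back_change_chart(1)[OF c d d q, of v] by (simp only: s e Dlift_def)
  show "\<Omega>\<sigma> d z v w = \<Omega> c d (lift c z) (Dlift c z v) (Dlift c z w)"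
    using pulled_back_change_chart(2)[OF c d d q, of v w] by (simp only: s e Dlift_def)
qed

context
  fixes c d x
  assumes c: "c \<in> atlas X" "\<sigma> x \<in> fst c" and d: "d \<in> atlas Y"
begin

abbreviation (input) "nbhd \<equiv> (\<sigma> -` fst c) \<times> chart_image d"

lemma nbhd_open: "open nbhd"
  by (intro open_Times \<sigma>_dom_open[OF c(1)] chart_image_open[OF Y d])

lemma C1_lift: "C1_on nbhd (lift c)"
  unfolding lift_def[abs_def]
  by (rule C1_on_Pair[OF C1_on_compose[OF \<sigma>_C1[OF c(1)] C1_on_fst] C1_on_snd]) auto

lemma C1_Dlift: "C1_on nbhd (\<lambda>z. Dlift c z v)"
  unfolding Dlift_def tangent_def
  by (rule C1_on_Pair[OF C1_on_compose[OF \<sigma>_C2[OF c(1)] C1_on_fst] C1_on_const]) auto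

lemma lift_has_derivative:
  assumes "z \<in> nbhd" shows "(lift c has_derivative Dlift c z) (at z)"
proof -
  have "\<sigma> (fst z) \<in> fst c" using assms by auto
  from has_derivative_compose[OF has_derivative_fst[OF has_derivative_ident] tangent[OF c(1) this]]
  show ?thesis unfolding lift_def[abs_def] Dlift_def[abs_def]
    by (rule has_derivative_Pair[OF _ has_derivative_snd[OF has_derivative_ident]])
qed

lemma twice: 
  assumes z: "z \<in> nbhd"
  shows "twice_differentiable_map (lift c) (Dlift c)
    (\<lambda>v. frechet_derivative (\<lambda>z. Dlift c z v) (at z)) nbhd (dom c d) z"
proof
  show "open nbhd" by (rule nbhd_open)
  show "z \<in> nbhd" by (rule z)
  show "lift c y \<in> dom c d" if "y \<in> nbhd" for y using lift_in[OF c(1), of y d] that by auto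
  show "(lift c has_derivative Dlift c z) (at z)" by (rule lift_has_derivative[OF z])
  show "((\<lambda>y. Dlift c y v) has_derivative frechet_derivative (\<lambda>z. Dlift c z v) (at z)) (at z)" for v
    by (rule C1_on_has_derivative[OF C1_Dlift z])
  have zc: "\<sigma> (fst z) \<in> fst c" using z by auto
  have D: "frechet_derivative (\<lambda>z. Dlift c z v) (at z) u =
     (frechet_derivative (\<lambda>x. frechet_derivative (\<lambda>x. snd c (\<sigma> x)) (at x) (fst v)) (at (fst z)) (fst u), 0)" for u v
  proof -
    have "((\<lambda>x. frechet_derivative (\<lambda>x. snd c (\<sigma> x)) (at x) (fst v)) has_derivative
       frechet_derivative (\<lambda>x. frechet_derivative (\<lambda>x. snd c (\<sigma> x)) (at x) (fst v)) (at (fst z))) (at (fst z))"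
      by (rule C1_on_has_derivative[OF \<sigma>_C2[OF c(1)]]) (use zc in simp)
    from has_derivative_Pair[OF has_derivative_compose[OF has_derivative_fst[OF has_derivative_ident] this] has_derivative_const]
    have "((\<lambda>z. Dlift c z v) has_derivative (\<lambda>u. (frechet_derivative (\<lambda>x. frechet_derivative (\<lambda>x. snd c (\<sigma> x)) (at x) (fst v)) (at (fst z)) (fst u), 0))) (at z)"
      unfolding Dlift_def tangent_def .
    then show ?thesis by (simp add: frechet_derivative_at[symmetric])
  qed
  show "frechet_derivative (\<lambda>z. Dlift c z v) (at z) u = frechet_derivative (\<lambda>z. Dlift c z u) (at z) v" for u v
    unfolding D by (simp add: \<sigma>_sym[OF c(1) zc, of "fst v" "fst u"])
qed

lemma C1_pullback_1: "C1_on nbhd (\<lambda>z. \<Theta> c d (lift c z) (Dlift c z v))"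
proof (rule C1_on_linear_apply[OF nbhd_open _ _ C1_Dlift])
  show "linear (\<Theta> c d (lift c z))" if "z \<in> nbhd" for z
    using linear_\<Theta>[OF c(1) d lift_in[OF c(1)]] that by auto
  show "C1_on nbhd (\<lambda>z. \<Theta> c d (lift c z) v)" for v
    by (rule C1_on_compose[OF C1_\<Theta>[OF c(1) d] C1_lift], rule image_subsetI, rule lift_in[OF c(1)]) auto
qed

lemma C1_pullback_2: "C1_on nbhd (\<lambda>z. \<Omega> c d (lift c z) (Dlift c z v) (Dlift c z w))"
proof (rule C1_on_bilinear_apply[OF nbhd_open _ _ C1_Dlift C1_Dlift])
  show "bilinear (\<Omega> c d (lift c z))" if "z \<in> nbhd" for z
    using bilinear_\<Omega>[OF c(1) d lift_in[OF c(1)]] that by auto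
  show "C1_on nbhd (\<lambda>z. \<Omega> c d (lift c z) v w)" for v w
    by (rule C1_on_compose[OF C1_\<Omega>[OF c(1) d] C1_lift], rule image_subsetI, rule lift_in[OF c(1)]) auto
qed

lemma pulled_back_on_nbhd:
  assumes "z \<in> nbhd"
  shows "\<Theta>\<sigma> d z v = \<Theta> c d (lift c z) (Dlift c z v)" "\<Omega>\<sigma> d z v w = \<Omega> c d (lift c z) (Dlift c z v) (Dlift c z w)"
proof -
  have "\<sigma> (fst z) \<in> fst c" "snd z \<in> chart_image d" using assms by auto
  from pulled_back_eq[OF c(1) this(1) d this(2)]
  show "\<Theta>\<sigma> d z v = \<Theta> c d (lift c z) (Dlift c z v)" "\<Omega>\<sigma> d z v w = \<Omega> c d (lift c z) (Dlift c z v) (Dlift c z w)" .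
qed

lemma frechet_pulled_back:
  assumes z: "z \<in> nbhd"
  shows "frechet_derivative (\<lambda>z. \<Theta>\<sigma> d z v) (at z) = frechet_derivative (\<lambda>z. \<Theta> c d (lift c z) (Dlift c z v)) (at z)"
    and "frechet_derivative (\<lambda>z. \<Omega>\<sigma> d z v w) (at z) = frechet_derivative (\<lambda>z. \<Omega> c d (lift c z) (Dlift c z v) (Dlift c z w)) (at z)"
proof -
  have "((\<lambda>z. \<Theta>\<sigma> d z v) has_derivative frechet_derivative (\<lambda>z. \<Theta> c d (lift c z) (Dlift c z v)) (at z)) (at z)"
    by (rule has_derivative_transform_within_open[OF C1_on_has_derivative[OF C1_pullback_1 z] nbhd_open z])
      (rule pulled_back_on_nbhd(1)[symmetric])
  then show "frechet_derivative (\<lambda>z. \<Theta>\<sigma> d z v) (at z) = frechet_derivative (\<lambda>z. \<Theta> c d (lift c z) (Dlift c z v)) (at z)"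
    by (rule frechet_derivative_at[symmetric])
  have "((\<lambda>z. \<Omega>\<sigma> d z v w) has_derivative frechet_derivative (\<lambda>z. \<Omega> c d (lift c z) (Dlift c z v) (Dlift c z w)) (at z)) (at z)"
    by (rule has_derivative_transform_within_open[OF C1_on_has_derivative[OF C1_pullback_2 z] nbhd_open z])
      (rule pulled_back_on_nbhd(2)[symmetric])
  then show "frechet_derivative (\<lambda>z. \<Omega>\<sigma> d z v w) (at z) = frechet_derivative (\<lambda>z. \<Omega> c d (lift c z) (Dlift c z v) (Dlift c z w)) (at z)"
    by (rule frechet_derivative_at[symmetric])
qed

end

lemma in_nbhd: "z \<in> UNIV \<times> chart_image d \<Longrightarrow> z \<in> (\<sigma> -` fst (chart_at (fst z))) \<times> chart_image d"
  using chart_at(2) by auto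

lemma C1_\<Theta>\<sigma>: "d \<in> atlas Y \<Longrightarrow> C1_on (UNIV \<times> chart_image d) (\<lambda>z. \<Theta>\<sigma> d z v)"
proof (rule C1_on_local)
  fix z :: "(real \<times> real) \<times> (complex, 'm) vec" assume d: "d \<in> atlas Y" and z: "z \<in> UNIV \<times> chart_image d"
  let ?c = "chart_at (fst z)"
  note c = chart_at[of "fst z"]
  show "\<exists>N g. open N \<and> z \<in> N \<and> C1_on N g \<and> (\<forall>y\<in>N. \<Theta>\<sigma> d y v = g y)"
    by (rule exI[of _ "(\<sigma> -` fst ?c) \<times> chart_image d"], rule exI[of _ "\<lambda>z. \<Theta> ?c d (lift ?c z) (Dlift ?c z v)"],
      intro conjI ballI nbhd_open[OF c d] in_nbhd[OF z] C1_pullback_1[OF c d] pulled_back_on_nbhd(1)[OF c d])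
qed

lemma C1_\<Omega>\<sigma>: "d \<in> atlas Y \<Longrightarrow> C1_on (UNIV \<times> chart_image d) (\<lambda>z. \<Omega>\<sigma> d z v w)"
proof (rule C1_on_local)
  fix z :: "(real \<times> real) \<times> (complex, 'm) vec" assume d: "d \<in> atlas Y" and z: "z \<in> UNIV \<times> chart_image d"
  let ?c = "chart_at (fst z)"
  note c = chart_at[of "fst z"]
  show "\<exists>N g. open N \<and> z \<in> N \<and> C1_on N g \<and> (\<forall>y\<in>N. \<Omega>\<sigma> d y v w = g y)"
    by (rule exI[of _ "(\<sigma> -` fst ?c) \<times> chart_image d"], rule exI[of _ "\<lambda>z. \<Omega> ?c d (lift ?c z) (Dlift ?c z v) (Dlift ?c z w)"],
      intro conjI ballI nbhd_open[OF c d] in_nbhd[OF z] C1_pullback_2[OF c d] pulled_back_on_nbhd(2)[OF c d])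
qed

lemma Dlift_linear: "c \<in> atlas X \<Longrightarrow> \<sigma> (fst z) \<in> fst c \<Longrightarrow> linear (Dlift c z)"
  unfolding Dlift_def[abs_def]
  by (rule linearI) (simp_all add: linear_add[OF tangent_linear] linear_cmul[OF tangent_linear])

lemma linear_\<Theta>\<sigma>: "d \<in> atlas Y \<Longrightarrow> z \<in> UNIV \<times> chart_image d \<Longrightarrow> linear (\<Theta>\<sigma> d z)"
proof -
  assume d: "d \<in> atlas Y" and z: "z \<in> UNIV \<times> chart_image d"
  have "snd z \<in> chart_image d" using z by auto
  from linear_compose[OF Dlift_linear[OF chart_at] linear_\<Theta>[OF chart_at(1) d lift_in[OF chart_at this]]]
  show ?thesis unfolding \<Theta>\<sigma>_def[abs_def] Let_def o_def .
qed

lemma closed_\<Theta>\<sigma>: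
  assumes d: "d \<in> atlas Y" and z: "z \<in> UNIV \<times> chart_image d"
  shows "frechet_derivative (\<lambda>z. \<Theta>\<sigma> d z v) (at z) u = frechet_derivative (\<lambda>z. \<Theta>\<sigma> d z u) (at z) v"
proof -
  let ?c = "chart_at (fst z)"
  note c = chart_at[of "fst z"]
  interpret twice_differentiable_map "lift ?c" "Dlift ?c" "\<lambda>v. frechet_derivative (\<lambda>z. Dlift ?c z v) (at z)"
    "(\<sigma> -` fst ?c) \<times> chart_image d" "dom ?c d" z
    by (rule twice[OF c d in_nbhd[OF z]])
  have Pz: "lift ?c z \<in> dom ?c d" by (rule PS[OF N(2)])
  have pb: "frechet_derivative (\<lambda>y. \<Theta> ?c d (lift ?c y) (Dlift ?c y v)) (at z) u
    = frechet_derivative (\<lambda>y. \<Theta> ?c d y (Dlift ?c z v)) (at (lift ?c z)) (Dlift ?c z u)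
      + \<Theta> ?c d (lift ?c z) (frechet_derivative (\<lambda>z. Dlift ?c z v) (at z) u)" for u v
    by (rule pullback_one_form_derivative[OF linear_\<Theta>[OF c(1) d] C1_on_differentiable[OF C1_\<Theta>[OF c(1) d] Pz]])
  show ?thesis unfolding frechet_pulled_back(1)[OF c d in_nbhd[OF z]] pb
    using closed_\<Theta>[OF c(1) d Pz, of "Dlift ?c z v" "Dlift ?c z u"] sym[of v u] by simp
qed

lemma lee_\<Omega>\<sigma>:
  assumes d: "d \<in> atlas Y" and z: "z \<in> UNIV \<times> chart_image d"
  shows "lee_identity_at (\<Theta>\<sigma> d) (\<Omega>\<sigma> d) z"
proof -
  let ?c = "chart_at (fst z)"
  note c = chart_at[of "fst z"]
  interpret twice_differentiable_map "lift ?c" "Dlift ?c" "\<lambda>v. frechet_derivative (\<lambda>z. Dlift ?c z v) (at z)"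
    "(\<sigma> -` fst ?c) \<times> chart_image d" "dom ?c d" z
    by (rule twice[OF c d in_nbhd[OF z]])
  have Pz: "lift ?c z \<in> dom ?c d" by (rule PS[OF N(2)])
  have "lee_identity_at (\<lambda>y v. \<Theta> ?c d (lift ?c y) (Dlift ?c y v)) (\<lambda>y v w. \<Omega> ?c d (lift ?c y) (Dlift ?c y v) (Dlift ?c y w)) z"
    by (rule pullback_lee_identity[OF bilinear_\<Omega>[OF c(1) d] C1_on_differentiable[OF C1_\<Omega>[OF c(1) d] Pz]
        \<Omega>_hermitian(1)[OF c(1) d Pz] lee_\<Omega>[OF c(1) d Pz]])
  then show ?thesis
    unfolding lee_identity_at_def frechet_pulled_back(2)[OF c d in_nbhd[OF z]]
      pulled_back_on_nbhd[OF c d in_nbhd[OF z]] .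
qed

end

section \<open>Spheres in polar coordinates\<close>

lemma mem_rectangle:
  fixes a b c d :: real
  shows "(s, \<phi>) \<in> cbox (a, c) (b, d) \<longleftrightarrow> a \<le> s \<and> s \<le> b \<and> c \<le> \<phi> \<and> \<phi> \<le> d"
    and "(s, \<phi>) \<in> box (a, c) (b, d) \<longleftrightarrow> a < s \<and> s < b \<and> c < \<phi> \<and> \<phi> < d"
  by (auto simp: mem_box Basis_prod_def)

text \<open>Green's theorem on a rectangle, one term at a time: Fubini and the fundamental theorem
  of calculus in the differentiated variable.\<close>

lemma integral_rectangle_partial_derivative:
  fixes g :: "real \<times> real \<Rightarrow> real"
  assumes g: "C1_on UNIV g" and ab: "a \<le> b" "c \<le> d"
  shows "integral (cbox (a, c) (b, d)) (\<lambda>x. frechet_derivative g (at x) (1, 0)) = integral (cbox c d) (\<lambda>\<phi>. g (b, \<phi>) - g (a, \<phi>))"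
    and "integral (cbox (a, c) (b, d)) (\<lambda>x. frechet_derivative g (at x) (0, 1)) = integral (cbox a b) (\<lambda>s. g (s, d) - g (s, c))"
proof -
  have cont: "continuous_on S (\<lambda>x. frechet_derivative g (at x) v)" for S v
    by (rule continuous_on_subset[OF C1_on_continuous_derivative[OF g] subset_UNIV])
  have gd: "(g has_derivative frechet_derivative g (at x)) (at x)" for x by (rule C1_on_has_derivative[OF g UNIV_I])
  have lin: "linear (frechet_derivative g (at x))" for x using gd has_derivative_linear by blast
  have d1: "((\<lambda>s. g (s, \<phi>)) has_vector_derivative frechet_derivative g (at (s, \<phi>)) (1, 0)) (at s within A)" for s \<phi> A
  proof -
    have "((\<lambda>s. g (s, \<phi>)) has_derivative (\<lambda>h. frechet_derivative g (at (s, \<phi>)) (h, 0))) (at s)"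
      by (rule has_derivative_slice_fst[OF gd])
    moreover have "(\<lambda>h. frechet_derivative g (at (s, \<phi>)) (h, 0)) = (\<lambda>h. h *\<^sub>R frechet_derivative g (at (s, \<phi>)) (1, 0))"
    proof
      fix h :: real
      show "frechet_derivative g (at (s, \<phi>)) (h, 0) = h *\<^sub>R frechet_derivative g (at (s, \<phi>)) (1, 0)"
        using linear_cmul[OF lin, of "(s, \<phi>)" h "(1, 0)"] by simp
    qed
    ultimately have "((\<lambda>s. g (s, \<phi>)) has_derivative (\<lambda>h. h *\<^sub>R frechet_derivative g (at (s, \<phi>)) (1, 0))) (at s)"
      by (rule back_subst[of "\<lambda>D. ((\<lambda>s. g (s, \<phi>)) has_derivative D) (at s)"])
    then show ?thesis unfolding has_vector_derivative_def by (rule has_derivative_at_withinI)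
  qed
  have d2: "((\<lambda>\<phi>. g (s, \<phi>)) has_vector_derivative frechet_derivative g (at (s, \<phi>)) (0, 1)) (at \<phi> within A)" for s \<phi> A
  proof -
    have "((\<lambda>\<phi>. g (s, \<phi>)) has_derivative (\<lambda>h. frechet_derivative g (at (s, \<phi>)) (0, h))) (at \<phi>)"
      by (rule has_derivative_slice_snd[OF gd])
    moreover have "(\<lambda>h. frechet_derivative g (at (s, \<phi>)) (0, h)) = (\<lambda>h. h *\<^sub>R frechet_derivative g (at (s, \<phi>)) (0, 1))"
    proof
      fix h :: real
      show "frechet_derivative g (at (s, \<phi>)) (0, h) = h *\<^sub>R frechet_derivative g (at (s, \<phi>)) (0, 1)"
        using linear_cmul[OF lin, of "(s, \<phi>)" h "(0, 1)"] by simp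
    qed
    ultimately have "((\<lambda>\<phi>. g (s, \<phi>)) has_derivative (\<lambda>h. h *\<^sub>R frechet_derivative g (at (s, \<phi>)) (0, 1))) (at \<phi>)"
      by (rule back_subst[of "\<lambda>D. ((\<lambda>\<phi>. g (s, \<phi>)) has_derivative D) (at \<phi>)"])
    then show ?thesis unfolding has_vector_derivative_def by (rule has_derivative_at_withinI)
  qed
  have i1: "integral (cbox a b) (\<lambda>s. frechet_derivative g (at (s, \<phi>)) (1, 0)) = g (b, \<phi>) - g (a, \<phi>)" for \<phi>
    unfolding cbox_interval by (rule integral_unique[OF fundamental_theorem_of_calculus[OF ab(1) d1]])
  have i2: "integral (cbox c d) (\<lambda>\<phi>. frechet_derivative g (at (s, \<phi>)) (0, 1)) = g (s, d) - g (s, c)" for s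
    unfolding cbox_interval by (rule integral_unique[OF fundamental_theorem_of_calculus[OF ab(2) d2]])
  have p: "integral (cbox (a, c) (b, d)) (\<lambda>x. frechet_derivative g (at x) v)
     = integral (cbox a b) (\<lambda>s. integral (cbox c d) (\<lambda>\<phi>. frechet_derivative g (at (s, \<phi>)) v))" for v
    by (rule integral_prod_continuous[OF cont])
  show "integral (cbox (a, c) (b, d)) (\<lambda>x. frechet_derivative g (at x) (0, 1)) = integral (cbox a b) (\<lambda>s. g (s, d) - g (s, c))"
    unfolding p i2 ..
  have "continuous_on (cbox (a, c) (b, d)) (\<lambda>(s, \<phi>). frechet_derivative g (at (s, \<phi>)) (1, 0))"
    unfolding case_prod_beta prod.collapse by (rule cont)
  from integral_swap_continuous[OF this]
  show "integral (cbox (a, c) (b, d)) (\<lambda>x. frechet_derivative g (at x) (1, 0)) = integral (cbox c d) (\<lambda>\<phi>. g (b, \<phi>) - g (a, \<phi>))"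
    unfolding p i1 .
qed

text \<open>\<open>\<sigma>\<close> parametrises a holomorphic sphere by polar coordinates: \<open>\<sigma> (s, \<phi>)\<close> is the image of
  \<open>tan s \<sqdot> exp (\<i> \<phi>)\<close>, so that \<open>\<partial>\<^sub>\<phi>\<close> is \<open>sin s cos s\<close> times the rotated vector \<open>\<i> \<partial>\<^sub>s\<close>.\<close>

locale sphere_lck_product = surface_lck_product X Y h \<theta> \<sigma>
  for X :: "('a, 'n::finite) cmfd" and Y :: "('b, 'm::finite) cmfd" and h \<theta> \<sigma> +
  assumes periodic: "\<And>s \<phi>. \<sigma> (s, \<phi> + 2 * pi) = \<sigma> (s, \<phi>)"
    and rotated: "\<And>c s \<phi>. c \<in> atlas X \<Longrightarrow> \<sigma> (s, \<phi>) \<in> fst c \<Longrightarrow>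
      frechet_derivative (\<lambda>x. snd c (\<sigma> x)) (at (s, \<phi>)) (0, 1)
      = (sin s * cos s) *\<^sub>R (\<i> *s frechet_derivative (\<lambda>x. snd c (\<sigma> x)) (at (s, \<phi>)) (1, 0))"
    and nonconstant: "\<not> \<sigma> constant_on (box (0, 0) (pi / 2, 2 * pi))"
begin

abbreviation "rect \<equiv> cbox (0, 0) (pi / 2, 2 * pi) :: (real \<times> real) set"

abbreviation "e\<^sub>1 \<equiv> ((1, 0), 0) :: (real \<times> real) \<times> (complex, 'm) vec"

abbreviation "e\<^sub>2 \<equiv> ((0, 1), 0) :: (real \<times> real) \<times> (complex, 'm) vec"

lemma tangent_rotated: "c \<in> atlas X \<Longrightarrow> \<sigma> (s, \<phi>) \<in> fst c \<Longrightarrow>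
    tangent c (s, \<phi>) (0, 1) = (sin s * cos s) *\<^sub>R (\<i> *s tangent c (s, \<phi>) (1, 0))"
  unfolding tangent_def by (rule rotated)

lemma tangent_periodic:
  assumes "c \<in> atlas X" "\<sigma> (s, \<phi>) \<in> fst c"
  shows "tangent c (s, \<phi> + 2 * pi) = tangent c (s, \<phi>)"
proof -
  have sh: "((\<lambda>x :: real \<times> real. x + (0, 2 * pi)) has_derivative (\<lambda>v. v)) (at (s, \<phi>))"
    using has_derivative_add[OF has_derivative_ident has_derivative_const] by fastforce
  have "\<sigma> ((s, \<phi>) + (0, 2 * pi)) \<in> fst c" using assms(2) periodic by simp
  from has_derivative_compose[OF sh tangent[OF assms(1) this]]
  have "((\<lambda>x. snd c (\<sigma> (x + (0, 2 * pi)))) has_derivative tangent c ((s, \<phi>) + (0, 2 * pi))) (at (s, \<phi>))" .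
  moreover have "\<sigma> (x + (0, 2 * pi)) = \<sigma> x" for x using periodic[of "fst x" "snd x"] by (cases x) simp
  ultimately have "((\<lambda>x. snd c (\<sigma> x)) has_derivative tangent c ((s, \<phi>) + (0, 2 * pi))) (at (s, \<phi>))" by simp
  from has_derivative_unique[OF this tangent[OF assms]] show ?thesis by simp
qed

text \<open>\<open>\<sigma>\<close> and its tangent map agree at the angles \<open>0\<close> and
  \<open>2 * pi\<close>, so one chart of \<open>X\<close> serves at both ends.\<close>

lemma pulled_back_periodic:
  assumes d: "d \<in> atlas Y" and y: "y \<in> chart_image d"
  shows "\<Theta>\<sigma> d ((s, 2 * pi), y) v = \<Theta>\<sigma> d ((s, 0), y) v"
    and "\<Omega>\<sigma> d ((s, 2 * pi), y) v w = \<Omega>\<sigma> d ((s, 0), y) v w"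
proof -
  let ?c = "chart_at (s, 0)"
  note c = chart_at[of "(s, 0)"]
  have p: "\<sigma> (s, 2 * pi) = \<sigma> (s, 0)" using periodic[of s 0] by simp
  have t: "tangent ?c (s, 2 * pi) = tangent ?c (s, 0)" using tangent_periodic[OF c] by simp
  have c2: "\<sigma> (fst ((s, 2 * pi), y)) \<in> fst ?c" "\<sigma> (fst ((s, 0), y)) \<in> fst ?c" using c(2) p by simp_all
  have y2: "snd ((s, 2 * pi), y) \<in> chart_image d" "snd ((s, 0), y) \<in> chart_image d" using y by simp_all
  show "\<Theta>\<sigma> d ((s, 2 * pi), y) v = \<Theta>\<sigma> d ((s, 0), y) v"
    unfolding pulled_back_eq(1)[OF c(1) c2(1) d y2(1)] pulled_back_eq(1)[OF c(1) c2(2) d y2(2)]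
    by (simp add: lift_def Dlift_def p t)
  show "\<Omega>\<sigma> d ((s, 2 * pi), y) v w = \<Omega>\<sigma> d ((s, 0), y) v w"
    unfolding pulled_back_eq(2)[OF c(1) c2(1) d y2(1)] pulled_back_eq(2)[OF c(1) c2(2) d y2(2)]
    by (simp add: lift_def Dlift_def p t)
qed

text \<open>At the poles, \<open>s = 0\<close> and \<open>s = pi / 2\<close> on the rectangle, the
  circle of angles is collapsed to a point.\<close>

lemma Dlift_e2_pole:
  assumes "sin s * cos s = 0"
  shows "Dlift (chart_at (s, \<phi>)) ((s, \<phi>), y) ((0, a), 0) = 0"
proof -
  have "tangent (chart_at (s, \<phi>)) (s, \<phi>) (0, 1) = 0"
    unfolding tangent_rotated[OF chart_at] assms by simp
  then have "tangent (chart_at (s, \<phi>)) (s, \<phi>) (0, a) = 0"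
    using linear_cmul[OF tangent_linear[OF chart_at], of "(s, \<phi>)" a "(0, 1)"] by simp
  then show ?thesis by (simp add: Dlift_def zero_prod_def)
qed

lemma pulled_back_pole:
  assumes d: "d \<in> atlas Y" and y: "y \<in> chart_image d" and s: "sin s * cos s = 0"
  shows "\<Theta>\<sigma> d ((s, \<phi>), y) ((0, a), 0) = 0" "\<Omega>\<sigma> d ((s, \<phi>), y) v e\<^sub>2 = 0"
proof -
  have l: "lift (chart_at (s, \<phi>)) ((s, \<phi>), y) \<in> dom (chart_at (s, \<phi>)) d"
    by (rule lift_in) (use chart_at y in simp_all)
  show "\<Theta>\<sigma> d ((s, \<phi>), y) ((0, a), 0) = 0"
    unfolding \<Theta>\<sigma>_def Let_def fst_conv Dlift_e2_pole[OF s] by (rule linear_0[OF linear_\<Theta>[OF chart_at(1) d l]])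
  have "linear (\<Omega> (chart_at (s, \<phi>)) d (lift (chart_at (s, \<phi>)) ((s, \<phi>), y)) (Dlift (chart_at (s, \<phi>)) ((s, \<phi>), y) v))"
    using bilinear_\<Omega>[OF chart_at(1) d l] unfolding bilinear_def by blast
  then show "\<Omega>\<sigma> d ((s, \<phi>), y) v e\<^sub>2 = 0"
    unfolding \<Omega>\<sigma>_def Let_def fst_conv Dlift_e2_pole[OF s] by (rule linear_0)
qed

text \<open>The angular tangent is \<open>sin s * cos s\<close> times \<open>\<i>\<close> times the
  radial one, so the area density is this polar factor times the squared length of the radial
  tangent. It therefore detects critical points.\<close>

lemma \<Omega>\<sigma>_area:
  assumes c: "c \<in> atlas X" "\<sigma> (s, \<phi>) \<in> fst c" and d: "d \<in> atlas Y" and y: "y \<in> chart_image d"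
  shows "\<exists>r. \<Omega>\<sigma> d ((s, \<phi>), y) e\<^sub>1 e\<^sub>2 = (sin s * cos s) * r \<and> r \<ge> 0 \<and> (r = 0 \<longrightarrow> tangent c (s, \<phi>) (1, 0) = 0)"
proof -
  let ?V = "tangent c (s, \<phi>) (1, 0)" and ?z = "lift c ((s, \<phi>), y)"
  have z: "?z \<in> dom c d" by (rule lift_in[OF c(1)]) (use c y in simp_all)
  have lin: "linear (\<Omega> c d ?z (?V, 0))" using bilinear_\<Omega>[OF c(1) d z] unfolding bilinear_def by blast
  have "\<Omega>\<sigma> d ((s, \<phi>), y) e\<^sub>1 e\<^sub>2 = \<Omega> c d ?z (?V, 0) ((sin s * cos s) *\<^sub>R (\<i> *s ?V), 0)"
    using pulled_back_eq(2)[OF c(1) _ d, of "((s, \<phi>), y)" "e\<^sub>1" "e\<^sub>2"] c(2) y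
    by (simp add: Dlift_def tangent_rotated[OF c])
  also have "((sin s * cos s) *\<^sub>R (\<i> *s ?V), 0) = (sin s * cos s) *\<^sub>R (\<i> *s ?V, \<i> *s 0 :: (complex, 'm) vec)"
    by (simp add: vec_eq_iff)
  also have "\<Omega> c d ?z (?V, 0) \<dots> = (sin s * cos s) * \<Omega> c d ?z (?V, 0) (\<i> *s ?V, \<i> *s 0)"
    by (simp only: linear_cmul[OF lin] real_scaleR_def)
  finally have eq: "\<Omega>\<sigma> d ((s, \<phi>), y) e\<^sub>1 e\<^sub>2 = (sin s * cos s) * \<Omega> c d ?z (?V, 0) (\<i> *s ?V, \<i> *s 0)" .
  show ?thesis
  proof (cases "?V = 0")
    case True
    have "\<i> *s (0 :: (complex, 'n) vec) = 0" "\<i> *s (0 :: (complex, 'm) vec) = 0" by (simp_all add: vec_eq_iff)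
    with True linear_0[OF lin] have "\<Omega> c d ?z (?V, 0) (\<i> *s ?V, \<i> *s 0) = 0" by (simp add: zero_prod_def)
    then show ?thesis using True unfolding eq by (intro exI[of _ 0]) simp
  next
    case False
    then have "(?V, 0 :: (complex, 'm) vec) \<noteq> 0" by (simp add: zero_prod_def)
    from \<Omega>_hermitian(2)[OF c(1) d z this] show ?thesis using eq
      by (intro exI[of _ "\<Omega> c d ?z (?V, 0) (\<i> *s ?V, \<i> *s 0)"]) simp
  qed
qed

section \<open>Areas of the spheres over a convex piece of a chart of \<open>Y\<close>\<close>

context
  fixes d U H
  assumes d: "d \<in> atlas Y" and U: "open U" "convex U" "U \<subseteq> chart_image d"
    and H: "\<And>z. z \<in> UNIV \<times> U \<Longrightarrow> (H has_derivative \<Theta>\<sigma> d z) (at z)"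
begin

definition "\<Phi> z v w = exp (- H z) * \<Omega>\<sigma> d z v w"

lemma sub: "UNIV \<times> U \<subseteq> UNIV \<times> chart_image d" using U(3) by blast

lemma C1_H: "C1_on (UNIV \<times> U) H"
  by (rule C1_onI[OF H]) (assumption, rule continuous_on_subset[OF C1_on_continuous_on[OF C1_\<Theta>\<sigma>[OF d]] sub])

lemma C1_\<Phi>: "C1_on (UNIV \<times> U) (\<lambda>z. \<Phi> z v w)"
  unfolding \<Phi>_def by (rule C1_on_mult[OF C1_on_exp[OF C1_on_uminus[OF C1_H]] C1_on_subset[OF C1_\<Omega>\<sigma>[OF d] sub]])

lemma closed_\<Phi>: "z \<in> UNIV \<times> U \<Longrightarrow> closed_two_form_at \<Phi> z"
  unfolding \<Phi>_def[abs_def]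
  by (rule conformal_closed_two_form[OF H C1_on_differentiable[OF C1_\<Omega>\<sigma>[OF d]] lee_\<Omega>\<sigma>[OF d]]) (use sub in blast)+

text \<open>Here the simple connectedness of the sphere enters. The defect between the angles
  \<open>2 * pi\<close> and \<open>0\<close> is independent of \<open>s\<close>, because the
  pulled-back form is periodic, and it is zero at the pole \<open>s = 0\<close>, where the form
  annihilates the angular direction.\<close>

lemma H_periodic: "y \<in> U \<Longrightarrow> H ((s, 2 * pi), y) = H ((s, 0), y)"
proof -
  assume y: "y \<in> U"
  have yi: "y \<in> chart_image d" using U(3) y by blast
  have Hx: "((\<lambda>x. H (x, y)) has_derivative (\<lambda>a. \<Theta>\<sigma> d (x, y) (a, 0))) (at x)" for x
    by (rule has_derivative_slice_fst[OF H]) (use y in simp)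
  have "H ((s, 2 * pi), y) - H ((s, 0), y) = H ((0, 2 * pi), y) - H ((0, 0), y)"
  proof (rule has_derivative_zero_unique_on[of UNIV "\<lambda>s. H ((s, 2 * pi), y)" "\<lambda>s a. \<Theta>\<sigma> d ((s, 0), y) ((a, 0), 0)" "\<lambda>s. H ((s, 0), y)"])
    show "((\<lambda>s. H ((s, 2 * pi), y)) has_derivative (\<lambda>a. \<Theta>\<sigma> d ((s, 0), y) ((a, 0), 0))) (at s)" for s
      unfolding pulled_back_periodic(1)[OF d yi, symmetric] by (rule has_derivative_slice_fst[OF Hx])
    show "((\<lambda>s. H ((s, 0), y)) has_derivative (\<lambda>a. \<Theta>\<sigma> d ((s, 0), y) ((a, 0), 0))) (at s)" for s
      by (rule has_derivative_slice_fst[OF Hx])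
  qed simp_all
  moreover have "H ((0, 2 * pi), y) - 0 = H ((0, 0), y) - 0"
  proof (rule has_derivative_zero_unique_on[of UNIV "\<lambda>\<phi>. H ((0, \<phi>), y)" "\<lambda>\<phi> a. 0" "\<lambda>_. 0"])
    have "((\<lambda>\<phi>. H ((0, \<phi>), y)) has_derivative (\<lambda>a. \<Theta>\<sigma> d ((0, \<phi>), y) ((0, a), 0))) (at \<phi>)" for \<phi>
      by (rule has_derivative_slice_snd[OF Hx])
    then show "((\<lambda>\<phi>. H ((0, \<phi>), y)) has_derivative (\<lambda>a. 0)) (at \<phi>)" for \<phi>
      by (simp add: pulled_back_pole(1)[OF d yi])
  qed simp_all
  ultimately show ?thesis by simp
qed

definition "area y = integral rect (\<lambda>x. \<Phi> (x, y) e\<^sub>1 e\<^sub>2)"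

lemma \<Phi>_slice:
  assumes y: "y \<in> U"
  shows "C1_on UNIV (\<lambda>x. \<Phi> (x, y) v w)"
    and "frechet_derivative (\<lambda>x. \<Phi> (x, y) v w) (at x) a = frechet_derivative (\<lambda>z. \<Phi> z v w) (at (x, y)) (a, 0)"
proof -
  show "C1_on UNIV (\<lambda>x. \<Phi> (x, y) v w)"
    by (rule C1_on_compose[OF C1_\<Phi> C1_on_Pair[OF C1_on_bounded_linear[OF bounded_linear_ident] C1_on_const]]) (use y in auto)
  have "((\<lambda>z. \<Phi> z v w) has_derivative frechet_derivative (\<lambda>z. \<Phi> z v w) (at (x, y))) (at (x, y))"
    by (rule C1_on_has_derivative[OF C1_\<Phi>]) (use y in simp)
  from fun_cong[OF frechet_derivative_at[OF has_derivative_slice_fst[OF this]], of a]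
  show "frechet_derivative (\<lambda>x. \<Phi> (x, y) v w) (at x) a = frechet_derivative (\<lambda>z. \<Phi> z v w) (at (x, y)) (a, 0)" by simp
qed

text \<open>Closedness turns the variation of the integrand in direction \<open>u\<close> into a
  curl in the parameter plane, so only the edges of the rectangle contribute. The edges at the poles
  give zero and those at the angles \<open>0\<close> and \<open>2 * pi\<close> cancel by
  periodicity.\<close>

lemma integral_variation_eq_0:
  assumes y: "y \<in> U"
  shows "integral rect (\<lambda>x. frechet_derivative (\<lambda>z. \<Phi> z e\<^sub>1 e\<^sub>2) (at (x, y)) (0, u)) = 0"
proof -
  have yi: "y \<in> chart_image d" using U(3) y by blast
  let ?g1 = "\<lambda>x. \<Phi> (x, y) (0, u) e\<^sub>2" and ?g2 = "\<lambda>x. \<Phi> (x, y) (0, u) e\<^sub>1"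
  have eq: "frechet_derivative (\<lambda>z. \<Phi> z e\<^sub>1 e\<^sub>2) (at (x, y)) (0, u)
     = frechet_derivative ?g1 (at x) (1, 0) - frechet_derivative ?g2 (at x) (0, 1)" for x
    using closed_\<Phi>[of "(x, y)", unfolded closed_two_form_at_def, rule_format, of "e\<^sub>1" "e\<^sub>2" "(0, u)"] y
    unfolding \<Phi>_slice(2)[OF y] by (simp add: zero_prod_def)
  have int: "(\<lambda>x. frechet_derivative (\<lambda>x. \<Phi> (x, y) v w) (at x) a) integrable_on rect" for v w a
    by (rule integrable_continuous[OF continuous_on_subset[OF C1_on_continuous_derivative[OF \<Phi>_slice(1)[OF y]] subset_UNIV]])
  have 1: "integral rect (\<lambda>x. frechet_derivative ?g1 (at x) (1, 0)) = 0"
    unfolding integral_rectangle_partial_derivative(1)[OF \<Phi>_slice(1)[OF y], of 0 "pi/2" 0 "2*pi", simplified]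
    by (simp add: \<Phi>_def pulled_back_pole(2)[OF d yi])
  have 2: "integral rect (\<lambda>x. frechet_derivative ?g2 (at x) (0, 1)) = 0"
    unfolding integral_rectangle_partial_derivative(2)[OF \<Phi>_slice(1)[OF y], of 0 "pi/2" 0 "2*pi", simplified]
    by (simp add: \<Phi>_def H_periodic[OF y] pulled_back_periodic(2)[OF d yi])
  show ?thesis unfolding eq Henstock_Kurzweil_Integration.integral_diff[OF int int] 1 2 by simp
qed

lemma area_constant:
  assumes y: "y0 \<in> U" "y1 \<in> U"
  shows "area y0 = area y1"
proof -
  define p where "p t = y0 + t *\<^sub>R (y1 - y0)" for t
  have pU: "p t \<in> U" if "t \<in> {0..1}" for t
    using convexD_alt[OF U(2) y, of t] that by (simp add: p_def algebra_simps)
  have D: "((\<lambda>t. area (p t)) has_field_derivative integral rect (\<lambda>x. frechet_derivative (\<lambda>z. \<Phi> z e\<^sub>1 e\<^sub>2) (at (x, p t)) (0, y1 - y0))) (at t within {0..1})"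
    if t: "t \<in> {0..1}" for t
    unfolding area_def
  proof (rule leibniz_rule_field_derivative[OF _ _ _ t])
    fix t and x :: "real \<times> real" assume t: "t \<in> {0..1 :: real}"
    have z: "(x, p t) \<in> UNIV \<times> U" using pU[OF t] by simp
    have "((\<lambda>t. (x, p t)) has_derivative (\<lambda>h. (0, h *\<^sub>R (y1 - y0)))) (at t)"
      unfolding p_def by (auto intro!: derivative_eq_intros)
    from has_derivative_compose[OF this C1_on_has_derivative[OF C1_\<Phi> z]]
    have "((\<lambda>t. \<Phi> (x, p t) e\<^sub>1 e\<^sub>2) has_derivative (\<lambda>h. frechet_derivative (\<lambda>z. \<Phi> z e\<^sub>1 e\<^sub>2) (at (x, p t)) (0, h *\<^sub>R (y1 - y0)))) (at t)" .
    moreover have lin: "linear (frechet_derivative (\<lambda>z. \<Phi> z e\<^sub>1 e\<^sub>2) (at (x, p t)))"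
      by (rule has_derivative_linear[OF C1_on_has_derivative[OF C1_\<Phi> z]])
    have "frechet_derivative (\<lambda>z. \<Phi> z e\<^sub>1 e\<^sub>2) (at (x, p t)) (0, h *\<^sub>R (y1 - y0))
      = frechet_derivative (\<lambda>z. \<Phi> z e\<^sub>1 e\<^sub>2) (at (x, p t)) (0, y1 - y0) * h" for h
      using linear_cmul[OF lin, of h "(0, y1 - y0)"] by (simp add: mult.commute)
    ultimately show "((\<lambda>t. \<Phi> (x, p t) e\<^sub>1 e\<^sub>2) has_field_derivative frechet_derivative (\<lambda>z. \<Phi> z e\<^sub>1 e\<^sub>2) (at (x, p t)) (0, y1 - y0)) (at t within {0..1})"
      by (simp only: has_field_derivative_def has_derivative_at_withinI)
  next
    fix t assume t: "t \<in> {0..1 :: real}"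
    show "(\<lambda>x. \<Phi> (x, p t) e\<^sub>1 e\<^sub>2) integrable_on rect"
      by (rule integrable_continuous[OF continuous_on_subset[OF C1_on_continuous_on[OF \<Phi>_slice(1)[OF pU[OF t]]] subset_UNIV]])
  next
    have cp: "continuous_on ({0..1} \<times> rect) (\<lambda>z. (snd z, p (fst z)))" unfolding p_def
      by (intro continuous_on_Pair continuous_on_add continuous_on_scaleR continuous_on_const
          continuous_on_fst continuous_on_snd continuous_on_id)
    have "(\<lambda>z. (snd z, p (fst z))) ` ({0..1} \<times> rect) \<subseteq> UNIV \<times> U"
    proof (rule image_subsetI)
      fix z :: "real \<times> real \<times> real" assume "z \<in> {0..1} \<times> rect"
      then have "fst z \<in> {0..1}" by (simp only: mem_Times_iff)
      from pU[OF this] show "(snd z, p (fst z)) \<in> UNIV \<times> U" by simp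
    qed
    from continuous_on_compose2[OF C1_on_continuous_derivative[OF C1_\<Phi>] cp this]
    show "continuous_on ({0..1} \<times> rect) (\<lambda>(t, x). frechet_derivative (\<lambda>z. \<Phi> z e\<^sub>1 e\<^sub>2) (at (x, p t)) (0, y1 - y0))"
      unfolding case_prod_beta .
  qed (rule convex_real_interval)
  have "((\<lambda>t. area (p t)) has_field_derivative 0) (at t within {0..1})" if "t \<in> {0..1}" for t
    using D[OF that] unfolding integral_variation_eq_0[OF pU[OF that]] .
  then have "\<exists>C. \<forall>t\<in>{0..1}. area (p t) = C"
    by (intro has_field_derivative_zero_constant) simp_all
  then obtain C where C: "\<forall>t\<in>{0..1}. area (p t) = C" ..
  have "area (p 0) = C" "area (p 1) = C" using C by simp_all
  then show ?thesis by (simp add: p_def)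
qed

text \<open>The density is nonnegative on the rectangle, so zero area would make it vanish
  identically. Inside, \<open>sin s * cos s\<close> is positive, hence both partial tangents would
  be zero and \<open>\<sigma>\<close> locally constant, against \<open>nonconstant\<close>.\<close>

lemma area_pos:
  assumes y: "y \<in> U"
  shows "area y > 0"
proof -
  have yi: "y \<in> chart_image d" using U(3) y by blast
  have nonneg: "\<Phi> (x, y) e\<^sub>1 e\<^sub>2 \<ge> 0" if "x \<in> rect" for x
  proof -
    obtain s \<phi> where x: "x = (s, \<phi>)" by fastforce
    have "0 \<le> s" "s \<le> pi / 2" using that unfolding x mem_rectangle by auto
    then have "sin s * cos s \<ge> 0" by (intro mult_nonneg_nonneg sin_ge_zero cos_ge_zero) (use pi_gt_zero in linarith)+
    moreover obtain r where "\<Omega>\<sigma> d ((s, \<phi>), y) e\<^sub>1 e\<^sub>2 = (sin s * cos s) * r" "r \<ge> 0"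
      using \<Omega>\<sigma>_area[OF chart_at d yi] by blast
    ultimately show ?thesis by (simp add: \<Phi>_def x)
  qed
  have cont: "continuous_on rect (\<lambda>x. \<Phi> (x, y) e\<^sub>1 e\<^sub>2)"
    by (rule continuous_on_subset[OF C1_on_continuous_on[OF \<Phi>_slice(1)[OF y]] subset_UNIV])
  have "area y \<noteq> 0"
  proof
    assume "area y = 0"
    have ne: "box (0, 0) (pi / 2, 2 * pi) \<noteq> ({} :: (real \<times> real) set)"
    proof -
      have "(pi / 4, pi) \<in> box (0, 0) (pi / 2, 2 * pi)" unfolding mem_rectangle using pi_gt_zero by simp
      then show ?thesis by blast
    qed
    have zero: "\<Phi> (x, y) e\<^sub>1 e\<^sub>2 = 0" if "x \<in> rect" for x
      using integral_cbox_eq_0_iff[OF cont ne nonneg] \<open>area y = 0\<close> that unfolding area_def by blast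
    have tan0: "tangent c x = (\<lambda>_. 0)" if x: "x \<in> box (0, 0) (pi / 2, 2 * pi)" and c: "c \<in> atlas X" "\<sigma> x \<in> fst c" for c x
    proof -
      obtain s \<phi> where xs: "x = (s, \<phi>)" by fastforce
      have "0 < s" "s < pi / 2" using x unfolding xs mem_rectangle by auto
      then have sc: "sin s * cos s > 0" by (intro mult_pos_pos sin_gt_zero cos_gt_zero) (use pi_gt_zero in linarith)+
      obtain r where r: "\<Omega>\<sigma> d ((s, \<phi>), y) e\<^sub>1 e\<^sub>2 = (sin s * cos s) * r" "r = 0 \<longrightarrow> tangent c (s, \<phi>) (1, 0) = 0"
        using \<Omega>\<sigma>_area[OF c(1) c(2)[unfolded xs] d yi] by blast
      have "x \<in> rect" using x box_subset_cbox by blast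
      from zero[OF this] have "\<Omega>\<sigma> d ((s, \<phi>), y) e\<^sub>1 e\<^sub>2 = 0" by (simp add: \<Phi>_def xs)
      then have t1: "tangent c (s, \<phi>) (1, 0) = 0" using r sc by auto
      have t2: "tangent c (s, \<phi>) (0, 1) = 0"
        unfolding tangent_rotated[OF c(1) c(2)[unfolded xs]] t1 by (simp add: vec_eq_iff)
      show ?thesis
      proof
        fix v :: "real \<times> real"
        note lin = tangent_linear[OF c, unfolded xs]
        have "v = fst v *\<^sub>R (1, 0) + snd v *\<^sub>R (0, 1)" by (simp add: prod_eq_iff)
        then have "tangent c (s, \<phi>) v = fst v *\<^sub>R tangent c (s, \<phi>) (1, 0) + snd v *\<^sub>R tangent c (s, \<phi>) (0, 1)"
          by (metis linear_add[OF lin] linear_cmul[OF lin])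
        then show "tangent c x v = 0" by (simp add: t1 t2 xs)
      qed
    qed
    let ?B = "box (0, 0) (pi / 2, 2 * pi) :: (real \<times> real) set"
    have "\<sigma> a = \<sigma> b" if ab: "a \<in> ?B" "b \<in> ?B" for a b
    proof (rule connected_local_const[OF convex_connected[OF convex_box(2)] ab], rule ballI)
      fix x assume x: "x \<in> ?B"
      let ?c = "chart_at x"
      note c = chart_at[of x]
      have "open (?B \<inter> \<sigma> -` fst ?c)" by (intro open_Int open_box \<sigma>_dom_open[OF c(1)])
      then obtain r where r: "r > 0" "ball x r \<subseteq> ?B \<inter> \<sigma> -` fst ?c"
        using x c(2) open_contains_ball by blast
      have "\<sigma> x = \<sigma> x'" if x': "x' \<in> ball x r" for x'
      proof -
        have "snd ?c (\<sigma> x) = snd ?c (\<sigma> x')"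
        proof (rule has_derivative_zero_unique_connected[OF open_ball connected_ball _ _ x'])
          show "x \<in> ball x r" using r by simp
          show "((\<lambda>x. snd ?c (\<sigma> x)) has_derivative (\<lambda>_. 0)) (at w)" if "w \<in> ball x r" for w
          proof -
            have w: "w \<in> ?B" "\<sigma> w \<in> fst ?c" using r(2) that by blast+
            show ?thesis using tangent[OF c(1) w(2)] unfolding tan0[OF w(1) c(1) w(2)] .
          qed
        qed
        moreover have "\<sigma> x' \<in> fst ?c" using r(2) x' by blast
        ultimately show ?thesis using inj_onD[OF chart_inj[OF X c(1)] _ c(2)] by blast
      qed
      then show "\<forall>\<^sub>F x' in at x within ?B. \<sigma> x = \<sigma> x'"
        unfolding eventually_at using r(1) by (intro exI[of _ r]) (simp add: dist_commute)
    qed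
    then have "\<sigma> constant_on ?B" unfolding constant_on_def by metis
    then show False using nonconstant by blast
  qed
  moreover have "area y \<ge> 0" unfolding area_def by (rule integral_nonneg[OF integrable_continuous[OF cont] nonneg])
  ultimately show ?thesis by linarith
qed

end

end

section \<open>The primitive on a slice obtained from areas\<close>

context sphere_lck_product begin

text \<open>The value \<open>0\<close> at the base point removes the free constant, so the primitive
  on the sphere over \<open>q\<close> is determined by \<open>q\<close> alone.\<close>

definition sphere_primitive :: "'b \<Rightarrow> (real \<times> real \<Rightarrow> real) \<Rightarrow> bool" where
  "sphere_primitive q \<phi> \<longleftrightarrow> \<phi> (0, 0) = 0 \<and> (\<forall>d\<in>atlas Y. q \<in> fst d \<longrightarrow>
    (\<forall>x. (\<phi> has_derivative (\<lambda>a. \<Theta>\<sigma> d (x, snd d q) (a, 0))) (at x)))"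

text \<open>Area of the sphere over \<open>q\<close> for the form rescaled by its normalised
  primitive. Unlike \<open>area\<close>, which refers to a local potential \<open>H\<close>, this is
  a function on all of \<open>Y\<close>.\<close>

definition sphere_area :: "'b \<Rightarrow> real" where
  "sphere_area q = (let d = SOME d. d \<in> atlas Y \<and> q \<in> fst d in
    integral rect (\<lambda>x. exp (- (SOME \<phi>. sphere_primitive q \<phi>) x) * \<Omega>\<sigma> d (x, snd d q) e\<^sub>1 e\<^sub>2))"

lemma pulled_back_transition_Y:
  assumes d: "d \<in> atlas Y" "d' \<in> atlas Y" and q: "q \<in> fst d \<inter> fst d'"
  shows "\<Theta>\<sigma> d (x, snd d q) (a, 0) = \<Theta>\<sigma> d' (x, snd d' q) (a, 0)"
    and "\<Omega>\<sigma> d (x, snd d q) (a, 0) (b, 0) = \<Omega>\<sigma> d' (x, snd d' q) (a, 0) (b, 0)"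
proof -
  note t0 = transition_0[OF Y d q]
  show "\<Theta>\<sigma> d (x, snd d q) (a, 0) = \<Theta>\<sigma> d' (x, snd d' q) (a, 0)"
    unfolding pulled_back_change_chart(1)[OF chart_at d q] by (simp add: t0 \<Theta>\<sigma>_def Let_def Dlift_def)
  show "\<Omega>\<sigma> d (x, snd d q) (a, 0) (b, 0) = \<Omega>\<sigma> d' (x, snd d' q) (a, 0) (b, 0)"
    unfolding pulled_back_change_chart(2)[OF chart_at d q] by (simp add: t0 \<Omega>\<sigma>_def Let_def Dlift_def)
qed

lemma sphere_primitive_unique:
  assumes q: "q \<in> topspace (mtop Y)" and \<phi>: "sphere_primitive q \<phi>" and \<psi>: "sphere_primitive q \<psi>"
  shows "\<phi> x = \<psi> x"
proof -
  obtain d where d: "d \<in> atlas Y" "q \<in> fst d" using q Y unfolding complex_manifold_def by blast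
  have "\<phi> x - \<psi> x = \<phi> (0, 0) - \<psi> (0, 0)"
  proof (rule has_derivative_zero_unique_on[of UNIV \<phi> "\<lambda>x a. \<Theta>\<sigma> d (x, snd d q) (a, 0)" \<psi>])
    show "(\<phi> has_derivative (\<lambda>a. \<Theta>\<sigma> d (x, snd d q) (a, 0))) (at x)" "(\<psi> has_derivative (\<lambda>a. \<Theta>\<sigma> d (x, snd d q) (a, 0))) (at x)" for x
      using \<phi> \<psi> d unfolding sphere_primitive_def by blast+
  qed (rule open_UNIV connected_UNIV UNIV_I)+
  then show ?thesis using \<phi> \<psi> by (simp add: sphere_primitive_def)
qed

text \<open>Given a potential \<open>H\<close>, the normalised primitive over \<open>y\<close> is
  \<open>H (x, y) - H ((0, 0), y)\<close>, so the area acquires the factor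
  \<open>exp (H ((0, 0), y))\<close> in front of the constant \<open>area d H y\<close>. Up to a
  constant, its logarithm is thus \<open>H\<close> on the slice through the base point.\<close>

lemma sphere_fibre_primitive: "fibre_primitive (\<sigma> (0, 0)) (\<lambda>q. ln (sphere_area q))"
  unfolding fibre_primitive_def
proof (intro ballI impI)
  fix c d y assume c: "c \<in> atlas X" "\<sigma> (0, 0) \<in> fst c" and d: "d \<in> atlas Y" and y: "y \<in> chart_image d"
  obtain r where r: "r > 0" "ball y r \<subseteq> chart_image d"
    using chart_image_open[OF Y d] y open_contains_ball by blast
  let ?U = "ball y r"
  have sub: "UNIV \<times> ?U \<subseteq> (UNIV :: (real \<times> real) set) \<times> chart_image d" using r(2) by blast
  \<comment> \<open>The whole parameter plane is one convex factor, so the potential exists along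
    the entire sphere and not only near a point of it.\<close>
  obtain H where H: "\<And>z. z \<in> UNIV \<times> ?U \<Longrightarrow> (H has_derivative \<Theta>\<sigma> d z) (at z)"
  proof (rule poincare[of "UNIV \<times> ?U" "\<Theta>\<sigma> d"])
    show "open ((UNIV :: (real \<times> real) set) \<times> ?U)" "convex ((UNIV :: (real \<times> real) set) \<times> ?U)"
      by (intro open_Times convex_Times open_UNIV convex_UNIV open_ball convex_ball)+
    show "linear (\<Theta>\<sigma> d z)" if "z \<in> UNIV \<times> ?U" for z using linear_\<Theta>\<sigma>[OF d subsetD[OF sub that]] .
    show "C1_on (UNIV \<times> ?U) (\<lambda>z. \<Theta>\<sigma> d z v)" for v by (rule C1_on_subset[OF C1_\<Theta>\<sigma>[OF d] sub])
    show "frechet_derivative (\<lambda>z. \<Theta>\<sigma> d z v) (at z) u = frechet_derivative (\<lambda>z. \<Theta>\<sigma> d z u) (at z) v"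
      if "z \<in> UNIV \<times> ?U" for z u v using closed_\<Theta>\<sigma>[OF d subsetD[OF sub that]] .
  qed (use that in blast)
  have HU: "((\<lambda>x. H (x, y')) has_derivative (\<lambda>a. \<Theta>\<sigma> d (x, y') (a, 0))) (at x)" if "y' \<in> ?U" for x y'
    by (rule has_derivative_slice_fst[OF H]) (use that in simp)
  have prim: "sphere_primitive (chart_inv d y') (\<lambda>x. H (x, y') - H ((0, 0), y'))" if y': "y' \<in> ?U" for y'
    unfolding sphere_primitive_def
  proof (intro conjI ballI impI allI)
    have yi: "y' \<in> chart_image d" using r(2) y' by blast
    fix d' x assume d': "d' \<in> atlas Y" "chart_inv d y' \<in> fst d'"
    have "\<Theta>\<sigma> d' (x, snd d' (chart_inv d y')) (a, 0) = \<Theta>\<sigma> d (x, y') (a, 0)" for a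
      using pulled_back_transition_Y(1)[OF d d'(1), of "chart_inv d y'" x a] d'(2) chart_inv_in[OF Y d yi]
      by (simp add: chart_chart_inv[OF Y d yi])
    moreover have "((\<lambda>x. H (x, y') - H ((0, 0), y')) has_derivative (\<lambda>a. \<Theta>\<sigma> d (x, y') (a, 0) - 0)) (at x)"
      by (rule has_derivative_diff[OF HU[OF y'] has_derivative_const])
    ultimately show "((\<lambda>x. H (x, y') - H ((0, 0), y')) has_derivative (\<lambda>a. \<Theta>\<sigma> d' (x, snd d' (chart_inv d y')) (a, 0))) (at x)"
      by simp
  qed simp
  have area_eq: "sphere_area (chart_inv d y') = exp (H ((0, 0), y')) * area d H y'" if y': "y' \<in> ?U" for y'
  proof -
    let ?q = "chart_inv d y'"
    have yi: "y' \<in> chart_image d" using r(2) y' by blast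
    have qd: "?q \<in> fst d" by (rule chart_inv_in[OF Y d yi])
    have q: "?q \<in> topspace (mtop Y)" using qd chart_sub[OF Y d] by blast
    define d0 where "d0 = (SOME d. d \<in> atlas Y \<and> ?q \<in> fst d)"
    have d0: "d0 \<in> atlas Y" "?q \<in> fst d0"
      unfolding d0_def using someI[of "\<lambda>d. d \<in> atlas Y \<and> ?q \<in> fst d" d] d qd by blast+
    have \<phi>: "(SOME \<phi>. sphere_primitive ?q \<phi>) x = H (x, y') - H ((0, 0), y')" for x
      by (rule sphere_primitive_unique[OF q someI[of "sphere_primitive ?q", OF prim[OF y']] prim[OF y']])
    have \<omega>: "\<Omega>\<sigma> d0 (x, snd d0 ?q) e\<^sub>1 e\<^sub>2 = \<Omega>\<sigma> d (x, y') e\<^sub>1 e\<^sub>2" for x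
      using pulled_back_transition_Y(2)[OF d0(1) d, of ?q x "(1, 0)" "(0, 1)"] d0(2) qd
      by (simp add: chart_chart_inv[OF Y d yi])
    have "sphere_area ?q = integral rect (\<lambda>x. exp (H ((0, 0), y')) * (exp (- H (x, y')) * \<Omega>\<sigma> d (x, y') e\<^sub>1 e\<^sub>2))"
      unfolding sphere_area_def d0_def[symmetric] Let_def \<phi> \<omega> by (simp add: exp_diff exp_minus field_simps)
    moreover have "\<Phi> d H z v w = exp (- H z) * \<Omega>\<sigma> d z v w" for z v w
      by (rule \<Phi>_def[OF d open_ball convex_ball r(2) H])
    moreover have "area d H y' = integral rect (\<lambda>x. \<Phi> d H (x, y') e\<^sub>1 e\<^sub>2)"
      by (rule area_def[OF d open_ball convex_ball r(2) H])
    ultimately show ?thesis by (simp only: integral_mult_right)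
  qed
  have yU: "y \<in> ?U" using r(1) by simp
  have pos: "area d H y > 0" by (rule area_pos[OF d open_ball convex_ball r(2) H yU])
  have "ln (sphere_area (chart_inv d y')) = H ((0, 0), y') + ln (area d H y)" if y': "y' \<in> ?U" for y'
  proof -
    have "area d H y' = area d H y" by (rule area_constant[OF d open_ball convex_ball r(2) H y' yU])
    then show ?thesis unfolding area_eq[OF y'] using pos by (simp add: ln_mult)
  qed
  moreover have "((\<lambda>y. H ((0, 0), y) + ln (area d H y')) has_derivative (\<lambda>b. \<Theta>\<sigma> d ((0, 0), y) (0, b) + 0)) (at y)" for y'
    by (rule has_derivative_add[OF has_derivative_slice_snd[OF H] has_derivative_const]) (use yU in simp)
  ultimately have "((\<lambda>y. ln (sphere_area (chart_inv d y))) has_derivative (\<lambda>b. \<Theta>\<sigma> d ((0, 0), y) (0, b) + 0)) (at y)"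
    using has_derivative_transform_within_open[OF _ open_ball yU, of "\<lambda>y'. H ((0, 0), y') + ln (area d H y)"] by simp
  moreover have "\<Theta>\<sigma> d ((0, 0), y) (0, b) + 0 = \<Theta> c d (snd c (\<sigma> (0, 0)), y) (0, b)" for b
  proof -
    have "tangent c (0, 0) 0 = 0" by (rule linear_0[OF tangent_linear[OF c]])
    then show ?thesis using pulled_back_eq(1)[OF c(1) _ d, of "((0, 0), y)" "(0, b)"] c(2) y
      by (simp add: lift_def Dlift_def zero_prod_def)
  qed
  ultimately show "((\<lambda>y. ln (sphere_area (chart_inv d y))) has_derivative (\<lambda>b. \<Theta> c d (snd c (\<sigma> (0, 0)), y) (0, b))) (at y)"
    by simp
qed

end

section \<open>Rational curves\<close>

text \<open>Treats both coordinates of the projective line at once: \<open>\<alpha> = tan\<close>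
  with \<open>\<epsilon> = 1\<close> away from infinity, \<open>\<alpha> = cos / sin\<close> with
  \<open>\<epsilon> = - 1\<close> away from zero. The hypothesis \<open>rot\<close> says that in
  both the angular derivative is \<open>\<i> * sin s * cos s\<close> times the radial one.\<close>

lemma polar_pullback:
  fixes f :: "complex \<Rightarrow> complex" and \<alpha> \<alpha>' \<alpha>'' :: "real \<Rightarrow> real"
  assumes f: "f holomorphic_on S" "open S" and A: "open A"
    and \<alpha>: "\<And>s. s \<in> A \<Longrightarrow> (\<alpha> has_real_derivative \<alpha>' s) (at s)"
    and \<alpha>': "\<And>s. s \<in> A \<Longrightarrow> (\<alpha>' has_real_derivative \<alpha>'' s) (at s)"
    and \<alpha>'': "continuous_on A \<alpha>''"
    and rot: "\<And>s. s \<in> A \<Longrightarrow> \<epsilon> * \<alpha> s = sin s * cos s * \<alpha>' s"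
    and N: "open N" "\<And>x. x \<in> N \<Longrightarrow> fst x \<in> A"
    and NS: "\<And>x. x \<in> N \<Longrightarrow> of_real (\<alpha> (fst x)) * exp (\<i> * of_real (\<epsilon> * snd x)) \<in> S"
    and g: "\<And>x. x \<in> N \<Longrightarrow> g x = f (of_real (\<alpha> (fst x)) * exp (\<i> * of_real (\<epsilon> * snd x)))"
  shows "C1_on N g" and "C1_on N (\<lambda>x. frechet_derivative g (at x) v)"
    and "x \<in> N \<Longrightarrow> frechet_derivative (\<lambda>x. frechet_derivative g (at x) v) (at x) u
      = frechet_derivative (\<lambda>x. frechet_derivative g (at x) u) (at x) v"
    and "x \<in> N \<Longrightarrow> frechet_derivative g (at x) (0, 1) = (sin (fst x) * cos (fst x)) *\<^sub>R (\<i> * frechet_derivative g (at x) (1, 0))"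
proof -
  define L where "L v = \<i> * complex_of_real (\<epsilon> * snd v)" for v :: "real \<times> real"
  define E where "E x = exp (L x)" for x
  define m where "m x = complex_of_real (\<alpha> (fst x)) * E x" for x
  define Dm where "Dm x v = (complex_of_real (\<alpha>' (fst x) * fst v) + complex_of_real (\<alpha> (fst x)) * L v) * E x" for x v
  \<comment> \<open>The second derivative of \<open>m\<close>, written so that its symmetry in
    \<open>u\<close> and \<open>v\<close> is plain algebra.\<close>
  define D2m where "D2m x v u = (complex_of_real (\<alpha>'' (fst x) * fst u * fst v) + complex_of_real (\<alpha>' (fst x) * fst u) * L v) * E x
    + (complex_of_real (\<alpha>' (fst x) * fst v) + complex_of_real (\<alpha> (fst x)) * L v) * (E x * L u)" for x v u
  have blL: "bounded_linear L"
    by (intro linear_conv_bounded_linear[THEN iffD1] linearI) (simp_all add: L_def algebra_simps scaleR_conv_of_real)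
  have E: "(E has_derivative (\<lambda>v. E x * L v)) (at x)" for x
    unfolding E_def[abs_def]
    by (rule has_derivative_compose[OF bounded_linear_imp_has_derivative[OF blL] DERIV_exp[unfolded has_field_derivative_def]])
  have re: "((\<lambda>x. complex_of_real (a (fst x))) has_derivative (\<lambda>v. complex_of_real (a' * fst v))) (at x)"
    if "(a has_real_derivative a') (at (fst x))" for a a' and x :: "real \<times> real"
    by (rule bounded_linear.has_derivative[OF bounded_linear_of_real
        has_derivative_compose[OF has_derivative_fst[OF has_derivative_ident] that[unfolded has_field_derivative_def]]])
  have m: "(m has_derivative Dm x) (at x)" if "x \<in> N" for x
    using has_derivative_mult[OF re[OF \<alpha>[OF N(2)[OF that]]] E]
    unfolding m_def[abs_def] Dm_def[abs_def] by (simp add: algebra_simps)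
  have Dm: "((\<lambda>x. Dm x v) has_derivative D2m x v) (at x)" if "x \<in> N" for x v
  proof -
    note r1 = has_derivative_mult_left[OF re[OF \<alpha>'[OF N(2)[OF that]]], of "complex_of_real (fst v)"]
    note r0 = has_derivative_mult_left[OF re[OF \<alpha>[OF N(2)[OF that]]], of "L v"]
    from has_derivative_mult[OF has_derivative_add[OF r1 r0] E]
    show ?thesis unfolding Dm_def D2m_def[abs_def] by (simp add: algebra_simps)
  qed
  have mS: "m x \<in> S" if "x \<in> N" for x using NS[OF that] by (simp add: m_def E_def L_def)
  have gm: "g x = f (m x)" if "x \<in> N" for x using g[OF that] by (simp add: m_def E_def L_def)
  have hol1: "deriv f holomorphic_on S" by (rule holomorphic_deriv[OF f])
  have df: "(f has_derivative (\<lambda>h. deriv f z * h)) (at z)" if "z \<in> S" for z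
    using holomorphic_derivI[OF f that] by (simp add: has_field_derivative_def)
  have ddf: "(deriv f has_derivative (\<lambda>h. deriv (deriv f) z * h)) (at z)" if "z \<in> S" for z
    using holomorphic_derivI[OF hol1 f(2) that] by (simp add: has_field_derivative_def)
  have Dg: "(g has_derivative (\<lambda>v. deriv f (m x) * Dm x v)) (at x)" if "x \<in> N" for x
    by (rule has_derivative_transform_within_open[OF has_derivative_compose[OF m[OF that] df[OF mS[OF that]]] N(1) that])
      (rule gm[symmetric])
  have fd: "frechet_derivative g (at x) v = deriv f (m x) * Dm x v" if "x \<in> N" for x v
    by (rule fun_cong[OF frechet_derivative_at[OF Dg[OF that]], symmetric])
  define D2 where "D2 x v u = deriv f (m x) * D2m x v u + deriv (deriv f) (m x) * Dm x u * Dm x v" for x v u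
  have D2g: "((\<lambda>x. frechet_derivative g (at x) v) has_derivative D2 x v) (at x)" if "x \<in> N" for x v
  proof -
    have "((\<lambda>x. deriv f (m x) * Dm x v) has_derivative D2 x v) (at x)"
      unfolding D2_def[abs_def]
      by (rule has_derivative_mult[OF has_derivative_compose[OF m[OF that] ddf[OF mS[OF that]]] Dm[OF that]])
    then show ?thesis by (rule has_derivative_transform_within_open[OF _ N(1) that]) (rule fd[symmetric])
  qed
  have cm: "continuous_on N m" using m by (intro continuous_at_imp_continuous_on ballI has_derivative_continuous) blast
  have cDm: "continuous_on N (\<lambda>x. Dm x v)" for v
    by (intro continuous_at_imp_continuous_on ballI has_derivative_continuous[OF Dm])
  have cE: "continuous_on N E" by (intro continuous_at_imp_continuous_on ballI has_derivative_continuous[OF E])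
  have cr: "continuous_on N (\<lambda>x. complex_of_real (a (fst x)))" if "continuous_on A a" for a
    by (intro continuous_on_of_real continuous_on_compose2[OF that continuous_on_fst[OF continuous_on_id]] image_subsetI N(2))
  have c\<alpha>: "continuous_on A \<alpha>" "continuous_on A \<alpha>'"
    using \<alpha> \<alpha>' by (auto intro!: continuous_at_imp_continuous_on DERIV_isCont)
  have cD2m: "continuous_on N (\<lambda>x. D2m x v u)" for v u
    unfolding D2m_def of_real_mult
    by (intro continuous_on_add continuous_on_mult cE cr c\<alpha> \<alpha>'' continuous_on_const)
  have c1: "continuous_on N (\<lambda>x. deriv f (m x))"
    by (rule continuous_on_compose2[OF holomorphic_on_imp_continuous_on[OF hol1] cm]) (use mS in blast)
  have c2: "continuous_on N (\<lambda>x. deriv (deriv f) (m x))"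
    by (rule continuous_on_compose2[OF holomorphic_on_imp_continuous_on[OF holomorphic_deriv[OF hol1 f(2)]] cm]) (use mS in blast)
  show "C1_on N g" by (rule C1_onI[OF Dg], assumption, intro continuous_on_mult c1 cDm)
  show "C1_on N (\<lambda>x. frechet_derivative g (at x) v)"
    by (rule C1_onI[OF D2g], assumption, unfold D2_def, intro continuous_on_add continuous_on_mult c1 c2 cDm cD2m)
  have sym: "D2m x v u = D2m x u v" for x
    unfolding D2m_def by (simp add: algebra_simps)
  show "frechet_derivative (\<lambda>x. frechet_derivative g (at x) v) (at x) u
      = frechet_derivative (\<lambda>x. frechet_derivative g (at x) u) (at x) v" if "x \<in> N"
    unfolding frechet_derivative_at[OF D2g[OF that], symmetric] D2_def sym by (simp add: mult.assoc mult.commute)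
  show "frechet_derivative g (at x) (0, 1) = (sin (fst x) * cos (fst x)) *\<^sub>R (\<i> * frechet_derivative g (at x) (1, 0))" if "x \<in> N"
  proof -
    have "Dm x (0, 1) = \<i> * complex_of_real (\<epsilon> * \<alpha> (fst x)) * E x" by (simp add: Dm_def L_def)
    also have "\<dots> = complex_of_real (sin (fst x) * cos (fst x)) * (\<i> * Dm x (1, 0))"
      unfolding rot[OF N(2)[OF that]] by (simp add: Dm_def L_def)
    finally show ?thesis unfolding fd[OF that] scaleR_conv_of_real by simp
  qed
qed

section \<open>The projective line and its two coordinates\<close>

lemma proj_line_simps:
  "topspace (mtop proj_line) = UNIV"
  "(- {None}, \<lambda>p. vec (case p of None \<Rightarrow> 0 | Some z \<Rightarrow> z)) \<in> atlas proj_line"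
  "(- {Some 0}, \<lambda>p. vec (case p of None \<Rightarrow> 0 | Some z \<Rightarrow> 1 / z)) \<in> atlas proj_line"
  by (auto simp: proj_line_def topspace_Alexandroff_compactification) (metis notin_range_Some)

lemma vec_eq_complex: "(vec z :: complex^1) = vec w \<longleftrightarrow> z = w"
  by (simp add: vec_eq_iff)

lemma bounded_linear_vec1: "bounded_linear (vec :: complex \<Rightarrow> complex^1)"
  by (intro linear_conv_bounded_linear[THEN iffD1] linearI) (simp_all add: vec_eq_iff)

text \<open>\<open>k\<close> inverts the chart \<open>c\<close> as a function of one complex
  variable; complex linearity of a differential on \<open>complex^1\<close> is complex
  differentiability.\<close>

lemma holomorphic_in_coordinate:
  fixes M :: "('a, 'n::finite) cmfd"
  assumes \<nu>: "holomorphic_map proj_line M \<nu>" and c: "c \<in> atlas proj_line" and d: "d \<in> atlas M"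
    and k: "\<And>z. k z \<in> fst c \<and> snd c (k z) = vec z" and inj: "inj_on (snd c) (fst c)"
    and op: "open {z. \<nu> (k z) \<in> fst d}"
  shows "(\<lambda>z. snd d (\<nu> (k z)) $ i) holomorphic_on {z. \<nu> (k z) \<in> fst d}"
  unfolding holomorphic_on_open[OF op]
proof
  fix z assume z: "z \<in> {z. \<nu> (k z) \<in> fst d}"
  have ck: "chart_inv c (vec w) = k w" for w
    using inv_into_f_f[OF inj, of "k w"] k[of w] by (simp add: chart_inv_def)
  have "vec z \<in> snd c ` {p \<in> fst c \<inter> topspace (mtop proj_line). \<nu> p \<in> fst d}"
    using k[of z] z by (intro image_eqI[of _ _ "k z"]) (auto simp: proj_line_simps)
  then obtain D where D: "((snd d \<circ> \<nu> \<circ> chart_inv c) has_derivative D) (at (vec z))" "\<forall>a v. D (a *s v) = a *s D v"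
    using \<nu> c d unfolding holomorphic_map_on_def cmap_holomorphic_on_def by blast
  from has_derivative_compose[OF bounded_linear_imp_has_derivative[OF bounded_linear_vec1] D(1)]
  have "((\<lambda>z. snd d (\<nu> (k z))) has_derivative (\<lambda>h. D (vec h))) (at z)" by (simp add: ck)
  from bounded_linear.has_derivative[OF bounded_linear_vec_nth this]
  have "((\<lambda>z. snd d (\<nu> (k z)) $ i) has_derivative (\<lambda>h. D (vec h) $ i)) (at z)" .
  moreover have "D (vec h) $ i = D (vec 1) $ i * h" for h
  proof -
    have "vec h = h *s (vec 1 :: complex^1)" by (simp add: vec_eq_iff)
    then show ?thesis using D(2) by simp
  qed
  ultimately show "\<exists>f'. ((\<lambda>z. snd d (\<nu> (k z)) $ i) has_field_derivative f') (at z)"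
    by (auto simp: has_field_derivative_def intro!: exI[of _ "D (vec 1) $ i"])
qed

lemma openin_proj_line_cases:
  assumes "openin (mtop proj_line) V"
  obtains (finite) U where "open U" "V = Some ` U" | (infinite) K where "compact K" "V = insert None (Some ` (- K))"
proof -
  have "openin (Alexandroff_compactification euclidean) V" using assms by (simp add: proj_line_def)
  then consider "\<exists>U. openin euclidean U \<and> V = Some ` U"
    | "\<exists>C. compactin euclidean C \<and> closedin euclidean C \<and> V = insert None (Some ` (topspace euclidean - C))"
    unfolding openin_Alexandroff_compactification by blast
  then show ?thesis
  proof cases
    case 1
    then show ?thesis using finite by auto
  next
    case 2
    then show ?thesis using infinite by (auto simp: Compl_eq_Diff_UNIV)
  qed
qed

lemma proj_line_open_finite:
  assumes "openin (mtop proj_line) V"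
  shows "open {z. Some z \<in> V}"
  using assms
proof (cases rule: openin_proj_line_cases)
  case (finite U)
  then have "{z. Some z \<in> V} = U" by auto
  then show ?thesis using finite(1) by simp
next
  case (infinite K)
  then have "{z. Some z \<in> V} = - K" by auto
  then show ?thesis using infinite(1) by (simp add: compact_imp_closed open_Compl)
qed

text \<open>A neighbourhood of infinity omits a compact set, say of radius \<open>R\<close>, so it
  contains \<open>1 / w\<close> whenever \<open>cmod w < 1 / R\<close>. Away from \<open>0\<close>,
  openness is that of a preimage under inversion.\<close>

lemma proj_line_open_infinite:
  assumes "openin (mtop proj_line) V"
  shows "open {w. (if w = 0 then None else Some (1 / w)) \<in> V}"
proof -
  have "continuous_on (- {0 :: complex}) inverse" by (intro continuous_on_inverse continuous_on_id) auto
  then have inv: "open (inverse -` U \<inter> - {0 :: complex})" if "open U" for U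
    using continuous_on_open_vimage[of "- {0 :: complex}" inverse] that by (simp add: open_delete Compl_eq_Diff_UNIV)
  show ?thesis
    using assms
  proof (cases rule: openin_proj_line_cases)
    case (finite U)
    then have "{w. (if w = 0 then None else Some (1 / w)) \<in> V} = inverse -` U \<inter> - {0}"
      by (auto simp: divide_inverse split: if_splits)
    then show ?thesis using inv[OF finite(1)] by simp
  next
    case (infinite K)
    obtain R where R: "R > 0" "\<And>z. z \<in> K \<Longrightarrow> cmod z \<le> R"
      using compact_imp_bounded[OF infinite(1)] unfolding bounded_pos by blast
    have small: "(if w = 0 then None else Some (1 / w)) \<in> V" if w: "cmod w < 1 / R" for w
    proof (cases "w = 0")
      case False
      then have "cmod (1 / w) > R" using w R(1) by (simp add: norm_divide field_simps)
      then have "1 / w \<notin> K" using R(2)[of "1 / w"] by linarith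
      then show ?thesis using False infinite(2) by auto
    qed (use infinite in auto)
    have "{w. (if w = 0 then None else Some (1 / w)) \<in> V} = ball 0 (1 / R) \<union> (inverse -` (- K) \<inter> - {0})"
    proof (intro set_eqI iffI)
      fix w assume "w \<in> {w. (if w = 0 then None else Some (1 / w)) \<in> V}"
      then show "w \<in> ball 0 (1 / R) \<union> (inverse -` (- K) \<inter> - {0})"
        using infinite(2) R(1) by (cases "w = 0") (auto simp: divide_inverse)
    next
      fix w assume "w \<in> ball 0 (1 / R) \<union> (inverse -` (- K) \<inter> - {0})"
      then show "w \<in> {w. (if w = 0 then None else Some (1 / w)) \<in> V}"
        using small[of w] infinite(2) by (auto simp: divide_inverse)
    qed
    then show ?thesis using inv[of "- K"] infinite(1) by (simp add: compact_imp_closed open_Compl open_Un)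
  qed
qed

text \<open>\<open>\<sigma>\<close> is \<open>\<nu>\<close> after the map sending
  \<open>(s, \<phi>)\<close> to \<open>tan s * exp (\<i> * \<phi>)\<close>, with value infinity
  where \<open>cos s = 0\<close>. There the inverse coordinate, \<open>cos s / sin s\<close> times
  \<open>exp (- \<i> * \<phi>)\<close>, is regular, and the two descriptions cover the plane since
  \<open>sin\<close> and \<open>cos\<close> have no common zero. Finite fibres of
  \<open>\<nu>\<close> keep \<open>\<sigma>\<close> from being constant, as \<open>tan\<close> is
  injective on \<open>(0, pi / 2)\<close>.\<close>

lemma sphere_of_rational_curve:
  fixes X :: "('a, 'n::finite) cmfd" and Y :: "('b, 'm::finite) cmfd"
  assumes lck: "lck_product X Y h \<theta>" and \<nu>: "holomorphic_map proj_line X \<nu>"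
    and fin: "\<And>q. finite {p. \<nu> p = q}"
  obtains \<sigma> where "sphere_lck_product X Y h \<theta> \<sigma>"
proof -
  interpret lck_product X Y h \<theta> by (rule lck)
  define k\<^sub>0 k\<^sub>1 :: "complex \<Rightarrow> complex option" where "k\<^sub>0 = Some" and "k\<^sub>1 = (\<lambda>w. if w = 0 then None else Some (1 / w))"
  define m\<^sub>0 m\<^sub>1 :: "real \<times> real \<Rightarrow> complex"
    where "m\<^sub>0 = (\<lambda>x. of_real (tan (fst x)) * exp (\<i> * of_real (1 * snd x)))"
      and "m\<^sub>1 = (\<lambda>x. of_real (cos (fst x) / sin (fst x)) * exp (\<i> * of_real (- 1 * snd x)))"
  define W\<^sub>0 W\<^sub>1 :: "(real \<times> real) set" where "W\<^sub>0 = {x. cos (fst x) \<noteq> 0}" and "W\<^sub>1 = {x. sin (fst x) \<noteq> 0}"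
  define \<sigma> where "\<sigma> x = (if cos (fst x) = 0 then \<nu> None else \<nu> (k\<^sub>0 (m\<^sub>0 x)))" for x
  have \<sigma>0: "\<sigma> x = \<nu> (k\<^sub>0 (m\<^sub>0 x))" if "x \<in> W\<^sub>0" for x using that by (simp add: \<sigma>_def W\<^sub>0_def)
  have \<sigma>1: "\<sigma> x = \<nu> (k\<^sub>1 (m\<^sub>1 x))" if "x \<in> W\<^sub>1" for x
  proof (cases "cos (fst x) = 0")
    case True
    then show ?thesis by (simp add: \<sigma>_def k\<^sub>1_def m\<^sub>1_def)
  next
    case False
    with that have "m\<^sub>1 x \<noteq> 0" "1 / m\<^sub>1 x = m\<^sub>0 x"
      by (simp_all add: W\<^sub>1_def m\<^sub>1_def m\<^sub>0_def tan_def exp_minus field_simps)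
    then show ?thesis using False by (simp add: \<sigma>_def k\<^sub>1_def k\<^sub>0_def)
  qed
  have W: "x \<in> W\<^sub>0 \<or> x \<in> W\<^sub>1" for x
    by (auto simp: W\<^sub>0_def W\<^sub>1_def dest: sin_zero_abs_cos_one)
  have A: "open {s :: real. cos s \<noteq> 0}" "open {s :: real. sin s \<noteq> 0}"
    by (intro open_Collect_neq continuous_intros)+
  have openW: "open W\<^sub>0" "open W\<^sub>1"
    unfolding W\<^sub>0_def W\<^sub>1_def by (intro open_Collect_neq continuous_intros)+
  have cm: "continuous_on W\<^sub>0 m\<^sub>0" "continuous_on W\<^sub>1 m\<^sub>1"
    unfolding m\<^sub>0_def m\<^sub>1_def W\<^sub>0_def W\<^sub>1_def tan_def by (intro continuous_intros ballI | simp)+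
  have contin: "continuous_map (mtop proj_line) (mtop X) \<nu>"
    using \<nu> unfolding holomorphic_map_on_def by (simp add: subtopology_topspace)
  have O: "open {z. \<nu> (k\<^sub>0 z) \<in> V}" "open {z. \<nu> (k\<^sub>1 z) \<in> V}" if "openin (mtop X) V" for V
    using proj_line_open_finite[OF openin_continuous_map_preimage[OF contin that]]
      proj_line_open_infinite[OF openin_continuous_map_preimage[OF contin that]]
    by (simp_all add: proj_line_simps k\<^sub>0_def k\<^sub>1_def)
  define N\<^sub>0 N\<^sub>1 where "N\<^sub>0 V = m\<^sub>0 -` {z. \<nu> (k\<^sub>0 z) \<in> V} \<inter> W\<^sub>0" and "N\<^sub>1 V = m\<^sub>1 -` {z. \<nu> (k\<^sub>1 z) \<in> V} \<inter> W\<^sub>1" for V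
  have N: "open (N\<^sub>0 V)" "open (N\<^sub>1 V)" if "openin (mtop X) V" for V
    unfolding N\<^sub>0_def N\<^sub>1_def
    using continuous_on_open_vimage[OF openW(1), of m\<^sub>0] continuous_on_open_vimage[OF openW(2), of m\<^sub>1] cm O[OF that] by blast+
  have N_eq: "\<sigma> -` V = N\<^sub>0 V \<union> N\<^sub>1 V" for V
  proof (intro set_eqI iffI)
    fix x assume x: "x \<in> \<sigma> -` V"
    from W[of x] show "x \<in> N\<^sub>0 V \<union> N\<^sub>1 V"
    proof
      assume w: "x \<in> W\<^sub>0"
      then show ?thesis using x by (simp add: N\<^sub>0_def \<sigma>0[OF w])
    next
      assume w: "x \<in> W\<^sub>1"
      then show ?thesis using x by (simp add: N\<^sub>1_def \<sigma>1[OF w])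
    qed
  next
    fix x assume "x \<in> N\<^sub>0 V \<union> N\<^sub>1 V"
    then show "x \<in> \<sigma> -` V"
    proof
      assume "x \<in> N\<^sub>0 V"
      then show ?thesis using \<sigma>0[of x] by (simp add: N\<^sub>0_def)
    next
      assume "x \<in> N\<^sub>1 V"
      then show ?thesis using \<sigma>1[of x] by (simp add: N\<^sub>1_def)
    qed
  qed
  have N_in: "x \<in> N\<^sub>0 V \<or> x \<in> N\<^sub>1 V" if "\<sigma> x \<in> V" for x V using N_eq[of V] that by blast
  let ?f = "\<lambda>c i x. snd c (\<sigma> x) $ i"
  \<comment> \<open>All local requirements at once for a single component \<open>i\<close>, obtained
    from \<open>polar_pullback\<close> in whichever coordinate of the projective line is available
    at \<open>x\<close>.\<close>
  have loc: "\<exists>N. open N \<and> x \<in> N \<and> C1_on N (?f c i) \<and> (\<forall>v. C1_on N (\<lambda>x. frechet_derivative (?f c i) (at x) v))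
      \<and> (\<forall>u v. frechet_derivative (\<lambda>x. frechet_derivative (?f c i) (at x) v) (at x) u
        = frechet_derivative (\<lambda>x. frechet_derivative (?f c i) (at x) u) (at x) v)
      \<and> frechet_derivative (?f c i) (at x) (0, 1) = (sin (fst x) * cos (fst x)) *\<^sub>R (\<i> * frechet_derivative (?f c i) (at x) (1, 0))"
    if c: "c \<in> atlas X" and x: "\<sigma> x \<in> fst c" for c i x
  proof -
    note oc = chart_open[OF X c]
    have h0: "(\<lambda>z. snd c (\<nu> (k\<^sub>0 z)) $ i) holomorphic_on {z. \<nu> (k\<^sub>0 z) \<in> fst c}"
      by (rule holomorphic_in_coordinate[OF \<nu> proj_line_simps(2) c _ _ O(1)[OF oc]])
        (auto simp: k\<^sub>0_def inj_on_def vec_eq_complex split: option.splits)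
    have h1: "(\<lambda>z. snd c (\<nu> (k\<^sub>1 z)) $ i) holomorphic_on {z. \<nu> (k\<^sub>1 z) \<in> fst c}"
      by (rule holomorphic_in_coordinate[OF \<nu> proj_line_simps(3) c _ _ O(2)[OF oc]])
        (auto simp: k\<^sub>1_def inj_on_def vec_eq_complex split: option.splits)
    have d0: "(tan has_real_derivative inverse ((cos s)\<^sup>2)) (at s)"
      "((\<lambda>s. inverse ((cos s)\<^sup>2)) has_real_derivative 2 * sin s * inverse (cos s ^ 3)) (at s)"
      if "s \<in> {s. cos s \<noteq> 0}" for s :: real
      using that by (auto intro!: derivative_eq_intros simp: field_simps power2_eq_square power3_eq_cube)
    have d1: "((\<lambda>s. cos s / sin s) has_real_derivative - inverse ((sin s)\<^sup>2)) (at s)"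
      "((\<lambda>s. - inverse ((sin s)\<^sup>2)) has_real_derivative 2 * cos s * inverse (sin s ^ 3)) (at s)"
      if "s \<in> {s. sin s \<noteq> 0}" for s :: real
    proof -
      have "- sin s * sin s - cos s * cos s = - 1" using sin_cos_squared_add[of s] by (simp add: power2_eq_square)
      then show "((\<lambda>s. cos s / sin s) has_real_derivative - inverse ((sin s)\<^sup>2)) (at s)"
        using that DERIV_divide[OF DERIV_cos DERIV_sin, of s] by (simp add: divide_inverse power2_eq_square)
      show "((\<lambda>s. - inverse ((sin s)\<^sup>2)) has_real_derivative 2 * cos s * inverse (sin s ^ 3)) (at s)"
        using that by (auto intro!: derivative_eq_intros simp: field_simps power2_eq_square power3_eq_cube)
    qed
    have c0: "continuous_on {s :: real. cos s \<noteq> 0} (\<lambda>s. 2 * sin s * inverse (cos s ^ 3))"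
      and c1: "continuous_on {s :: real. sin s \<noteq> 0} (\<lambda>s. 2 * cos s * inverse (sin s ^ 3))"
      by (intro continuous_intros; simp)+
    note P0 = polar_pullback[OF h0 O(1)[OF oc] A(1) _ _ c0 _ N(1)[OF oc], where \<alpha>=tan
      and \<alpha>'="\<lambda>s. inverse ((cos s)\<^sup>2)" and \<epsilon>=1 and g="?f c i"]
    note P1 = polar_pullback[OF h1 O(2)[OF oc] A(2) _ _ c1 _ N(2)[OF oc], where \<alpha>="\<lambda>s. cos s / sin s"
      and \<alpha>'="\<lambda>s. - inverse ((sin s)\<^sup>2)" and \<epsilon>="- 1" and g="?f c i"]
    have r0: "1 * tan s = sin s * cos s * inverse ((cos s)\<^sup>2)" if "s \<in> {s. cos s \<noteq> 0}" for s :: real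
      using that by (simp add: tan_def field_simps power2_eq_square)
    have r1: "- 1 * (cos s / sin s) = sin s * cos s * - inverse ((sin s)\<^sup>2)" if "s \<in> {s. sin s \<noteq> 0}" for s :: real
      using that by (simp add: field_simps power2_eq_square)
    have n0: "fst y \<in> {s. cos s \<noteq> 0}" "of_real (tan (fst y)) * exp (\<i> * of_real (1 * snd y)) \<in> {z. \<nu> (k\<^sub>0 z) \<in> fst c}"
      "?f c i y = snd c (\<nu> (k\<^sub>0 (of_real (tan (fst y)) * exp (\<i> * of_real (1 * snd y))))) $ i" if "y \<in> N\<^sub>0 (fst c)" for y
      using that \<sigma>0[of y] by (auto simp: N\<^sub>0_def W\<^sub>0_def m\<^sub>0_def)
    have n1: "fst y \<in> {s. sin s \<noteq> 0}" "of_real (cos (fst y) / sin (fst y)) * exp (\<i> * of_real (- 1 * snd y)) \<in> {z. \<nu> (k\<^sub>1 z) \<in> fst c}"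
      "?f c i y = snd c (\<nu> (k\<^sub>1 (of_real (cos (fst y) / sin (fst y)) * exp (\<i> * of_real (- 1 * snd y))))) $ i" if "y \<in> N\<^sub>1 (fst c)" for y
      using that \<sigma>1[of y] by (auto simp: N\<^sub>1_def W\<^sub>1_def m\<^sub>1_def)
    from N_in[of x "fst c", OF x] show ?thesis
    proof
      assume xN: "x \<in> N\<^sub>0 (fst c)"
      show ?thesis
        by (rule exI[of _ "N\<^sub>0 (fst c)"], intro conjI allI N(1)[OF oc] xN P0; erule d0 r0 n0)
    next
      assume xN: "x \<in> N\<^sub>1 (fst c)"
      show ?thesis
        by (rule exI[of _ "N\<^sub>1 (fst c)"], intro conjI allI N(2)[OF oc] xN P1; erule d1 r1 n1)
    qed
  qed
  have dom: "open (\<sigma> -` fst c)" if "c \<in> atlas X" for c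
    unfolding N_eq by (intro open_Un N chart_open[OF X that])
  have f1: "C1_on (\<sigma> -` fst c) (?f c i)" if c: "c \<in> atlas X" for c i
  proof (rule C1_on_local)
    fix x assume "x \<in> \<sigma> -` fst c"
    then have "\<sigma> x \<in> fst c" by simp
    from loc[OF c this, of i] obtain N where "open N" "x \<in> N" "C1_on N (?f c i)" by (elim exE conjE)
    then show "\<exists>N g. open N \<and> x \<in> N \<and> C1_on N g \<and> (\<forall>y\<in>N. ?f c i y = g y)"
      by (intro exI[of _ N] exI[of _ "?f c i"] conjI ballI refl)
  qed
  have f2: "C1_on (\<sigma> -` fst c) (\<lambda>x. frechet_derivative (?f c i) (at x) v)" if c: "c \<in> atlas X" for c i v
  proof (rule C1_on_local)
    let ?g = "\<lambda>x. frechet_derivative (?f c i) (at x) v"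
    fix x assume "x \<in> \<sigma> -` fst c"
    then have "\<sigma> x \<in> fst c" by simp
    from loc[OF c this, of i] obtain N where "open N" "x \<in> N" "\<forall>v. C1_on N (\<lambda>x. frechet_derivative (?f c i) (at x) v)"
      by (elim exE conjE)
    then show "\<exists>N g. open N \<and> x \<in> N \<and> C1_on N g \<and> (\<forall>y\<in>N. ?g y = g y)"
      by (intro exI[of _ N] exI[of _ ?g] conjI ballI refl) (assumption | erule spec)+
  qed
  have fd: "frechet_derivative (\<lambda>x. snd c (\<sigma> x)) (at x) v = (\<chi> i. frechet_derivative (?f c i) (at x) v)"
    if c: "c \<in> atlas X" and x: "x \<in> \<sigma> -` fst c" for c x v
    by (rule fun_cong[OF frechet_derivative_at[OF has_derivative_vecI[OF C1_on_has_derivative[OF f1[OF c] x]]], symmetric])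
  have fd2: "frechet_derivative (\<lambda>x. frechet_derivative (\<lambda>x. snd c (\<sigma> x)) (at x) v) (at x) u
      = (\<chi> i. frechet_derivative (\<lambda>x. frechet_derivative (?f c i) (at x) v) (at x) u)"
    if c: "c \<in> atlas X" and x: "x \<in> \<sigma> -` fst c" for c x u v
  proof -
    have "((\<lambda>x. \<chi> i. frechet_derivative (?f c i) (at x) v) has_derivative
      (\<lambda>u. \<chi> i. frechet_derivative (\<lambda>x. frechet_derivative (?f c i) (at x) v) (at x) u)) (at x)"
      by (rule has_derivative_vecI) (simp add: C1_on_has_derivative[OF f2[OF c] x])
    then have "((\<lambda>x. frechet_derivative (\<lambda>x. snd c (\<sigma> x)) (at x) v) has_derivative
      (\<lambda>u. \<chi> i. frechet_derivative (\<lambda>x. frechet_derivative (?f c i) (at x) v) (at x) u)) (at x)"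
      by (rule has_derivative_transform_within_open[OF _ dom[OF c] x]) (rule fd[OF c, symmetric])
    then show ?thesis by (rule fun_cong[OF frechet_derivative_at, symmetric])
  qed
  have "sphere_lck_product X Y h \<theta> \<sigma>"
  proof unfold_locales
    show "\<sigma> x \<in> topspace (mtop X)" for x
      using contin unfolding \<sigma>_def continuous_map_def by (auto simp: proj_line_simps)
    show "open (\<sigma> -` U)" if "openin (mtop X) U" for U
      unfolding N_eq by (intro open_Un N that)
    fix c assume c: "c \<in> atlas X"
    show "C1_on (\<sigma> -` fst c) (\<lambda>x. snd c (\<sigma> x))" by (rule C1_on_vec[OF f1[OF c]])
    show "C1_on (\<sigma> -` fst c) (\<lambda>x. frechet_derivative (\<lambda>x. snd c (\<sigma> x)) (at x) v)" for v
      by (rule C1_on_cong[OF dom[OF c] _ fd[OF c]], rule C1_on_vec) (simp_all add: f2[OF c])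
    show "frechet_derivative (\<lambda>x. frechet_derivative (\<lambda>x. snd c (\<sigma> x)) (at x) v) (at x) u
      = frechet_derivative (\<lambda>x. frechet_derivative (\<lambda>x. snd c (\<sigma> x)) (at x) u) (at x) v" if "\<sigma> x \<in> fst c" for x u v
    proof -
      have x: "x \<in> \<sigma> -` fst c" using that by simp
      have "frechet_derivative (\<lambda>x. frechet_derivative (?f c i) (at x) v) (at x) u
        = frechet_derivative (\<lambda>x. frechet_derivative (?f c i) (at x) u) (at x) v" for i
      proof -
        from loc[OF c that, of i] have "\<forall>u v. frechet_derivative (\<lambda>x. frechet_derivative (?f c i) (at x) v) (at x) u
          = frechet_derivative (\<lambda>x. frechet_derivative (?f c i) (at x) u) (at x) v" by (elim exE conjE)
        then show ?thesis by (elim allE)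
      qed
      then show ?thesis unfolding fd2[OF c x] by (simp add: vec_eq_iff)
    qed
    show "frechet_derivative (\<lambda>x. snd c (\<sigma> x)) (at (s, \<phi>)) (0, 1)
      = (sin s * cos s) *\<^sub>R (\<i> *s frechet_derivative (\<lambda>x. snd c (\<sigma> x)) (at (s, \<phi>)) (1, 0))" if "\<sigma> (s, \<phi>) \<in> fst c" for s \<phi>
    proof -
      have x: "(s, \<phi>) \<in> \<sigma> -` fst c" using that by simp
      have "frechet_derivative (?f c i) (at (s, \<phi>)) (0, 1) = (sin s * cos s) *\<^sub>R (\<i> * frechet_derivative (?f c i) (at (s, \<phi>)) (1, 0))" for i
        using loc[OF c that, of i] unfolding fst_conv by (elim exE conjE)
      then show ?thesis unfolding fd[OF c x] by (simp add: vec_eq_iff)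
    qed
  next
    show "\<sigma> (s, \<phi> + 2 * pi) = \<sigma> (s, \<phi>)" for s \<phi>
    proof -
      have "\<i> * complex_of_real (1 * (\<phi> + 2 * pi)) = \<i> * complex_of_real (1 * \<phi>) + 2 * of_real pi * \<i>"
        by (simp add: algebra_simps)
      then have "m\<^sub>0 (s, \<phi> + 2 * pi) = m\<^sub>0 (s, \<phi>)"
        unfolding m\<^sub>0_def fst_conv snd_conv by (simp only: exp_add exp_two_pi_i mult_1_right)
      then show ?thesis by (simp add: \<sigma>_def)
    qed
    show "\<not> \<sigma> constant_on (box (0, 0) (pi / 2, 2 * pi))"
    proof
      assume "\<sigma> constant_on (box (0, 0) (pi / 2, 2 * pi))"
      then obtain q where q: "\<And>x. x \<in> box (0, 0) (pi / 2, 2 * pi) \<Longrightarrow> \<sigma> x = q" unfolding constant_on_def by blast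
      \<comment> \<open>Points on the ray of angle \<open>pi\<close>, which runs inside the open
        box; if \<open>\<sigma>\<close> were constant, infinitely many of them would lie in one
        fibre of \<open>\<nu>\<close>.\<close>
      let ?g = "\<lambda>s. Some (m\<^sub>0 (s, pi))"
      have "?g ` {0 <..< pi / 2} \<subseteq> {p. \<nu> p = q}"
      proof (rule image_subsetI)
        fix s :: real assume s: "s \<in> {0 <..< pi / 2}"
        then have "(s, pi) \<in> box (0, 0) (pi / 2, 2 * pi)" unfolding mem_rectangle using pi_gt_zero by simp
        moreover have "cos s > 0" using s by (intro cos_gt_zero) auto
        ultimately show "Some (m\<^sub>0 (s, pi)) \<in> {p. \<nu> p = q}" using q[of "(s, pi)"] by (simp add: \<sigma>_def k\<^sub>0_def)
      qed
      then have "finite (?g ` {0 <..< pi / 2})" using fin finite_subset by blast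
      moreover have "inj_on ?g {0 <..< pi / 2}"
      proof (rule inj_onI)
        fix s t :: real assume st: "s \<in> {0 <..< pi / 2}" "t \<in> {0 <..< pi / 2}" and "?g s = ?g t"
        then have "tan s = tan t" by (simp add: m\<^sub>0_def)
        then show "s = t" using st tan_monotone[of s t] tan_monotone[of t s] pi_gt_zero by (cases s t rule: linorder_cases) auto
      qed
      ultimately have "finite {0 <..< pi / 2}" by (rule finite_imageD)
      then show False using infinite_Ioo[of 0 "pi / 2"] pi_gt_zero by simp
    qed
  qed
  then show ?thesis by (rule that)
qed

theorem theorem5p1:
  fixes X :: "('a, 'n::finite) cmfd" and Y :: "('b, 'm::finite) cmfd"
    and g :: "('a, 'n) field2" and C :: "'a set"
  assumes "complex_manifold X" and "compact_space (mtop X)" and "strict_LCK_structure X g"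
    and "rational_curve X C"
    and "complex_manifold Y" and "compact_space (mtop Y)" and "CARD('m) > 0"
  shows "\<not> (\<exists>h. strict_LCK_structure (prod_cmfd X Y) h)"
proof
  assume "\<exists>h. strict_LCK_structure (prod_cmfd X Y) h"
  then obtain h \<theta> where dim: "2 \<le> CARD('n + 'm)" and herm: "hermitian_metric (prod_cmfd X Y) h"
    and lee: "lee_form (prod_cmfd X Y) h \<theta>" and strict: "\<not> GCK_structure (prod_cmfd X Y) h"
    unfolding strict_LCK_structure_def LCK_structure_def by blast
  interpret compact_lck_product X Y h \<theta>
    by unfold_locales (use assms herm lee in auto)
  obtain \<nu> where \<nu>: "is_normalisation X C proj_line \<nu>"
    using assms(4) unfolding rational_curve_def by blast
  then have hol: "holomorphic_map proj_line X \<nu>" and im: "range \<nu> = C" and fin: "\<forall>q\<in>C. finite {p. \<nu> p = q}"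
    unfolding is_normalisation_def by (simp_all add: proj_line_simps)
  have "finite {p. \<nu> p = q}" for q
  proof (cases "q \<in> C")
    case False
    then have "{p. \<nu> p = q} = {}" using im by blast
    then show ?thesis by simp
  qed (use fin in blast)
  then obtain \<sigma> where "sphere_lck_product X Y h \<theta> \<sigma>"
    using sphere_of_rational_curve[OF lck_product_axioms hol] by blast
  then interpret sphere_lck_product X Y h \<theta> \<sigma> .
  have "exact_one_form (prod_cmfd X Y) \<theta>"
    by (rule exact_of_fibre_primitive[OF \<sigma>_in sphere_fibre_primitive])
  then show False using strict dim herm lee unfolding GCK_structure_def by blast
qed

end
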